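(* Let $m,n\ge1$. The $\mathbb{C}(q^{1/2})$-linear map $\pi$ from $\mathrm{U}_q(\mathfrak{osp}(2m+1|2n),\Theta_1)$ to $\mathrm{Cl}_q(m,n)$ defined on generators by $$e_i \mapsto \phi_{i}\phi_{i+1}^{\dagger},\quad f_i \mapsto \phi_{i+1}\phi_i^{\dagger},\quad k_i\mapsto -u_i u_{i+1}^{-1}\qquad (i=1,\dots,m-1),$$ $$e_m \mapsto \phi_m\psi_1^{\dagger},\quad f_m\mapsto \phi_m^{\dagger}\psi_1,\quad k_m\mapsto u_mv_1^{-1},$$ $$e_{m+j} \mapsto \psi_{j}\psi_{j+1}^{\dagger},\quad f_{m+j} \mapsto \psi_{j+1}\psi_j^{\dagger},\quad k_{m+j}\mapsto v_j v_{j+1}^{-1}\qquad (j=1,\dots,n-1),$$ $$e_{m+n} \mapsto \sqrt{-1}\,(q^{1/2}-q^{-1/2})^{-1}\psi_n,\quad f_{m+n}\mapsto \psi_n^{\dagger},\quad k_{m+n}\mapsto \sqrt{-1}\, q^{1/2}v_n$$ is an associative superalgebra homomorphism.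
   Context: $q$ is an indeterminate over $\mathbb{C}$; all algebras are over $\mathbb{C}(q^{1/2})$; $\sqrt{-1}\in\mathbb{C}$ is the imaginary unit. For a superalgebra, $[x]\in\mathbb{Z}_2$ denotes the parity of a homogeneous element $x$. **The quantum supergroup $\mathrm{U}_q(\mathfrak{osp}(2m+1|2n),\Theta_1)$, $\Theta_1=\{m,m+n\}$.** Let $A=(a_{ij})_{1\le i,j\le m+n}$ be given by $a_{mm}=0$ and $a_{ii}=2$ for $i\ne m$; $a_{m,m+1}=1$ and $a_{i,i+1}=-1$ for $1\le i\le m+n-1$, $i\ne m$; $a_{i+1,i}=-1$ for $1\le i\le m+n-2$; $a_{m+n,m+n-1}=-2$; all other entries $0$. Let $d_i=-1$ for $1\le i\le m$, $d_i=1$ for $m<i<m+n$, $d_{m+n}=\tfrac12$, and $q_i=q^{d_i}$. $\mathrm{U}_q(\mathfrak{osp}(2m+1|2n),\Theta_1)$ is the associative superalgebra generated by $e_i,f_i,k_i^{\pm1}$ ($1\le i\le m+n$), with $e_s,f_s$ odd for $s\in\Theta_1$ and all other generators even, subject to - $k_ik_i^{-1}=k_i^{-1}k_i=1$, $k_ik_j=k_jk_i$; - $k_ie_jk_i^{-1}=q_i^{a_{ij}}e_j$, $k_if_jk_i^{-1}=q_i^{-a_{ij}}f_j$; - $e_if_j-(-1)^{[e_i][f_j]}f_je_i=\delta_{ij}\dfrac{k_i-k_i^{-1}}{q-q^{-1}}$; - $e_m^2=f_m^2=0$; - $(\mathrm{Ad}_{e_i})^{1-a_{ij}}(e_j)=(\mathrm{Ad}_{f_i})^{1-a_{ij}}(f_j)=0$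 for $a_{ii}\ne0$, $i\ne j$; - (when $m\ge2$) $\mathrm{Ad}_{e_m}\mathrm{Ad}_{e_{m-1}}\mathrm{Ad}_{e_m}(e_{m+1})=0$, $\mathrm{Ad}_{f_m}\mathrm{Ad}_{f_{m-1}}\mathrm{Ad}_{f_m}(f_{m+1})=0$, where, for homogeneous $x$, $\mathrm{Ad}_{e_i}(x)=e_ix-(-1)^{[e_i][x]}k_ixk_i^{-1}e_i$ and $\mathrm{Ad}_{f_i}(x)=f_ix-(-1)^{[f_i][x]}k_i^{-1}xk_if_i$. **The deformed Clifford superalgebra $\mathrm{Cl}_q(m,n)$** is the associative superalgebra generated by bosonic generators $\phi_i,\phi_i^\dagger,u_i^{\pm1}$ ($1\le i\le m$) and fermionic generators $\psi_j,\psi_j^\dagger,v_j^{\pm1}$ ($1\le j\le n$), with $\psi_j,\psi_j^\dagger$ odd and all other generators even, subject to the following relations. Fermionic: - $v_iv_j=v_jv_i$, $v_iv_i^{-1}=v_i^{-1}v_i=1$; - $v_i\psi_jv_i^{-1}=q^{\delta_{ij}}\psi_j$, $v_i\psi_j^\dagger v_i^{-1}=q^{-\delta_{ij}}\psi_j^\dagger$; - $\psi_i\psi_j+\psi_j\psi_i=\psi_i^\dagger\psi_j^\dagger+\psi_j^\dagger\psi_i^\dagger=0$; - $\psi_i\psi_j^\dagger+\psi_j^\dagger\psi_i=0$ for $i\ne j$; - $\psi_i\psi_i^\dagger+q\psi_i^\dagger\psi_i=v_i^{-1}$, $\psi_i\psi_i^\dagger+q^{-1}\psi_i^\dagger\psi_i=v_i$.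 Bosonic: - $u_iu_j=u_ju_i$, $u_iu_i^{-1}=u_i^{-1}u_i=1$; - $u_i\phi_ju_i^{-1}=q^{-\delta_{ij}}\phi_j$, $u_i\phi_j^\dagger u_i^{-1}=q^{\delta_{ij}}\phi_j^\dagger$; - $\phi_i\phi_j-\phi_j\phi_i=\phi_i^\dagger\phi_j^\dagger-\phi_j^\dagger\phi_i^\dagger=0$; - $\phi_i\phi_j^\dagger-\phi_j^\dagger\phi_i=0$ for $i\ne j$; - $\phi_i\phi_i^\dagger-q\phi_i^\dagger\phi_i=u_i^{-1}$, $\phi_i\phi_i^\dagger-q^{-1}\phi_i^\dagger\phi_i=u_i$. Moreover every bosonic generator commutes with every fermionic generator. *)

theory Defs
  imports
    "HOL-Library.Poly_Mapping"
    "HOL-Library.Z2"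
    "HOL-Computational_Algebra.Polynomial"
    "HOL-Computational_Algebra.Fraction_Field"
    "HOL-Algebra.QuotRing"
    "HOL-Algebra.Module"
    "HOL-Algebra.Algebraic_Closure_Type"
begin

section \<open>Superalgebras over a field\<close>

record ('k, 'a) superalg = "('k, 'a) module" +
  grade :: "bit \<Rightarrow> 'a set"

text \<open>The base field is the type \<open>'k\<close>; unital, associative, not necessarily commutative.\<close>

locale superalgebra =
  module "ring_of_type_algebra :: 'k ring" A + ring A
  for A :: "('k::field, 'a, 'm) superalg_scheme" (structure) +
  assumes smult_mult_left:
      "\<lbrakk>x \<in> carrier A; y \<in> carrier A\<rbrakk> \<Longrightarrow> (c \<odot> x) \<otimes> y = c \<odot> (x \<otimes> y)"
    and smult_mult_right:
      "\<lbrakk>x \<in> carrier A; y \<in> carrier A\<rbrakk> \<Longrightarrow> x \<otimes> (c \<odot> y) = c \<odot> (x \<otimes> y)"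
    and grade_subgroup: "additive_subgroup (grade A s) A"
    and grade_smult: "x \<in> grade A s \<Longrightarrow> c \<odot> x \<in> grade A s"
    and grade_sum: "x \<in> carrier A \<Longrightarrow> \<exists>a\<in>grade A 0. \<exists>b\<in>grade A 1. x = a \<oplus> b"
    and grade_direct: "grade A 0 \<inter> grade A 1 = {\<zero>}"
    and grade_mult: "\<lbrakk>x \<in> grade A s; y \<in> grade A t\<rbrakk> \<Longrightarrow> x \<otimes> y \<in> grade A (s + t)"

locale superalgebra_hom = A: superalgebra A + B: superalgebra B
  for A :: "('k::field, 'a, 'm) superalg_scheme"
    and B :: "('k, 'b, 'n) superalg_scheme"
    and h :: "'a \<Rightarrow> 'b" +
  assumes ring_hom: "h \<in> ring_hom A B"
    and hom_smult: "x \<in> carrier A \<Longrightarrow> h (c \<odot>\<^bsub>A\<^esub> x) = c \<odot>\<^bsub>B\<^esub> h x"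
    and hom_grade: "x \<in> grade A s \<Longrightarrow> h x \<in> grade B s"


section \<open>Superalgebras given by generators and relations\<close>

datatype 'g word = Word (letters: "'g list")

instantiation word :: (type) monoid_add
begin
definition zero_word :: "'a word" where "0 = Word []"
definition plus_word :: "'a word \<Rightarrow> 'a word \<Rightarrow> 'a word"
  where "w + w' = Word (letters w @ letters w')"
instance
  by standard (simp_all add: zero_word_def plus_word_def)
end

text \<open>Finitely supported functions on words, with convolution product: the free associative
  algebra on the type \<open>'g\<close>.\<close>

type_synonym ('g, 'k) free_alg = "'g word \<Rightarrow>\<^sub>0 'k"

definition gen :: "'g \<Rightarrow> ('g, 'k::field) free_alg"
  where "gen g = Poly_Mapping.single (Word [g]) 1"

definition scal :: "'k::field \<Rightarrow> ('g, 'k) free_alg \<Rightarrow> ('g, 'k) free_alg"  (infixr \<open>*\<^sub>F\<close> 75)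
  where "c *\<^sub>F x = Poly_Mapping.single 0 c * x"

definition word_parity :: "('g \<Rightarrow> bit) \<Rightarrow> 'g word \<Rightarrow> bit"
  where "word_parity p w = (\<Sum>g\<leftarrow>letters w. p g)"

definition free_superalgebra ::
    "'g set \<Rightarrow> ('g \<Rightarrow> bit) \<Rightarrow> ('k::field, ('g, 'k) free_alg) superalg"
  where "free_superalgebra G p =
    \<lparr>carrier = {x. \<forall>w\<in>Poly_Mapping.keys x. set (letters w) \<subseteq> G},
     monoid.mult = (*), one = 1, ring.zero = 0, add = (+), module.smult = (*\<^sub>F),
     grade = (\<lambda>s. {x. \<forall>w\<in>Poly_Mapping.keys x. set (letters w) \<subseteq> G \<and> word_parity p w = s})\<rparr>"

definition quotient_superalgebra ::
    "('k, 'a, 'm) superalg_scheme \<Rightarrow> 'a set \<Rightarrow> ('k, 'a set) superalg"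
  where "quotient_superalgebra A I =
    \<lparr>carrier = carrier (A Quot I), monoid.mult = monoid.mult (A Quot I), one = monoid.one (A Quot I),
     ring.zero = ring.zero (A Quot I), add = ring.add (A Quot I),
     module.smult = (\<lambda>c C. \<Union>x\<in>C. I +>\<^bsub>A\<^esub> (c \<odot>\<^bsub>A\<^esub> x)),
     grade = (\<lambda>s. (\<lambda>x. I +>\<^bsub>A\<^esub> x) ` grade A s)\<rparr>"

text \<open>A relation \<open>x = y\<close> is recorded as the element \<open>x - y\<close> of the free algebra.
  (\<^const>\<open>genideal\<close> is the two-sided ideal generated by a set.)\<close>

definition presented_superalgebra ::
    "'g set \<Rightarrow> ('g \<Rightarrow> bit) \<Rightarrow> ('g, 'k::field) free_alg set \<Rightarrow>
     ('k, ('g, 'k) free_alg set) superalg"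
  where "presented_superalgebra G p R =
    quotient_superalgebra (free_superalgebra G p) (Idl\<^bsub>free_superalgebra G p\<^esub> R)"

definition presented_class ::
    "'g set \<Rightarrow> ('g \<Rightarrow> bit) \<Rightarrow> ('g, 'k::field) free_alg set \<Rightarrow>
     ('g, 'k) free_alg \<Rightarrow> ('g, 'k) free_alg set"
  where "presented_class G p R x =
    (Idl\<^bsub>free_superalgebra G p\<^esub> R) +>\<^bsub>free_superalgebra G p\<^esub> x"

text \<open>The Koszul sign \<open>(-1)\<^sup>s\<^sup>t\<close>.\<close>

definition koszul :: "bit \<Rightarrow> bit \<Rightarrow> 'k::field"
  where "koszul s t = (if s = 1 \<and> t = 1 then - 1 else 1)"

text \<open>Meaningful only for homogeneous nonzero \<open>x\<close>.\<close>

definition parity_of :: "('g \<Rightarrow> bit) \<Rightarrow> ('g, 'k::field) free_alg \<Rightarrow> bit"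
  where "parity_of p x = (if \<forall>w\<in>Poly_Mapping.keys x. word_parity p w = 1 then 1 else 0)"


section \<open>The base field\<close>

text \<open>The field \<open>\<complex>(q\<^sup>1\<^sup>/\<^sup>2)\<close> is the field of rational functions over \<open>\<complex>\<close> whose
  indeterminate is \<open>q\<^sup>1\<^sup>/\<^sup>2\<close>, here called \<open>qh\<close>.\<close>

type_synonym qfield = "complex poly fract"

definition qh :: qfield where "qh = Fract [:0, 1:] 1"

definition qq :: qfield where "qq = qh ^ 2"

definition qI :: qfield where "qI = Fract [:\<i>:] 1"


section \<open>The quantum supergroup\<close>

datatype osp_gen = E_gen nat | F_gen nat | K_gen nat | Kinv_gen nat

type_synonym osp_free = "(osp_gen, qfield) free_alg"

abbreviation gE :: "nat \<Rightarrow> osp_free" where "gE i \<equiv> gen (E_gen i)"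
abbreviation gF :: "nat \<Rightarrow> osp_free" where "gF i \<equiv> gen (F_gen i)"
abbreviation gK :: "nat \<Rightarrow> osp_free" where "gK i \<equiv> gen (K_gen i)"
abbreviation gKinv :: "nat \<Rightarrow> osp_free" where "gKinv i \<equiv> gen (Kinv_gen i)"

definition osp_gens :: "nat \<Rightarrow> nat \<Rightarrow> osp_gen set"
  where "osp_gens m n = (\<Union>i\<in>{1..m+n}. {E_gen i, F_gen i, K_gen i, Kinv_gen i})"

fun osp_parity :: "nat \<Rightarrow> nat \<Rightarrow> osp_gen \<Rightarrow> bit" where
  "osp_parity m n (E_gen i) = (if i \<in> {m, m+n} then 1 else 0)"
| "osp_parity m n (F_gen i) = (if i \<in> {m, m+n} then 1 else 0)"
| "osp_parity m n (K_gen i) = 0"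
| "osp_parity m n (Kinv_gen i) = 0"

definition osp_a :: "nat \<Rightarrow> nat \<Rightarrow> nat \<Rightarrow> nat \<Rightarrow> int"
  where "osp_a m n i j =
    (if j = i then (if i = m then 0 else 2)
     else if j = i + 1 then (if i = m then 1 else - 1)
     else if i = j + 1 then (if i = m + n then - 2 else - 1)
     else 0)"

text \<open>This is \<open>2 d\<^sub>i\<close>, so that \<open>q\<^sub>i = qh\<close> to the power \<open>osp_dd m n i\<close>.\<close>

definition osp_dd :: "nat \<Rightarrow> nat \<Rightarrow> nat \<Rightarrow> int"
  where "osp_dd m n i = (if i \<le> m then - 2 else if i < m + n then 2 else 1)"

definition osp_q :: "nat \<Rightarrow> nat \<Rightarrow> nat \<Rightarrow> qfield"
  where "osp_q m n i = qh powi osp_dd m n i"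

definition AdE :: "nat \<Rightarrow> nat \<Rightarrow> nat \<Rightarrow> osp_free \<Rightarrow> osp_free"
  where "AdE m n i x =
    gE i * x - koszul (osp_parity m n (E_gen i)) (parity_of (osp_parity m n) x)
                 *\<^sub>F (gK i * x * gKinv i * gE i)"

definition AdF :: "nat \<Rightarrow> nat \<Rightarrow> nat \<Rightarrow> osp_free \<Rightarrow> osp_free"
  where "AdF m n i x =
    gF i * x - koszul (osp_parity m n (F_gen i)) (parity_of (osp_parity m n) x)
                 *\<^sub>F (gKinv i * x * gK i * gF i)"

definition osp_rels :: "nat \<Rightarrow> nat \<Rightarrow> osp_free set"
  where "osp_rels m n =
    (let N = {1..m+n}; a = osp_a m n; q = osp_q m n; par = osp_parity m n in
      {gK i * gKinv i - 1 | i. i \<in> N}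
    \<union> {gKinv i * gK i - 1 | i. i \<in> N}
    \<union> {gK i * gK j - gK j * gK i | i j. i \<in> N \<and> j \<in> N}
    \<union> {gK i * gE j * gKinv i - (q i powi a i j) *\<^sub>F gE j | i j. i \<in> N \<and> j \<in> N}
    \<union> {gK i * gF j * gKinv i - (q i powi (- a i j)) *\<^sub>F gF j | i j. i \<in> N \<and> j \<in> N}
    \<union> {gE i * gF j - koszul (par (E_gen i)) (par (F_gen j)) *\<^sub>F (gF j * gE i)
         - (if i = j then inverse (qq - inverse qq) *\<^sub>F (gK i - gKinv i) else 0)
       | i j. i \<in> N \<and> j \<in> N}
    \<union> {gE m * gE m, gF m * gF m}
    \<union> {(AdE m n i ^^ nat (1 - a i j)) (gE j) | i j. i \<in> N \<and> j \<in> N \<and> a i i \<noteq> 0 \<and> i \<noteq> j}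
    \<union> {(AdF m n i ^^ nat (1 - a i j)) (gF j) | i j. i \<in> N \<and> j \<in> N \<and> a i i \<noteq> 0 \<and> i \<noteq> j}
    \<union> (if m \<ge> 2 then
         {AdE m n m (AdE m n (m - 1) (AdE m n m (gE (m + 1)))),
          AdF m n m (AdF m n (m - 1) (AdF m n m (gF (m + 1))))}
       else {}))"

definition Uq_osp :: "nat \<Rightarrow> nat \<Rightarrow> (qfield, osp_free set) superalg"
  where "Uq_osp m n = presented_superalgebra (osp_gens m n) (osp_parity m n) (osp_rels m n)"

definition Uq_class :: "nat \<Rightarrow> nat \<Rightarrow> osp_free \<Rightarrow> osp_free set"
  where "Uq_class m n = presented_class (osp_gens m n) (osp_parity m n) (osp_rels m n)"


section \<open>The deformed Clifford superalgebra\<close>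

datatype cl_gen =
    Phi_gen nat | PhiD_gen nat | U_gen nat | Uinv_gen nat
  | Psi_gen nat | PsiD_gen nat | V_gen nat | Vinv_gen nat

type_synonym cl_free = "(cl_gen, qfield) free_alg"

abbreviation phi :: "nat \<Rightarrow> cl_free" where "phi i \<equiv> gen (Phi_gen i)"
abbreviation phiD :: "nat \<Rightarrow> cl_free" where "phiD i \<equiv> gen (PhiD_gen i)"
abbreviation gu :: "nat \<Rightarrow> cl_free" where "gu i \<equiv> gen (U_gen i)"
abbreviation guinv :: "nat \<Rightarrow> cl_free" where "guinv i \<equiv> gen (Uinv_gen i)"
abbreviation psi :: "nat \<Rightarrow> cl_free" where "psi j \<equiv> gen (Psi_gen j)"
abbreviation psiD :: "nat \<Rightarrow> cl_free" where "psiD j \<equiv> gen (PsiD_gen j)"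
abbreviation gv :: "nat \<Rightarrow> cl_free" where "gv j \<equiv> gen (V_gen j)"
abbreviation gvinv :: "nat \<Rightarrow> cl_free" where "gvinv j \<equiv> gen (Vinv_gen j)"

definition bos_gens :: "nat \<Rightarrow> cl_gen set"
  where "bos_gens m = (\<Union>i\<in>{1..m}. {Phi_gen i, PhiD_gen i, U_gen i, Uinv_gen i})"

definition ferm_gens :: "nat \<Rightarrow> cl_gen set"
  where "ferm_gens n = (\<Union>j\<in>{1..n}. {Psi_gen j, PsiD_gen j, V_gen j, Vinv_gen j})"

fun cl_parity :: "cl_gen \<Rightarrow> bit" where
  "cl_parity (Psi_gen j) = 1"
| "cl_parity (PsiD_gen j) = 1"
| "cl_parity _ = 0"

definition ferm_rels :: "nat \<Rightarrow> cl_free set"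
  where "ferm_rels n =
    (let N = {1..n}; \<delta> = (\<lambda>i j::nat. if i = j then 1 else 0 :: int) in
      {gv i * gv j - gv j * gv i | i j. i \<in> N \<and> j \<in> N}
    \<union> {gv i * gvinv i - 1 | i. i \<in> N}
    \<union> {gvinv i * gv i - 1 | i. i \<in> N}
    \<union> {gv i * psi j * gvinv i - (qq powi \<delta> i j) *\<^sub>F psi j | i j. i \<in> N \<and> j \<in> N}
    \<union> {gv i * psiD j * gvinv i - (qq powi (- \<delta> i j)) *\<^sub>F psiD j | i j. i \<in> N \<and> j \<in> N}
    \<union> {psi i * psi j + psi j * psi i | i j. i \<in> N \<and> j \<in> N}
    \<union> {psiD i * psiD j + psiD j * psiD i | i j. i \<in> N \<and> j \<in> N}
    \<union> {psi i * psiD j + psiD j * psi i | i j. i \<in> N \<and> j \<in> N \<and> i \<noteq> j}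
    \<union> {psi i * psiD i + qq *\<^sub>F (psiD i * psi i) - gvinv i | i. i \<in> N}
    \<union> {psi i * psiD i + inverse qq *\<^sub>F (psiD i * psi i) - gv i | i. i \<in> N})"

definition bos_rels :: "nat \<Rightarrow> cl_free set"
  where "bos_rels m =
    (let N = {1..m}; \<delta> = (\<lambda>i j::nat. if i = j then 1 else 0 :: int) in
      {gu i * gu j - gu j * gu i | i j. i \<in> N \<and> j \<in> N}
    \<union> {gu i * guinv i - 1 | i. i \<in> N}
    \<union> {guinv i * gu i - 1 | i. i \<in> N}
    \<union> {gu i * phi j * guinv i - (qq powi (- \<delta> i j)) *\<^sub>F phi j | i j. i \<in> N \<and> j \<in> N}
    \<union> {gu i * phiD j * guinv i - (qq powi \<delta> i j) *\<^sub>F phiD j | i j. i \<in> N \<and> j \<in> N}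
    \<union> {phi i * phi j - phi j * phi i | i j. i \<in> N \<and> j \<in> N}
    \<union> {phiD i * phiD j - phiD j * phiD i | i j. i \<in> N \<and> j \<in> N}
    \<union> {phi i * phiD j - phiD j * phi i | i j. i \<in> N \<and> j \<in> N \<and> i \<noteq> j}
    \<union> {phi i * phiD i - qq *\<^sub>F (phiD i * phi i) - guinv i | i. i \<in> N}
    \<union> {phi i * phiD i - inverse qq *\<^sub>F (phiD i * phi i) - gu i | i. i \<in> N})"

definition cl_rels :: "nat \<Rightarrow> nat \<Rightarrow> cl_free set"
  where "cl_rels m n = ferm_rels n \<union> bos_rels m
    \<union> {gen b * gen c - gen c * gen b | b c. b \<in> bos_gens m \<and> c \<in> ferm_gens n}"

definition Cl_q :: "nat \<Rightarrow> nat \<Rightarrow> (qfield, cl_free set) superalg"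
  where "Cl_q m n = presented_superalgebra (bos_gens m \<union> ferm_gens n) cl_parity (cl_rels m n)"

definition Cl_class :: "nat \<Rightarrow> nat \<Rightarrow> cl_free \<Rightarrow> cl_free set"
  where "Cl_class m n = presented_class (bos_gens m \<union> ferm_gens n) cl_parity (cl_rels m n)"

end

theory Submission
  imports Defs
begin

text \<open>A homomorphism out of an algebra given by generators and relations exists as soon as the
  prescribed images satisfy the relations, and it is determined by the images of the generators;
  the images of the \<open>k\<^sub>i\<^sup>-\<^sup>1\<close>, which are not prescribed, are forced because they are inverses. So
  everything rests on the relations of the quantum supergroup holding among the images.

  Those become short once the bosons and the fermions are read as one system of deformed
  oscillators. Put \<open>N = m + n\<close>, let \<open>(A\<^sub>i, D\<^sub>i, w\<^sub>i)\<close> be \<open>(\<phi>\<^sub>i, \<phi>\<^sub>i\<^sup>\<dagger>, u\<^sub>i)\<close> for \<open>i \<le> m\<close> and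
  \<open>(\<psi>\<^sub>j, \<psi>\<^sub>j\<^sup>\<dagger>, v\<^sub>j)\<close> for \<open>i = m + j\<close>, and let the sign \<open>s\<^sub>i\<close> be \<open>1\<close> for a boson and \<open>-1\<close> for a fermion.
  Then \<open>A\<^sub>i D\<^sub>i - s\<^sub>i q D\<^sub>i A\<^sub>i = w\<^sub>i\<^sup>-\<^sup>1\<close>, \<open>A\<^sub>i D\<^sub>i - s\<^sub>i q\<^sup>-\<^sup>1 D\<^sub>i A\<^sub>i = w\<^sub>i\<close>, conjugation by \<open>w\<^sub>i\<close> multiplies
  \<open>A\<^sub>i\<close> by \<open>q\<close> to the power \<open>- s\<^sub>i\<close> and \<open>D\<^sub>i\<close> by the inverse scalar, and letters of different
  index supercommute. With a scalar letter of index \<open>N + 1\<close> the last node is no exception: the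
  images are \<open>e\<^sub>i = A\<^sub>i D\<^sub>i\<^sub>+\<^sub>1\<close>,
  \<open>f\<^sub>i = A\<^sub>i\<^sub>+\<^sub>1 D\<^sub>i\<close> and \<open>k\<^sub>i = \<kappa>\<^sub>i w\<^sub>i w\<^sub>i\<^sub>+\<^sub>1\<^sup>-\<^sup>1\<close> with scalars \<open>\<kappa>\<^sub>i\<close>.

  Now the weights of \<open>e\<^sub>j\<close> and \<open>f\<^sub>j\<close> under \<open>k\<^sub>i\<close> are sums of four contributions; \<open>e\<^sub>i\<close> and \<open>f\<^sub>j\<close> with
  \<open>i \<noteq> j\<close> supercommute because their letters do; and \<open>e\<^sub>i f\<^sub>i\<close>, \<open>f\<^sub>i e\<^sub>i\<close> are products of the elements
  \<open>A\<^sub>i D\<^sub>i\<close> and \<open>D\<^sub>i A\<^sub>i\<close>, which are linear in \<open>w\<^sub>i\<close> and \<open>w\<^sub>i\<^sup>-\<^sup>1\<close> (\<open>number_operators\<close>, \<open>E_F_diagonal\<close>,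
  \<open>E_F_last\<close>). Since every \<open>k\<^sub>i\<close> acts on the image of a generator by a scalar, the adjoint actions
  turn into twisted commutators \<open>x y - c y x\<close> and the Serre relations into polynomial identities.
  Between nodes that are not neighbours they hold because the letters supercommute; at
  the nodes \<open>i > m\<close> they hold because \<open>A\<^sub>i\<^sup>2 = D\<^sub>i\<^sup>2 = 0\<close> for fermions. At the nodes \<open>i < m\<close>, and for the
  additional relation at the isotropic node \<open>m\<close> (\<open>extra_serre\<close>), they reduce by pulling out commuting
  factors to the identity \<open>A A D - (q + q\<^sup>-\<^sup>1) A D A + D A A = 0\<close> of a single boson and its mirror
  image (\<open>boson_serre\<close>).

  To calculate modulo the relations of the Clifford superalgebra by equational reasoning, its
  elements are mapped into one ring type that contains all quotients of the free algebra.\<close>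

section \<open>Quotients of superalgebras by homogeneous ideals\<close>

abbreviation scalars :: "'k::field ring"
  where "scalars \<equiv> ring_of_type_algebra"

lemma carrier_scalars [simp]: "c \<in> carrier (scalars :: 'k::field ring)"
  by (simp add: ring_of_type_algebra_def)

lemma add_scalars [simp]: "a \<oplus>\<^bsub>(scalars :: 'k::field ring)\<^esub> b = a + b"
  and mult_scalars [simp]: "a \<otimes>\<^bsub>(scalars :: 'k::field ring)\<^esub> b = a * b"
  and one_scalars [simp]: "\<one>\<^bsub>(scalars :: 'k::field ring)\<^esub> = 1"
  by (simp_all add: ring_of_type_algebra_def)

text \<open>Exactly what makes the images of the even and the odd part meet only in zero in the quotient.\<close>

definition homogeneous :: "('k, 'a, 'm) superalg_scheme \<Rightarrow> 'a set \<Rightarrow> bool"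
  where "homogeneous A I \<longleftrightarrow>
    (\<forall>x\<in>I. \<exists>a\<in>grade A 0 \<inter> I. \<exists>b\<in>grade A 1 \<inter> I. x = a \<oplus>\<^bsub>A\<^esub> b)"

context superalgebra
begin

lemma grade_subset: "grade A s \<subseteq> carrier A"
  using additive_subgroup.a_subset[OF grade_subgroup] .

lemma grade_closed: "x \<in> grade A s \<Longrightarrow> x \<in> carrier A"
  using grade_subset by blast

lemma grade_add: "x \<in> grade A s \<Longrightarrow> y \<in> grade A s \<Longrightarrow> x \<oplus> y \<in> grade A s"
  using additive_subgroup.a_closed[OF grade_subgroup] .

lemma grade_minus: "x \<in> grade A s \<Longrightarrow> y \<in> grade A s \<Longrightarrow> x \<ominus> y \<in> grade A s"
  unfolding a_minus_def
  by (simp add: additive_subgroup.a_closed[OF grade_subgroup]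
      additive_subgroup.a_inv_closed[OF grade_subgroup])

lemma grade_zero: "\<zero> \<in> grade A s"
  using additive_subgroup.zero_closed[OF grade_subgroup] .

lemma smult_ideal:
  assumes "ideal I A" and "x \<in> I"
  shows "c \<odot> x \<in> I"
proof -
  interpret I: ideal I A by fact
  have x: "x \<in> carrier A" using assms(2) by (rule I.a_Hcarr)
  have "(c \<odot> \<one>) \<otimes> x = c \<odot> x" using x by (simp add: smult_mult_left)
  then show ?thesis using I.I_l_closed[OF assms(2), of "c \<odot> \<one>"] by simp
qed

end

text \<open>The set of elements of an ideal whose two homogeneous components also lie in the ideal is
  itself an ideal; so an ideal generated by homogeneous elements is homogeneous.\<close>

lemma (in superalgebra) homogeneous_genideal:
  assumes R: "R \<subseteq> grade A 0 \<union> grade A 1"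
  shows "homogeneous A (Idl R)"
proof -
  have Rc: "R \<subseteq> carrier A" using R grade_subset by blast
  define I where "I = Idl R"
  have I: "ideal I A" unfolding I_def by (rule genideal_ideal[OF Rc])
  interpret I: ideal I A by fact
  define J where "J = {x. \<exists>a\<in>grade A 0 \<inter> I. \<exists>b\<in>grade A 1 \<inter> I. x = a \<oplus> b}"
  have Jc: "J \<subseteq> carrier A"
    unfolding J_def using grade_closed by auto
  have mult: "x \<otimes> y \<in> J" "y \<otimes> x \<in> J" if x: "x \<in> J" and y: "y \<in> carrier A" for x y
  proof -
    obtain a b where ab: "a \<in> grade A 0" "a \<in> I" "b \<in> grade A 1" "b \<in> I" "x = a \<oplus> b"
      using x unfolding J_def by blast
    obtain c d where cd: "c \<in> grade A 0" "d \<in> grade A 1" "y = c \<oplus> d"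
      using grade_sum[OF y] by blast
    note car = ab(1,3)[THEN grade_closed] cd(1,2)[THEN grade_closed]
    have "x \<otimes> y = (a \<otimes> c \<oplus> b \<otimes> d) \<oplus> (a \<otimes> d \<oplus> b \<otimes> c)"
      unfolding ab(5) cd(3) using car by algebra
    moreover have "a \<otimes> c \<oplus> b \<otimes> d \<in> grade A 0 \<inter> I"
      using grade_mult[OF ab(1) cd(1)] grade_mult[OF ab(3) cd(2)] car ab
      by (auto intro!: grade_add I.a_closed I.I_r_closed)
    moreover have "a \<otimes> d \<oplus> b \<otimes> c \<in> grade A 1 \<inter> I"
      using grade_mult[OF ab(1) cd(2)] grade_mult[OF ab(3) cd(1)] car ab
      by (auto intro!: grade_add I.a_closed I.I_r_closed)
    ultimately show "x \<otimes> y \<in> J" unfolding J_def by blast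
    have "y \<otimes> x = (c \<otimes> a \<oplus> d \<otimes> b) \<oplus> (d \<otimes> a \<oplus> c \<otimes> b)"
      unfolding ab(5) cd(3) using car by algebra
    moreover have "c \<otimes> a \<oplus> d \<otimes> b \<in> grade A 0 \<inter> I"
      using grade_mult[OF cd(1) ab(1)] grade_mult[OF cd(2) ab(3)] car ab
      by (auto intro!: grade_add I.a_closed I.I_l_closed)
    moreover have "d \<otimes> a \<oplus> c \<otimes> b \<in> grade A 1 \<inter> I"
      using grade_mult[OF cd(2) ab(1)] grade_mult[OF cd(1) ab(3)] car ab
      by (auto intro!: grade_add I.a_closed I.I_l_closed)
    ultimately show "y \<otimes> x \<in> J" unfolding J_def by blast
  qed
  have "ideal J A"
  proof (rule idealI)
    show "ring A" by (rule ring_axioms)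
    show "subgroup J (add_monoid A)"
    proof (rule add.subgroupI)
      show "J \<subseteq> carrier A" by fact
      have "\<zero> \<in> J" unfolding J_def using grade_zero I.zero_closed
        by (auto intro!: bexI[of _ \<zero>])
      then show "J \<noteq> {}" by blast
    next
      fix x assume "x \<in> J"
      then obtain a b where ab: "a \<in> grade A 0" "a \<in> I" "b \<in> grade A 1" "b \<in> I" "x = a \<oplus> b"
        unfolding J_def by blast
      have "\<ominus> x = \<ominus> a \<oplus> \<ominus> b"
        unfolding ab(5) using ab(1,3)[THEN grade_closed] by algebra
      moreover have "\<ominus> a \<in> grade A 0 \<inter> I" "\<ominus> b \<in> grade A 1 \<inter> I"
        using ab by (auto intro: additive_subgroup.a_inv_closed[OF grade_subgroup] I.a_inv_closed)
      ultimately show "\<ominus> x \<in> J" unfolding J_def by blast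
    next
      fix x y assume "x \<in> J" "y \<in> J"
      then obtain a b c d where
        ab: "a \<in> grade A 0" "a \<in> I" "b \<in> grade A 1" "b \<in> I" "x = a \<oplus> b" and
        cd: "c \<in> grade A 0" "c \<in> I" "d \<in> grade A 1" "d \<in> I" "y = c \<oplus> d"
        unfolding J_def by blast
      have "x \<oplus> y = (a \<oplus> c) \<oplus> (b \<oplus> d)"
        unfolding ab(5) cd(5) using ab(1,3)[THEN grade_closed] cd(1,3)[THEN grade_closed] by algebra
      moreover have "a \<oplus> c \<in> grade A 0 \<inter> I" "b \<oplus> d \<in> grade A 1 \<inter> I"
        using ab cd by (auto intro: grade_add I.a_closed)
      ultimately show "x \<oplus> y \<in> J" unfolding J_def by blast
    qed
  qed (use mult in auto)
  moreover have "R \<subseteq> J"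
  proof
    fix r assume r: "r \<in> R"
    have "r \<in> I" unfolding I_def using genideal_self[OF Rc] r by blast
    then have "r \<in> carrier A" by (rule I.a_Hcarr)
    then have "r = r \<oplus> \<zero>" "r = \<zero> \<oplus> r" by simp_all
    then show "r \<in> J" using \<open>r \<in> I\<close> r R grade_zero I.zero_closed unfolding J_def by blast
  qed
  ultimately have "I \<subseteq> J" unfolding I_def by (rule genideal_minimal)
  then show ?thesis unfolding homogeneous_def I_def[symmetric] J_def by blast
qed

text \<open>The ring axioms mention only the five ring components, so they pass to a record with more fields.\<close>

lemma ring_cong:
  assumes "ring A" and "carrier B = carrier A" "monoid.mult B = monoid.mult A"
    "monoid.one B = monoid.one A" "ring.zero B = ring.zero A" "ring.add B = ring.add A"
  shows "ring B"
proof -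
  interpret ring A by fact
  show ?thesis
  proof (rule ringI)
    show "abelian_group B"
    proof (rule abelian_groupI)
      show "\<exists>y\<in>carrier B. y \<oplus>\<^bsub>B\<^esub> x = \<zero>\<^bsub>B\<^esub>" if "x \<in> carrier B" for x
        using that by (intro bexI[of _ "\<ominus>\<^bsub>A\<^esub> x"]) (simp_all add: assms(2-) l_neg)
    qed (simp_all add: assms(2-) a_ac)
    show "Group.monoid B"
      by (rule monoidI) (simp_all add: assms(2-) m_assoc)
  qed (simp_all add: assms(2-) l_distr r_distr)
qed

context superalgebra
begin

lemma coset_eq_iff:
  assumes "ideal I A" "x \<in> carrier A" "y \<in> carrier A"
  shows "I +> x = I +> y \<longleftrightarrow> x \<ominus> y \<in> I"
  using ring.quotient_eq_iff_same_a_r_cos[OF ring_axioms assms] by simp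

lemma quotient_simps:
  shows "carrier (quotient_superalgebra A I) = (\<lambda>x. I +> x) ` carrier A"
    and "\<one>\<^bsub>quotient_superalgebra A I\<^esub> = I +> \<one>"
    and "\<zero>\<^bsub>quotient_superalgebra A I\<^esub> = I"
    and "grade (quotient_superalgebra A I) s = (\<lambda>x. I +> x) ` grade A s"
  by (auto simp: quotient_superalgebra_def FactRing_simps)

lemma quotient_add:
  assumes "ideal I A" "x \<in> carrier A" "y \<in> carrier A"
  shows "(I +> x) \<oplus>\<^bsub>quotient_superalgebra A I\<^esub> (I +> y) = I +> (x \<oplus> y)"
  using ideal.a_rcos_sum[OF assms] by (simp add: quotient_superalgebra_def FactRing_def)

lemma quotient_mult:
  assumes "ideal I A" "x \<in> carrier A" "y \<in> carrier A"
  shows "(I +> x) \<otimes>\<^bsub>quotient_superalgebra A I\<^esub> (I +> y) = I +> (x \<otimes> y)"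
  using ideal.rcoset_mult_add[OF assms] by (simp add: quotient_superalgebra_def FactRing_def)

lemma quotient_smult:
  assumes I: "ideal I A" and x: "x \<in> carrier A"
  shows "c \<odot>\<^bsub>quotient_superalgebra A I\<^esub> (I +> x) = I +> (c \<odot> x)"
proof -
  interpret I: ideal I A by fact
  have "I +> (c \<odot> y) = I +> (c \<odot> x)" if y: "y \<in> I +> x" for y
  proof -
    obtain h where h: "h \<in> I" "y = h \<oplus> x"
      using y unfolding a_r_coset_def r_coset_def by auto
    have hc: "h \<in> carrier A" using h(1) by (rule I.a_Hcarr)
    have "c \<odot> y \<ominus> c \<odot> x = c \<odot> h"
    proof -
      have "c \<odot> h \<in> carrier A" "c \<odot> x \<in> carrier A" using hc x by simp_all
      then have "(c \<odot> h \<oplus> c \<odot> x) \<ominus> c \<odot> x = c \<odot> h"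
        by (simp add: a_minus_def a_assoc r_neg)
      then show ?thesis unfolding h(2) using hc x by (simp add: smult_r_distr)
    qed
    then show ?thesis
      using coset_eq_iff[OF I, of "c \<odot> y" "c \<odot> x"] smult_ideal[OF I h(1)] hc x h(2) by simp
  qed
  moreover have "x \<in> I +> x" using x by (rule I.a_rcos_self)
  ultimately have "(\<Union>y\<in>I +> x. I +> (c \<odot> y)) = I +> (c \<odot> x)" by blast
  then show ?thesis by (simp add: quotient_superalgebra_def)
qed

theorem superalgebra_quotient:
  assumes I: "ideal I A" and hom: "homogeneous A I"
  shows "superalgebra (quotient_superalgebra A I)" (is "superalgebra ?Q")
proof -
  interpret I: ideal I A by fact
  note simps = quotient_simps quotient_add[OF I] quotient_mult[OF I] quotient_smult[OF I]
  have ring: "ring ?Q"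
    by (rule ring_cong[OF I.quotient_is_ring]) (simp_all add: quotient_superalgebra_def)
  interpret Q: ring ?Q by fact
  have mod: "module scalars ?Q"
  proof (rule moduleI)
    show "cring (scalars :: 'k ring)" by (rule cring_from_type_algebra)
    show "abelian_group ?Q" by (rule Q.abelian_group_axioms)
    fix a b :: 'k and C D
    assume "C \<in> carrier ?Q" "D \<in> carrier ?Q"
    then obtain x y where xy: "x \<in> carrier A" "C = I +> x" "y \<in> carrier A" "D = I +> y"
      by (auto simp: simps)
    show "a \<odot>\<^bsub>?Q\<^esub> C \<in> carrier ?Q"
      using xy by (simp add: simps)
    show "(a \<oplus>\<^bsub>scalars\<^esub> b) \<odot>\<^bsub>?Q\<^esub> C = (a \<odot>\<^bsub>?Q\<^esub> C) \<oplus>\<^bsub>?Q\<^esub> (b \<odot>\<^bsub>?Q\<^esub> C)"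
      using xy smult_l_distr[of a b x] by (simp add: simps)
    show "a \<odot>\<^bsub>?Q\<^esub> (C \<oplus>\<^bsub>?Q\<^esub> D) = (a \<odot>\<^bsub>?Q\<^esub> C) \<oplus>\<^bsub>?Q\<^esub> (a \<odot>\<^bsub>?Q\<^esub> D)"
      using xy smult_r_distr[of a x y] by (simp add: simps)
    show "(a \<otimes>\<^bsub>scalars\<^esub> b) \<odot>\<^bsub>?Q\<^esub> C = a \<odot>\<^bsub>?Q\<^esub> (b \<odot>\<^bsub>?Q\<^esub> C)"
      using xy smult_assoc1[of a b x] by (simp add: simps)
    show "\<one>\<^bsub>(scalars :: 'k ring)\<^esub> \<odot>\<^bsub>?Q\<^esub> C = C"
      using xy smult_one[of x] by (simp add: simps)
  qed
  have coset_add: "(\<lambda>x. I +> x) \<in> hom (add_monoid A) (add_monoid ?Q)"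
    by (rule homI) (auto simp: simps)
  show ?thesis
  proof (intro superalgebra.intro superalgebra_axioms.intro mod ring)
    show "additive_subgroup (grade ?Q s) ?Q" for s
    proof (rule additive_subgroupI)
      have "group_hom (add_monoid A) (add_monoid ?Q) (\<lambda>x. I +> x)"
        using coset_add a_group Q.a_group by (simp add: group_hom_def group_hom_axioms_def)
      from group_hom.subgroup_img_is_subgroup[OF this additive_subgroup.a_subgroup[OF grade_subgroup]]
      show "subgroup (grade ?Q s) (add_monoid ?Q)" by (simp add: simps)
    qed
    show "\<exists>a\<in>grade ?Q 0. \<exists>b\<in>grade ?Q 1. C = a \<oplus>\<^bsub>?Q\<^esub> b" if C: "C \<in> carrier ?Q" for C
    proof -
      obtain x where x: "x \<in> carrier A" "C = I +> x" using C by (auto simp: simps)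
      obtain a b where "a \<in> grade A 0" "b \<in> grade A 1" "x = a \<oplus> b" using grade_sum[OF x(1)] by blast
      then show ?thesis using grade_closed x by (auto simp: simps)
    qed
    show "grade ?Q 0 \<inter> grade ?Q 1 = {\<zero>\<^bsub>?Q\<^esub>}"
    proof
      show "{\<zero>\<^bsub>?Q\<^esub>} \<subseteq> grade ?Q 0 \<inter> grade ?Q 1"
        using grade_zero[of 0] grade_zero[of 1] a_rcos_zero[OF I I.zero_closed]
        by (auto simp: simps intro!: image_eqI[of _ _ \<zero>])
      show "grade ?Q 0 \<inter> grade ?Q 1 \<subseteq> {\<zero>\<^bsub>?Q\<^esub>}"
      proof
        fix C assume "C \<in> grade ?Q 0 \<inter> grade ?Q 1"
        then obtain x y where xy: "x \<in> grade A 0" "y \<in> grade A 1" "C = I +> x" "C = I +> y"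
          by (auto simp: simps)
        note car = xy(1,2)[THEN grade_closed]
        have "x \<ominus> y \<in> I" using coset_eq_iff[OF I car] xy by simp
        then obtain a b where ab: "a \<in> grade A 0" "a \<in> I" "b \<in> grade A 1" "b \<in> I" "x \<ominus> y = a \<oplus> b"
          using hom unfolding homogeneous_def by blast
        \<comment> \<open>Comparing components in \<open>x - y = a + b\<close> gives \<open>x = a\<close>.\<close>
        note car' = ab(1,3)[THEN grade_closed]
        have "x \<ominus> a = (x \<ominus> y) \<oplus> (y \<ominus> a)" using car car' by algebra
        also have "\<dots> = y \<oplus> b" unfolding ab(5) using car car' by algebra
        finally have "x \<ominus> a \<in> grade A 1" using grade_add[OF xy(2) ab(3)] by simp
        then have "x \<ominus> a = \<zero>" using grade_minus[OF xy(1) ab(1)] grade_direct by blast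
        then have "x = a" using car car' by simp
        then show "C \<in> {\<zero>\<^bsub>?Q\<^esub>}" using xy(3) ab(2) a_rcos_zero[OF I] by (simp add: simps)
      qed
    qed
    show "C \<otimes>\<^bsub>?Q\<^esub> D \<in> grade ?Q (s + t)" if CD: "C \<in> grade ?Q s" "D \<in> grade ?Q t" for C D s t
    proof -
      obtain x y where "x \<in> grade A s" "C = I +> x" "y \<in> grade A t" "D = I +> y"
        using CD by (auto simp: simps)
      then show ?thesis using grade_mult[of x s y t] by (simp add: simps grade_closed)
    qed
  qed (auto simp: simps smult_mult_left smult_mult_right grade_closed
       intro!: imageI grade_smult)
qed

end

lemma (in superalgebra_hom) hom_closed: "x \<in> carrier A \<Longrightarrow> h x \<in> carrier B"
  using ring_hom by (rule ring_hom_closed)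

text \<open>The induced map takes the value of \<open>h\<close> on any representative, since \<open>h\<close> maps \<open>I\<close> into \<open>J\<close>.
  Requiring it to be extensional makes it a definite function on the whole type.\<close>

lemma superalgebra_hom_quotient:
  assumes h: "superalgebra_hom A B h"
    and I: "ideal I A" "homogeneous A I" and J: "ideal J B" "homogeneous B J"
    and IJ: "h ` I \<subseteq> J"
  shows "\<exists>\<pi>. \<pi> \<in> extensional (carrier (quotient_superalgebra A I))
    \<and> superalgebra_hom (quotient_superalgebra A I) (quotient_superalgebra B J) \<pi>
    \<and> (\<forall>x\<in>carrier A. \<pi> (I +>\<^bsub>A\<^esub> x) = J +>\<^bsub>B\<^esub> h x)"
proof -
  interpret superalgebra_hom A B h by fact
  let ?Q = "quotient_superalgebra A I" and ?S = "quotient_superalgebra B J"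
  interpret h: ring_hom_ring A B h
    by (intro ring_hom_ringI2 A.ring_axioms B.ring_axioms ring_hom)
  define \<pi> where "\<pi> = restrict (\<lambda>C. J +>\<^bsub>B\<^esub> h (SOME x. x \<in> carrier A \<and> C = I +>\<^bsub>A\<^esub> x)) (carrier ?Q)"
  have \<pi>: "\<pi> (I +>\<^bsub>A\<^esub> x) = J +>\<^bsub>B\<^esub> h x" if x: "x \<in> carrier A" for x
  proof -
    define y where "y = (SOME y. y \<in> carrier A \<and> I +>\<^bsub>A\<^esub> x = I +>\<^bsub>A\<^esub> y)"
    have y: "y \<in> carrier A" "I +>\<^bsub>A\<^esub> x = I +>\<^bsub>A\<^esub> y"
      using someI[of "\<lambda>y. y \<in> carrier A \<and> I +>\<^bsub>A\<^esub> x = I +>\<^bsub>A\<^esub> y" x] x unfolding y_def by auto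
    then have "y \<ominus>\<^bsub>A\<^esub> x \<in> I" using A.coset_eq_iff[OF I(1)] x by metis
    then have "h (y \<ominus>\<^bsub>A\<^esub> x) \<in> J" using IJ by blast
    then have "h y \<ominus>\<^bsub>B\<^esub> h x \<in> J" using x y(1) by (simp add: a_minus_def)
    then have "J +>\<^bsub>B\<^esub> h y = J +>\<^bsub>B\<^esub> h x" using B.coset_eq_iff[OF J(1)] x y(1) by simp
    then show ?thesis unfolding \<pi>_def using x by (simp add: A.quotient_simps y_def)
  qed
  have "superalgebra_hom ?Q ?S \<pi>"
  proof (intro superalgebra_hom.intro superalgebra_hom_axioms.intro)
    show "superalgebra ?Q" by (rule A.superalgebra_quotient[OF I])
    show "superalgebra ?S" by (rule B.superalgebra_quotient[OF J])
    show "\<pi> \<in> ring_hom ?Q ?S"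
      by (rule ring_hom_memI)
        (auto simp: A.quotient_simps B.quotient_simps A.quotient_add[OF I(1)] A.quotient_mult[OF I(1)]
          B.quotient_add[OF J(1)] B.quotient_mult[OF J(1)] \<pi>)
  qed (auto simp: A.quotient_simps B.quotient_simps A.quotient_smult[OF I(1)]
       B.quotient_smult[OF J(1)] \<pi> A.grade_closed hom_smult intro!: imageI hom_grade)
  then show ?thesis using \<pi> by (auto intro!: exI[of _ \<pi>] simp: \<pi>_def)
qed

text \<open>The preimage of an ideal is an ideal, so it contains \<open>Idl R\<close> as soon as it contains \<open>R\<close>.\<close>

lemma image_genideal_subset:
  assumes h: "superalgebra_hom A B h" and R: "R \<subseteq> carrier A" and J: "ideal J B" and RJ: "h ` R \<subseteq> J"
  shows "h ` (Idl\<^bsub>A\<^esub> R) \<subseteq> J"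
proof -
  interpret superalgebra_hom A B h by fact
  interpret h: ring_hom_ring A B h
    by (intro ring_hom_ringI2 A.ring_axioms B.ring_axioms ring_hom)
  have "Idl\<^bsub>A\<^esub> R \<subseteq> {r \<in> carrier A. h r \<in> J}"
    using R RJ by (intro A.genideal_minimal h.ideal_vimage[OF J]) auto
  then show ?thesis by blast
qed

section \<open>The free superalgebra and its substitution homomorphisms\<close>

abbreviation keys :: "('a \<Rightarrow>\<^sub>0 'b::zero) \<Rightarrow> 'a set"
  where "keys \<equiv> Poly_Mapping.keys"

abbreviation lookup :: "('a \<Rightarrow>\<^sub>0 'b::zero) \<Rightarrow> 'a \<Rightarrow> 'b"
  where "lookup \<equiv> poly_mapping.lookup"

lemma letters_zero [simp]: "letters 0 = []"
  and letters_plus [simp]: "letters (v + w) = letters v @ letters w"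
  by (simp_all add: zero_word_def plus_word_def)

lemma word_parity_zero [simp]: "word_parity p 0 = 0"
  and word_parity_plus [simp]: "word_parity p (v + w) = word_parity p v + word_parity p w"
  by (simp_all add: word_parity_def)

lemma single_0_central: "Poly_Mapping.single 0 c * x = x * Poly_Mapping.single 0 c"
  for x :: "'a::monoid_add \<Rightarrow>\<^sub>0 'b::comm_ring_1"
proof (induction x rule: update_induct)
  case const
  then show ?case by simp
next
  case (update f a b)
  have "Poly_Mapping.update a b f = f + Poly_Mapping.single a b"
    using update.hyps
    by (intro poly_mapping_eqI) (auto simp: lookup_update lookup_add lookup_single when_def in_keys_iff)
  then show ?case using update.IH by (simp add: algebra_simps mult_single)
qed

lemma lookup_scal: "lookup (c *\<^sub>F x) w = c * lookup x w"
  unfolding scal_def by (simp add: mult_map_scale_conv_mult[symmetric] Poly_Mapping.map.rep_eq when_def)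

lemma keys_scal: "keys (c *\<^sub>F x) \<subseteq> keys x"
  by (auto simp: in_keys_iff lookup_scal)

lemma scal_mult_left: "(c *\<^sub>F x) * y = c *\<^sub>F (x * y)"
  by (simp add: scal_def mult.assoc)

lemma scal_mult_right: "x * (c *\<^sub>F y) = c *\<^sub>F (x * y)"
  by (simp add: scal_def single_0_central[of c] mult.assoc)

lemma scal_scal: "c *\<^sub>F d *\<^sub>F x = (c * d) *\<^sub>F x"
  by (simp add: scal_def mult.assoc[symmetric] mult_single)

lemma scal_one [simp]: "1 *\<^sub>F x = x"
  by (simp add: scal_def)

lemma scal_zero [simp]: "0 *\<^sub>F x = 0" "c *\<^sub>F 0 = 0"
  by (simp_all add: scal_def)

lemma scal_add_left: "(c + d) *\<^sub>F x = c *\<^sub>F x + d *\<^sub>F x"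
  and scal_add_right: "c *\<^sub>F (x + y) = c *\<^sub>F x + c *\<^sub>F y"
  by (simp_all add: scal_def single_add algebra_simps)

lemma single_eq_scal: "Poly_Mapping.single w c = c *\<^sub>F Poly_Mapping.single w 1"
  by (simp add: scal_def mult_single)

lemma single_Word_Cons: "Poly_Mapping.single (Word (g # gs)) 1 = gen g * Poly_Mapping.single (Word gs) 1"
  by (simp add: gen_def mult_single plus_word_def)

lemma single_Word_Nil: "Poly_Mapping.single (Word []) 1 = 1"
  by (metis single_one zero_word_def)

lemma sum_keys_single: "(\<Sum>w\<in>keys x. Poly_Mapping.single w (lookup x w)) = x"
  by (rule poly_mapping_eqI) (simp add: lookup_sum lookup_single when_def sum.delta in_keys_iff)

text \<open>The algebra homomorphism that replaces every generator \<open>g\<close> by \<open>f g\<close>.\<close>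

definition subst :: "('g \<Rightarrow> ('h, 'k) free_alg) \<Rightarrow> ('g, 'k::field) free_alg \<Rightarrow> ('h, 'k) free_alg"
  where "subst f x = (\<Sum>w\<in>keys x. lookup x w *\<^sub>F prod_list (map f (letters w)))"

lemma subst_eq_sum:
  assumes "finite W" "keys x \<subseteq> W"
  shows "subst f x = (\<Sum>w\<in>W. lookup x w *\<^sub>F prod_list (map f (letters w)))"
  unfolding subst_def using assms by (intro sum.mono_neutral_left) (auto simp: in_keys_iff)

lemma subst_zero [simp]: "subst f 0 = 0"
  by (simp add: subst_def)

lemma subst_single [simp]:
  "subst f (Poly_Mapping.single w c) = c *\<^sub>F prod_list (map f (letters w))"
  by (cases "c = 0") (simp_all add: subst_def)

lemma subst_add [simp]: "subst f (x + y) = subst f x + subst f y"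
proof -
  have "subst f (x + y) = (\<Sum>w\<in>keys x \<union> keys y. lookup (x + y) w *\<^sub>F prod_list (map f (letters w)))"
    by (rule subst_eq_sum) (simp_all add: keys_add)
  also have "\<dots> = subst f x + subst f y"
    by (simp add: lookup_add scal_add_left sum.distrib subst_eq_sum[of "keys x \<union> keys y"])
  finally show ?thesis .
qed

lemma subst_sum: "subst f (sum g S) = (\<Sum>i\<in>S. subst f (g i))"
  by (induction S rule: infinite_finite_induct) auto

lemma subst_uminus [simp]: "subst f (- x) = - subst f x"
  by (rule minus_unique[symmetric]) (simp add: subst_add[symmetric] del: subst_add)

lemma subst_diff [simp]: "subst f (x - y) = subst f x - subst f y"
  using subst_add[of f x "- y"] by simp

lemma subst_one [simp]: "subst f 1 = 1"
  using subst_single[of f 0 1] by simp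

lemma subst_gen [simp]: "subst f (gen g) = f g"
  by (simp add: gen_def)

lemma subst_mult [simp]: "subst f (x * y) = subst f x * subst f y"
proof -
  \<comment> \<open>Both sides are bilinear in \<open>x\<close> and \<open>y\<close>, so they need only agree on multiples of words.\<close>
  have "subst f (Poly_Mapping.single v c * Poly_Mapping.single w d)
      = subst f (Poly_Mapping.single v c) * subst f (Poly_Mapping.single w d)" for v w c d
    by (simp add: mult_single scal_mult_left scal_mult_right scal_scal mult.commute[of d c])
  then have "subst f ((\<Sum>v\<in>keys x. Poly_Mapping.single v (lookup x v))
        * (\<Sum>w\<in>keys y. Poly_Mapping.single w (lookup y w)))
      = subst f (\<Sum>v\<in>keys x. Poly_Mapping.single v (lookup x v))
        * subst f (\<Sum>w\<in>keys y. Poly_Mapping.single w (lookup y w))"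
    by (simp add: sum_product subst_sum)
  then show ?thesis by (simp only: sum_keys_single)
qed

lemma subst_scal [simp]: "subst f (c *\<^sub>F x) = c *\<^sub>F subst f x"
  by (simp add: scal_def)

lemma free_simps:
  "carrier (free_superalgebra G p) = {x. \<forall>w\<in>keys x. set (letters w) \<subseteq> G}"
  "x \<otimes>\<^bsub>free_superalgebra G p\<^esub> y = x * y"
  "x \<oplus>\<^bsub>free_superalgebra G p\<^esub> y = x + y"
  "\<one>\<^bsub>free_superalgebra G p\<^esub> = 1"
  "\<zero>\<^bsub>free_superalgebra G p\<^esub> = 0"
  "c \<odot>\<^bsub>free_superalgebra G p\<^esub> x = c *\<^sub>F x"
  "grade (free_superalgebra G p) s =
    {x. \<forall>w\<in>keys x. set (letters w) \<subseteq> G \<and> word_parity p w = s}"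
  by (simp_all add: free_superalgebra_def)

lemma free_grade_iff: "x \<in> grade (free_superalgebra G p) s \<longleftrightarrow>
    keys x \<subseteq> {w. set (letters w) \<subseteq> G \<and> word_parity p w = s}"
  and free_carrier_iff: "x \<in> carrier (free_superalgebra G p) \<longleftrightarrow> keys x \<subseteq> {w. set (letters w) \<subseteq> G}"
  by (auto simp: free_simps)

lemma keys_subset_closed:
  assumes "keys x \<subseteq> S"
  shows "keys (- x) \<subseteq> S" "keys (c *\<^sub>F x) \<subseteq> S"
    "keys y \<subseteq> S \<Longrightarrow> keys (x + y) \<subseteq> S" "keys y \<subseteq> S \<Longrightarrow> keys (x - y) \<subseteq> S"
proof -
  show "keys (- x) \<subseteq> S" using assms by (auto simp: in_keys_iff)
  show "keys (c *\<^sub>F x) \<subseteq> S" using assms keys_scal[of c x] by blast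
  show "keys (x + y) \<subseteq> S" if "keys y \<subseteq> S" using assms that keys_add[of x y] by blast
  show "keys (x - y) \<subseteq> S" if "keys y \<subseteq> S"
  proof
    fix w assume "w \<in> keys (x - y)"
    then have "w \<in> keys x \<or> w \<in> keys y" by (auto simp: in_keys_iff lookup_minus)
    then show "w \<in> S" using assms that by blast
  qed
qed

context
  fixes G :: "'g set" and p :: "'g \<Rightarrow> bit"
begin

abbreviation FA :: "('k::field, ('g, 'k) free_alg) superalg"
  where "FA \<equiv> free_superalgebra G p"

lemma free_graded:
  "0 \<in> grade FA s" "1 \<in> grade FA 0"
  "gen g \<in> grade FA s \<longleftrightarrow> g \<in> G \<and> p g = s"
  "x \<in> grade FA s \<Longrightarrow> - x \<in> grade FA s"
  "x \<in> grade FA s \<Longrightarrow> c *\<^sub>F x \<in> grade FA s"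
  "x \<in> grade FA s \<Longrightarrow> y \<in> grade FA s \<Longrightarrow> x + y \<in> grade FA s"
  "x \<in> grade FA s \<Longrightarrow> y \<in> grade FA s \<Longrightarrow> x - y \<in> grade FA s"
  by (simp_all add: free_grade_iff keys_subset_closed gen_def word_parity_def)

lemma free_graded_mult:
  "x \<in> grade FA s \<Longrightarrow> y \<in> grade FA t \<Longrightarrow> x * y \<in> grade FA (s + t)"
  unfolding free_grade_iff using keys_mult[of x y] by fastforce

lemma free_closed:
  "0 \<in> carrier FA" "1 \<in> carrier FA"
  "gen g \<in> carrier FA \<longleftrightarrow> g \<in> G"
  "x \<in> carrier FA \<Longrightarrow> - x \<in> carrier FA"
  "x \<in> carrier FA \<Longrightarrow> c *\<^sub>F x \<in> carrier FA"
  "x \<in> carrier FA \<Longrightarrow> y \<in> carrier FA \<Longrightarrow> x + y \<in> carrier FA"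
  "x \<in> carrier FA \<Longrightarrow> y \<in> carrier FA \<Longrightarrow> x - y \<in> carrier FA"
  by (simp_all add: free_carrier_iff keys_subset_closed gen_def)

lemma free_closed_mult:
  "x \<in> carrier FA \<Longrightarrow> y \<in> carrier FA \<Longrightarrow> x * y \<in> carrier FA"
  unfolding free_carrier_iff using keys_mult[of x y] by fastforce

lemma free_graded_sum: "(\<And>i. i \<in> S \<Longrightarrow> h i \<in> grade FA s) \<Longrightarrow> sum h S \<in> grade FA s"
  by (induction S rule: infinite_finite_induct) (auto simp: free_graded)

theorem superalgebra_free: "superalgebra (FA :: ('k::field, ('g, 'k) free_alg) superalg)"
proof -
  let ?A = "FA :: ('k, ('g, 'k) free_alg) superalg"
  have add: "abelian_group ?A"
  proof (rule abelian_groupI)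
    show "\<exists>y\<in>carrier ?A. y \<oplus>\<^bsub>?A\<^esub> x = \<zero>\<^bsub>?A\<^esub>" if "x \<in> carrier ?A" for x
      using free_closed(4)[OF that] by (intro bexI[of _ "- x"]) (simp_all add: free_simps)
  qed (use free_closed in \<open>auto simp: free_simps(2-)\<close>)
  have ring: "ring ?A"
  proof (rule ringI)
    show "Group.monoid ?A"
      by (rule monoidI) (use free_closed free_closed_mult in \<open>auto simp: free_simps(2-) mult.assoc\<close>)
  qed (use add in \<open>auto simp: free_simps(2-) algebra_simps\<close>)
  interpret ring ?A by fact
  have mod: "module scalars ?A"
    by (rule moduleI)
      (use add free_closed in \<open>auto simp: free_simps(2-) scal_add_left scal_add_right scal_scal
        intro: cring_from_type_algebra\<close>)
  have neg: "\<ominus>\<^bsub>?A\<^esub> x = - x" if "x \<in> carrier ?A" for x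
    using that free_closed(4)[OF that] by (intro minus_equality) (simp_all add: free_simps)
  show ?thesis
  proof (intro superalgebra.intro superalgebra_axioms.intro mod ring)
    show "additive_subgroup (grade ?A s) ?A" for s
    proof (intro additive_subgroupI add.subgroupI)
      show "grade ?A s \<subseteq> carrier ?A" by (auto simp: free_simps)
      then show "\<ominus>\<^bsub>?A\<^esub> x \<in> grade ?A s" if "x \<in> grade ?A s" for x
        using that neg[of x] free_graded(4)[OF that] by auto
      have "0 \<in> grade ?A s" by (rule free_graded(1))
      then show "grade ?A s \<noteq> {}" by blast
    qed (auto simp: free_simps(2-6) free_graded)
    show "\<exists>a\<in>grade ?A 0. \<exists>b\<in>grade ?A 1. x = a \<oplus>\<^bsub>?A\<^esub> b" if x: "x \<in> carrier ?A" for x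
    proof -
      \<comment> \<open>The homogeneous components collect the words of either parity.\<close>
      let ?W = "\<lambda>s. {w \<in> keys x. word_parity p w = s}"
      let ?P = "\<lambda>s. \<Sum>w\<in>?W s. Poly_Mapping.single w (lookup x w)"
      have "?P s \<in> grade ?A s" for s
        using x by (intro free_graded_sum) (auto simp: free_simps)
      moreover have "x = ?P 0 + ?P 1"
      proof -
        have "keys x = ?W 0 \<union> ?W 1" by (auto simp: bit_not_one_iff)
        then have "(\<Sum>w\<in>keys x. Poly_Mapping.single w (lookup x w)) = ?P 0 + ?P 1"
          by (subst sum.union_disjoint[symmetric]) auto
        then show ?thesis by (simp add: sum_keys_single)
      qed
      ultimately show ?thesis by (auto simp: free_simps(3))
    qed
    show "grade ?A 0 \<inter> grade ?A 1 = {\<zero>\<^bsub>?A\<^esub>}"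
      by (auto simp: free_simps)
    show "x \<otimes>\<^bsub>?A\<^esub> y \<in> grade ?A (s + t)" if "x \<in> grade ?A s" "y \<in> grade ?A t" for x y s t
      using free_graded_mult[OF that] by (simp only: free_simps(2))
  qed (auto simp: free_simps(2-6) scal_mult_left scal_mult_right free_graded)
qed

text \<open>Words are reached by adding letters on the left, everything else by linear combination.\<close>

lemma free_induct [consumes 1, case_names one gen add scal]:
  assumes x: "x \<in> carrier (FA :: ('k::field, ('g, 'k) free_alg) superalg)"
    and one: "P 1"
    and gen: "\<And>g y. g \<in> G \<Longrightarrow> y \<in> carrier FA \<Longrightarrow> P y \<Longrightarrow> P (gen g * y)"
    and add: "\<And>y z. y \<in> carrier FA \<Longrightarrow> z \<in> carrier FA \<Longrightarrow> P y \<Longrightarrow> P z \<Longrightarrow> P (y + z)"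
    and scal: "\<And>c y. y \<in> carrier FA \<Longrightarrow> P y \<Longrightarrow> P (c *\<^sub>F y)"
  shows "P x"
proof -
  have word: "P (Poly_Mapping.single (Word gs) 1)" if "set gs \<subseteq> G" for gs
    using that
  proof (induction gs)
    case Nil
    then show ?case using one by (simp add: single_Word_Nil)
  next
    case (Cons g gs)
    then show ?case
      using gen[of g "Poly_Mapping.single (Word gs) 1"] by (simp add: single_Word_Cons free_carrier_iff)
  qed
  have "P (\<Sum>w\<in>W. Poly_Mapping.single w (lookup x w))
      \<and> (\<Sum>w\<in>W. Poly_Mapping.single w (lookup x w)) \<in> carrier FA"
    if "finite W" "W \<subseteq> keys x" for W
    using that
  proof (induction W rule: finite_induct)
    case empty
    then show ?case using scal[OF free_closed(2) one, of 0] free_closed(1) by simp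
  next
    case (insert w W)
    then have w: "set (letters w) \<subseteq> G" using x by (auto simp: free_simps)
    have "P (Poly_Mapping.single w (lookup x w))"
      using scal[OF _ word[OF w], of "lookup x w"] w
      by (subst single_eq_scal) (simp add: free_carrier_iff)
    moreover have "Poly_Mapping.single w (lookup x w) \<in> carrier FA" using w by (simp add: free_carrier_iff)
    ultimately show ?case using insert add by (simp add: free_closed(6))
  qed
  from this[of "keys x"] show ?thesis by (simp add: sum_keys_single)
qed

end

lemma subst_word_graded:
  assumes f: "\<And>g. g \<in> G \<Longrightarrow> f g \<in> grade (free_superalgebra G' p') (p g)" and "set gs \<subseteq> G"
  shows "prod_list (map f gs) \<in> grade (free_superalgebra G' p') (\<Sum>g\<leftarrow>gs. p g)"
  using assms(2) by (induction gs) (simp_all only: list.map prod_list.Nil prod_list.Cons sum_list.Nil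
    sum_list.Cons free_graded list.set insert_subset f free_graded_mult)

lemma superalgebra_hom_subst:
  fixes f :: "'g \<Rightarrow> ('h, 'k::field) free_alg"
  assumes f: "\<And>g. g \<in> G \<Longrightarrow> f g \<in> grade (free_superalgebra G' p') (p g)"
  shows "superalgebra_hom (free_superalgebra G p) (free_superalgebra G' p') (subst f)"
proof -
  interpret A: superalgebra "free_superalgebra G p :: ('k, ('g, 'k) free_alg) superalg"
    by (rule superalgebra_free)
  interpret B: superalgebra "free_superalgebra G' p' :: ('k, ('h, 'k) free_alg) superalg"
    by (rule superalgebra_free)
  have grade: "subst f x \<in> grade (free_superalgebra G' p') s"
    if x: "x \<in> grade (free_superalgebra G p) s" for x s
    unfolding subst_def
  proof (rule free_graded_sum)
    fix w assume "w \<in> keys x"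
    then have w: "set (letters w) \<subseteq> G" "word_parity p w = s"
      using x by (auto simp: free_simps)
    show "lookup x w *\<^sub>F prod_list (map f (letters w)) \<in> grade (free_superalgebra G' p') s"
      using subst_word_graded[where f=f and G=G and p=p, OF f w(1)] w(2)
      by (simp only: word_parity_def[symmetric] free_graded)
  qed
  have carrier: "subst f x \<in> carrier (free_superalgebra G' p')"
    if x: "x \<in> carrier (free_superalgebra G p)" for x
  proof -
    obtain a b where ab: "a \<in> grade (free_superalgebra G p) 0" "b \<in> grade (free_superalgebra G p) 1"
      "x = a + b"
      using A.grade_sum[OF x] by (auto simp: free_simps(3))
    then show ?thesis using grade[OF ab(1)] grade[OF ab(2)] B.grade_closed by (auto intro: free_closed)
  qed
  show ?thesis
    by (intro superalgebra_hom.intro superalgebra_hom_axioms.intro superalgebra_free ring_hom_memI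
        grade carrier) (simp_all only: free_simps(2-6) subst_mult subst_add subst_one subst_scal)
qed

section \<open>Superalgebras given by generators and relations\<close>

definition homogeneous_relations :: "'g set \<Rightarrow> ('g \<Rightarrow> bit) \<Rightarrow> ('g, 'k::field) free_alg set \<Rightarrow> bool"
  where "homogeneous_relations G p R \<longleftrightarrow>
    R \<subseteq> grade (free_superalgebra G p) 0 \<union> grade (free_superalgebra G p) 1"

context
  fixes G :: "'g set" and p :: "'g \<Rightarrow> bit" and R :: "('g, 'k::field) free_alg set"
  assumes R: "homogeneous_relations G p R"
begin

interpretation A: superalgebra "free_superalgebra G p :: ('k, ('g, 'k) free_alg) superalg"
  by (rule superalgebra_free)

lemma relations_subset: "R \<subseteq> carrier (free_superalgebra G p)"
  using R A.grade_subset unfolding homogeneous_relations_def by blast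

lemma ideal_relations: "ideal (Idl\<^bsub>free_superalgebra G p\<^esub> R) (free_superalgebra G p)"
  by (rule A.genideal_ideal[OF relations_subset])

lemma relation_in_ideal: "r \<in> R \<Longrightarrow> r \<in> Idl\<^bsub>free_superalgebra G p\<^esub> R"
  using A.genideal_self[OF relations_subset] by blast

lemma homogeneous_relation_ideal:
  "homogeneous (free_superalgebra G p) (Idl\<^bsub>free_superalgebra G p\<^esub> R)"
  using R unfolding homogeneous_relations_def by (rule A.homogeneous_genideal)

lemma presented_carrier:
  "carrier (presented_superalgebra G p R) = presented_class G p R ` carrier (free_superalgebra G p)"
  unfolding presented_superalgebra_def presented_class_def[abs_def] by (rule A.quotient_simps)

lemma presented_class_eq_iff:
  assumes "x \<in> carrier (free_superalgebra G p)" "y \<in> carrier (free_superalgebra G p)"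
  shows "presented_class G p R x = presented_class G p R y \<longleftrightarrow> x - y \<in> Idl\<^bsub>free_superalgebra G p\<^esub> R"
proof -
  have neg: "\<ominus>\<^bsub>free_superalgebra G p\<^esub> y = - y"
    using assms(2) free_closed(4)[OF assms(2)] by (intro A.minus_equality) (simp_all add: free_simps)
  show ?thesis
    unfolding presented_class_def A.coset_eq_iff[OF ideal_relations assms]
    by (simp add: a_minus_def neg) (simp add: free_simps)
qed

lemma presented_ops:
  assumes "x \<in> carrier (free_superalgebra G p)" "y \<in> carrier (free_superalgebra G p)"
  shows "presented_class G p R x \<otimes>\<^bsub>presented_superalgebra G p R\<^esub> presented_class G p R y
      = presented_class G p R (x * y)"
    and "presented_class G p R x \<oplus>\<^bsub>presented_superalgebra G p R\<^esub> presented_class G p R y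
      = presented_class G p R (x + y)"
    and "c \<odot>\<^bsub>presented_superalgebra G p R\<^esub> presented_class G p R x = presented_class G p R (c *\<^sub>F x)"
  using A.quotient_mult[OF ideal_relations assms] A.quotient_add[OF ideal_relations assms]
    A.quotient_smult[OF ideal_relations assms(1)]
  by (simp_all add: presented_superalgebra_def presented_class_def free_simps(2-6))

lemma presented_one: "\<one>\<^bsub>presented_superalgebra G p R\<^esub> = presented_class G p R 1"
  unfolding presented_superalgebra_def presented_class_def A.quotient_simps by (simp only: free_simps(4))

theorem presented_hom_unique:
  assumes h: "superalgebra_hom (presented_superalgebra G p R) B h"
    and h': "superalgebra_hom (presented_superalgebra G p R) B h'"
    and gen: "\<And>g. g \<in> G \<Longrightarrow> h (presented_class G p R (gen g)) = h' (presented_class G p R (gen g))"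
    and a: "a \<in> carrier (presented_superalgebra G p R)"
  shows "h a = h' a"
proof -
  interpret h: superalgebra_hom "presented_superalgebra G p R" B h by fact
  interpret h': superalgebra_hom "presented_superalgebra G p R" B h' by fact
  note [simp] = presented_ops[symmetric]
  have closed: "presented_class G p R x \<in> carrier (presented_superalgebra G p R)"
    if "x \<in> carrier (free_superalgebra G p)" for x
    using that by (simp add: presented_carrier)
  have "h (presented_class G p R x) = h' (presented_class G p R x)"
    if "x \<in> carrier (free_superalgebra G p)" for x
    using that
  proof (induction x rule: free_induct)
    case one
    then show ?case
      using ring_hom_one[OF h.ring_hom] ring_hom_one[OF h'.ring_hom] by (simp add: presented_one)
  next
    case (gen g y)
    have g: "(Defs.gen g :: ('g, 'k) free_alg) \<in> carrier (free_superalgebra G p)"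
      using gen.hyps by (simp add: free_closed)
    show ?case
      using assms(3)[OF gen.hyps(1)] gen.IH g gen.hyps
      by (simp add: closed ring_hom_mult[OF h.ring_hom] ring_hom_mult[OF h'.ring_hom])
  next
    case (add y z)
    then show ?case
      by (simp add: closed ring_hom_add[OF h.ring_hom] ring_hom_add[OF h'.ring_hom])
  next
    case (scal c y)
    then show ?case by (simp add: closed h.hom_smult h'.hom_smult)
  qed
  then show ?thesis using a by (auto simp: presented_carrier)
qed

end

text \<open>The universal property of a presentation: the substitution homomorphism descends to the quotients.\<close>

theorem presented_hom_exists:
  fixes f :: "'g \<Rightarrow> ('h, 'k::field) free_alg"
  assumes R: "homogeneous_relations G p R" and R': "homogeneous_relations G' p' R'"
    and f: "\<And>g. g \<in> G \<Longrightarrow> f g \<in> grade (free_superalgebra G' p') (p g)"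
    and fR: "\<And>r. r \<in> R \<Longrightarrow> subst f r \<in> Idl\<^bsub>free_superalgebra G' p'\<^esub> R'"
  shows "\<exists>\<pi>. \<pi> \<in> extensional (carrier (presented_superalgebra G p R))
    \<and> superalgebra_hom (presented_superalgebra G p R) (presented_superalgebra G' p' R') \<pi>
    \<and> (\<forall>x\<in>carrier (free_superalgebra G p).
        \<pi> (presented_class G p R x) = presented_class G' p' R' (subst f x))"
proof -
  have h: "superalgebra_hom (free_superalgebra G p) (free_superalgebra G' p') (subst f)"
    by (rule superalgebra_hom_subst[OF f])
  note ideal = ideal_relations[OF R] homogeneous_relation_ideal[OF R]
  note ideal' = ideal_relations[OF R'] homogeneous_relation_ideal[OF R']
  have "subst f ` (Idl\<^bsub>free_superalgebra G p\<^esub> R) \<subseteq> Idl\<^bsub>free_superalgebra G' p'\<^esub> R'"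
    using fR by (intro image_genideal_subset[OF h relations_subset[OF R] ideal'(1)]) blast
  from superalgebra_hom_quotient[OF h ideal ideal' this]
  show ?thesis unfolding presented_superalgebra_def presented_class_def .
qed

text \<open>For the generators \<open>k\<^sub>i\<^sup>-\<^sup>1\<close>, on which no value is prescribed.\<close>

lemma ring_hom_inverse_unique:
  assumes h: "superalgebra_hom A B h" and h': "superalgebra_hom A B h'"
    and xy: "x \<in> carrier A" "y \<in> carrier A" "x \<otimes>\<^bsub>A\<^esub> y = \<one>\<^bsub>A\<^esub>" "y \<otimes>\<^bsub>A\<^esub> x = \<one>\<^bsub>A\<^esub>"
    and eq: "h x = h' x"
  shows "h y = h' y"
proof -
  interpret h: superalgebra_hom A B h by fact
  interpret h': superalgebra_hom A B h' by fact
  have "h y \<otimes>\<^bsub>B\<^esub> h x = \<one>\<^bsub>B\<^esub>" "h' x \<otimes>\<^bsub>B\<^esub> h' y = \<one>\<^bsub>B\<^esub>"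
    using ring_hom_mult[OF h.ring_hom xy(2,1)] ring_hom_mult[OF h'.ring_hom xy(1,2)] xy(3,4)
      ring_hom_one[OF h.ring_hom] ring_hom_one[OF h'.ring_hom] by simp_all
  then show ?thesis
    using h.B.inv_unique[of "h y" "h x" "h' y"] eq h.hom_closed[OF xy(1)] h.hom_closed[OF xy(2)]
      h'.hom_closed[OF xy(2)] by simp
qed

section \<open>All quotients of a ring as a single type\<close>

text \<open>The ideals of a type of class \<open>ring\<close>, as opposed to those of a ring given by a carrier.\<close>

definition two_sided_ideal :: "'a::ring set \<Rightarrow> bool"
  where "two_sided_ideal I \<longleftrightarrow>
    0 \<in> I \<and> (\<forall>x\<in>I. \<forall>y\<in>I. x - y \<in> I) \<and> (\<forall>x\<in>I. \<forall>a. a * x \<in> I \<and> x * a \<in> I)"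

lemma two_sided_idealD:
  assumes "two_sided_ideal I"
  shows "0 \<in> I" "x \<in> I \<Longrightarrow> y \<in> I \<Longrightarrow> x - y \<in> I" "x \<in> I \<Longrightarrow> a * x \<in> I" "x \<in> I \<Longrightarrow> x * a \<in> I"
    "x \<in> I \<Longrightarrow> - x \<in> I" "x \<in> I \<Longrightarrow> y \<in> I \<Longrightarrow> x + y \<in> I"
proof -
  show 0: "0 \<in> I" and diff: "x \<in> I \<Longrightarrow> y \<in> I \<Longrightarrow> x - y \<in> I" for x y
    using assms by (auto simp: two_sided_ideal_def)
  show "x \<in> I \<Longrightarrow> a * x \<in> I" "x \<in> I \<Longrightarrow> x * a \<in> I" using assms by (auto simp: two_sided_ideal_def)
  show neg: "x \<in> I \<Longrightarrow> - x \<in> I" for x using diff[OF 0, of x] by simp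
  show "x \<in> I \<Longrightarrow> y \<in> I \<Longrightarrow> x + y \<in> I" using diff[OF _ neg, of x y] by simp
qed

text \<open>The quotient by an ideal that depends on parameters is not a type, but the product of the quotients
  by all two-sided ideals is one: a function chooses a representative for every ideal, and two
  functions are identified if they agree modulo each ideal. Congruences modulo one ideal thus
  become equations in a type of class \<open>ring\<close>.\<close>

quotient_type (overloaded) 'a all_quotients =
  "'a::ring_1 set \<Rightarrow> 'a" / "\<lambda>f g. \<forall>I. two_sided_ideal I \<longrightarrow> f I - g I \<in> I"
proof (rule equivpI)
  show "reflp (\<lambda>f g :: 'a set \<Rightarrow> 'a. \<forall>I. two_sided_ideal I \<longrightarrow> f I - g I \<in> I)"
    by (rule reflpI) (simp add: two_sided_idealD)
  show "symp (\<lambda>f g :: 'a set \<Rightarrow> 'a. \<forall>I. two_sided_ideal I \<longrightarrow> f I - g I \<in> I)"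
    by (rule sympI) (metis two_sided_idealD(5) minus_diff_eq)
  show "transp (\<lambda>f g :: 'a set \<Rightarrow> 'a. \<forall>I. two_sided_ideal I \<longrightarrow> f I - g I \<in> I)"
  proof (rule transpI, intro allI impI)
    fix f g h :: "'a set \<Rightarrow> 'a" and I :: "'a set"
    assume "\<forall>I. two_sided_ideal I \<longrightarrow> f I - g I \<in> I" "\<forall>I. two_sided_ideal I \<longrightarrow> g I - h I \<in> I"
      and I: "two_sided_ideal I"
    then have "(f I - g I) + (g I - h I) \<in> I" by (intro two_sided_idealD(6)) auto
    then show "f I - h I \<in> I" by simp
  qed
qed

instantiation all_quotients :: (ring_1) ring
begin

lift_definition zero_all_quotients :: "'a all_quotients" is "\<lambda>I. 0" .

lift_definition plus_all_quotients :: "'a all_quotients \<Rightarrow> 'a all_quotients \<Rightarrow> 'a all_quotients"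
  is "\<lambda>f g I. f I + g I"
  by (metis (no_types, lifting) add_diff_add two_sided_idealD(6))

lift_definition uminus_all_quotients :: "'a all_quotients \<Rightarrow> 'a all_quotients" is "\<lambda>f I. - f I"
  by (metis (no_types, lifting) minus_diff_minus two_sided_idealD(5))

lift_definition minus_all_quotients :: "'a all_quotients \<Rightarrow> 'a all_quotients \<Rightarrow> 'a all_quotients"
  is "\<lambda>f g I. f I - g I"
proof -
  fix f f' g g' :: "'a set \<Rightarrow> 'a" and I :: "'a set"
  assume "\<And>I. two_sided_ideal I \<Longrightarrow> f I - f' I \<in> I" "\<And>I. two_sided_ideal I \<Longrightarrow> g I - g' I \<in> I"
    and I: "two_sided_ideal I"
  then have "(f I - f' I) - (g I - g' I) \<in> I" by (blast intro: two_sided_idealD(2))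
  moreover have "f I - g I - (f' I - g' I) = (f I - f' I) - (g I - g' I)" by simp
  ultimately show "f I - g I - (f' I - g' I) \<in> I" by (simp only:)
qed

lift_definition times_all_quotients :: "'a all_quotients \<Rightarrow> 'a all_quotients \<Rightarrow> 'a all_quotients"
  is "\<lambda>f g I. f I * g I"
proof -
  fix f f' g g' :: "'a set \<Rightarrow> 'a" and I :: "'a set"
  assume "\<And>I. two_sided_ideal I \<Longrightarrow> f I - f' I \<in> I" "\<And>I. two_sided_ideal I \<Longrightarrow> g I - g' I \<in> I"
    and I: "two_sided_ideal I"
  then have "(f I - f' I) * g I + f' I * (g I - g' I) \<in> I"
    by (intro two_sided_idealD(6) two_sided_idealD(3,4)) auto
  moreover have "f I * g I - f' I * g' I = (f I - f' I) * g I + f' I * (g I - g' I)"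
    by (simp add: algebra_simps)
  ultimately show "f I * g I - f' I * g' I \<in> I" by simp
qed

instance
  by standard (transfer; simp add: two_sided_idealD(1) algebra_simps)+

end

lift_definition left_mult :: "'a::ring_1 \<Rightarrow> 'a all_quotients \<Rightarrow> 'a all_quotients" is "\<lambda>a f I. a * f I"
  by (metis right_diff_distrib two_sided_idealD(3))

text \<open>The quotient by \<open>J\<close> embedded as the factor with index \<open>J\<close>. The map is multiplicative but not
  unital: it sends \<open>1\<close> to the central idempotent that projects onto this factor.\<close>

lift_definition factor :: "'a::ring_1 set \<Rightarrow> 'a \<Rightarrow> 'a all_quotients" is "\<lambda>J x I. if I = J then x else 0" .

lemma factor_hom:
  "factor J (x + y) = factor J x + factor J y" "factor J (x - y) = factor J x - factor J y"
  "factor J (- x) = - factor J x" "factor J (x * y) = factor J x * factor J y"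
  "factor J (a * x) = left_mult a (factor J x)" "factor J 0 = 0"
  by (transfer; simp add: two_sided_idealD(1))+

lemma factor_eq_0_iff: "two_sided_ideal J \<Longrightarrow> factor J x = 0 \<longleftrightarrow> x \<in> J"
  by transfer (auto simp: two_sided_idealD(1))

section \<open>Twisted commutators in an associative algebra\<close>

lemma koszul_simps [simp]: "koszul 0 t = 1" "koszul s 0 = 1" "koszul 1 1 = - 1"
  by (simp_all add: koszul_def)

lemma koszul_commute: "koszul s t = koszul t s"
  by (simp add: koszul_def)

lemma koszul_add_right: "koszul s (t + t') = (koszul s t * koszul s t' :: 'k::field)"
  by (cases s; cases t; cases t') (auto simp: koszul_def)

lemma koszul_square [simp]: "koszul s t * koszul s t = (1 :: 'k::field)"
  by (simp add: koszul_def)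

locale associative_algebra = vector_space scale
  for scale :: "'k::field \<Rightarrow> 'a::ring \<Rightarrow> 'a" (infixr \<open>*s\<close> 75) +
  assumes mult_scale_left: "(c *s x) * y = c *s (x * y)"
    and mult_scale_right: "x * (c *s y) = c *s (x * y)"
begin

lemmas scalar_simps = mult_scale_left mult_scale_right scale_scale scale_right_distrib
  scale_right_diff_distrib

text \<open>The parities are parameters, so that the notion makes sense without a grading on the ring.\<close>

definition supercommute :: "bit \<Rightarrow> bit \<Rightarrow> 'a \<Rightarrow> 'a \<Rightarrow> bool"
  where "supercommute s t x y \<longleftrightarrow> x * y = koszul s t *s (y * x)"

lemma supercommute_sym: "supercommute s t x y \<Longrightarrow> supercommute t s y x"
  by (simp add: supercommute_def koszul_commute[of t s] scalar_simps)

lemma supercommute_mult_right: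
  assumes "supercommute s t x y" "supercommute s t' x y'"
  shows "supercommute s (t + t') x (y * y')"
proof -
  have "x * (y * y') = koszul s t *s (y * (x * y'))"
    using assms(1) by (simp add: supercommute_def mult.assoc[symmetric] scalar_simps)
  then show ?thesis
    using assms(2) unfolding supercommute_def koszul_add_right by (simp add: scalar_simps mult.assoc)
qed

lemma supercommute_mult_left:
  "supercommute s t x y \<Longrightarrow> supercommute s' t x' y \<Longrightarrow> supercommute (s + s') t (x * x') y"
  using supercommute_mult_right supercommute_sym by metis

lemma supercommute_even [simp]:
  "supercommute 0 t x y \<longleftrightarrow> x * y = y * x" "supercommute s 0 x y \<longleftrightarrow> x * y = y * x"
  by (simp_all add: supercommute_def)

text \<open>What the adjoint action of a generator \<open>x\<close> becomes on an element \<open>y\<close> that the Cartan generator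
  multiplies by a scalar; \<open>c\<close> is that scalar times the Koszul sign.\<close>

definition bracket :: "'k \<Rightarrow> 'a \<Rightarrow> 'a \<Rightarrow> 'a"
  where "bracket c x y = x * y - c *s (y * x)"

lemma bracket_twice:
  "bracket d x (bracket c x y) = x * x * y - (c + d) *s (x * y * x) + (c * d) *s (y * x * x)"
  by (simp add: bracket_def scalar_simps algebra_simps scale_left_distrib)

text \<open>Two brackets leave only a multiple of \<open>x y x\<close>, and this is annihilated by \<open>x\<close> on both sides.\<close>

lemma bracket_thrice_square_zero:
  assumes "x * x = 0"
  shows "bracket c'' x (bracket c' x (bracket c x y)) = 0"
proof -
  have "x * (x * z) = 0" for z using assms by (simp add: mult.assoc[symmetric])
  then show ?thesis using assms by (simp add: bracket_def scalar_simps algebra_simps)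
qed

text \<open>The Serre expression is again a twisted commutator, namely \<open>a z - q\<^sup>-\<^sup>1 z a\<close>.\<close>

lemma serre_of_q_commutator:
  assumes z: "a * b - q *s (b * a) = z" and za: "z * a = q *s (a * z)" and q: "q \<noteq> 0"
  shows "a * a * b - (q + inverse q) *s (a * b * a) + b * a * a = 0"
proof -
  have "a * a * b - (q + inverse q) *s (a * b * a) + b * a * a = a * z - inverse q *s (z * a)"
    unfolding z[symmetric] using q by (simp add: scalar_simps algebra_simps scale_left_distrib)
  then show ?thesis using za q by (simp add: scalar_simps)
qed

lemma commute_left: "x * y = y * x \<Longrightarrow> x * (y * z) = y * (x * z)" for x y z :: 'a
  by (simp add: mult.assoc[symmetric])

lemma mult_interchange: "b * c = c * b \<Longrightarrow> (a * b) * (c * x) = (a * c) * (b * x)" for a b c x :: 'a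
  by (simp add: mult.assoc commute_left)

text \<open>The expression equals \<open>V V (a a b - c a b a + b a a) Z\<close>, because \<open>V\<close> and \<open>Z\<close> commute with everything.\<close>

lemma serre_product:
  assumes serre: "a * a * b - c *s (a * b * a) + b * a * a = 0"
    and V: "a * V = V * a" "b * V = V * b" "Z * V = V * Z"
    and Z: "Z * a = a * Z" "Z * b = b * Z"
  shows "(V * a) * (V * a) * (b * Z) - c *s ((V * a) * (b * Z) * (V * a))
    + (b * Z) * (V * a) * (V * a) = 0"
proof -
  have "V * V * (a * a * b - c *s (a * b * a) + b * a * a) * Z = 0"
    unfolding serre by simp
  moreover have "V * V * (a * a * b - c *s (a * b * a) + b * a * a) * Z
    = (V * a) * (V * a) * (b * Z) - c *s ((V * a) * (b * Z) * (V * a)) + (b * Z) * (V * a) * (V * a)"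
    by (simp add: mult.assoc V Z V[THEN commute_left] Z[THEN commute_left] scalar_simps
        distrib_left distrib_right left_diff_distrib right_diff_distrib)
  ultimately show ?thesis by simp
qed

text \<open>In each product the two factors \<open>a\<close> can be moved next to each other at the cost of a scalar.\<close>

lemma square_zero_products:
  assumes a: "a * a = 0" and aV: "a * V = c *s (V * a)" and ax: "a * x = d *s (x * a)"
  shows "(a * V) * (a * V) = 0" and "(a * V) * x * (a * V) = 0"
proof -
  have aa: "a * (a * y) = 0" for y using a by (simp add: mult.assoc[symmetric])
  have aV': "a * (V * y) = c *s (V * (a * y))" for y
    using aV by (simp add: mult.assoc[symmetric] scalar_simps)
  have ax': "a * (x * y) = d *s (x * (a * y))" for y
    using ax by (simp add: mult.assoc[symmetric] scalar_simps)
  show "(a * V) * (a * V) = 0" "(a * V) * x * (a * V) = 0"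
    by (simp_all add: mult.assoc aV' ax' aa scalar_simps)
qed

text \<open>Write \<open>E = a \<eta>\<close>, \<open>B = V b\<close>, \<open>x = \<xi> Z\<close>. In the expansion the terms containing \<open>E B E\<close> vanish since
  \<open>\<eta>\<^sup>2 = 0\<close>. What remains is \<open>k (E x E B + B E x E - (q + q\<^sup>-\<^sup>1) E x B E)\<close>, and moving the even
  letters to the left turns the bracketed factor into a multiple of the Serre expression of \<open>a\<close> and \<open>b\<close>, multiplied by
  \<open>V\<close> on the left and by \<open>\<eta> \<xi> \<eta> Z\<close> on the right.\<close>

lemma extra_serre:
  assumes serre: "a * a * b - (q + inverse q) *s (a * b * a) + b * a * a = 0" and q: "q \<noteq> 0"
    and \<eta>: "\<eta> * \<eta> = 0" and Z\<eta>: "Z * \<eta> = - (k *s (\<eta> * Z))" and k: "k * k = 1"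
    and even: "\<eta> * a = a * \<eta>" "\<eta> * b = b * \<eta>" "\<eta> * V = V * \<eta>"
      "\<xi> * a = a * \<xi>" "\<xi> * b = b * \<xi>" "\<xi> * V = V * \<xi>"
      "Z * a = a * Z" "Z * b = b * Z" "Z * V = V * Z" "a * V = V * a" "b * V = V * b"
  shows "bracket (- k) (a * \<eta>) (bracket q (V * b) (bracket (k * inverse q) (a * \<eta>) (\<xi> * Z))) = 0"
proof -
  note even' = even[THEN commute_left]
  have k': "k * (k * y) = y" for y using k by (simp add: mult.assoc[symmetric])
  have q': "q * (inverse q * inverse q) = inverse q" using q by simp
  have \<eta>': "\<eta> * (\<eta> * y) = 0" for y using \<eta> by (simp add: mult.assoc[symmetric])
  have Z\<eta>': "Z * (\<eta> * y) = - (k *s (\<eta> * (Z * y)))" for y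
    using Z\<eta> by (simp add: mult.assoc[symmetric] scalar_simps)
  have "V * (a * a * b - (q + inverse q) *s (a * b * a) + b * a * a) * \<eta> * \<xi> * \<eta> * Z = 0"
    unfolding serre by simp
  then have key: "V * (a * (a * (b * (\<eta> * (\<xi> * (\<eta> * Z))))))
      = (q + inverse q) *s (V * (a * (b * (a * (\<eta> * (\<xi> * (\<eta> * Z)))))))
        - V * (b * (a * (a * (\<eta> * (\<xi> * (\<eta> * Z))))))"
    by (simp add: mult.assoc scalar_simps distrib_left distrib_right left_diff_distrib
        right_diff_distrib algebra_simps)
  show ?thesis
    by (simp add: bracket_def mult.assoc even even' \<eta> \<eta>' Z\<eta> Z\<eta>' scalar_simps key
        distrib_left distrib_right left_diff_distrib right_diff_distrib)
      (simp add: algebra_simps scale_left_distrib k k' q q')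
qed

lemma inverse_commute:
  assumes xz: "x * z = c *s (z * x)" and c: "c \<noteq> 0"
    and y: "y * x = e" "x * y = e" "e * z = z" "z * e = z" "e * y = y" "y * e = y"
  shows "y * z = inverse c *s (z * y)"
proof -
  have "z * y = (y * x) * (z * y)" using y(1,3) by (simp add: mult.assoc[symmetric])
  also have "\<dots> = y * (x * z) * y" by (simp add: mult.assoc)
  also have "\<dots> = c *s (y * (z * (x * y)))" unfolding xz by (simp add: scalar_simps mult.assoc)
  also have "\<dots> = c *s (y * z)" using y(2,4) by simp
  finally have "z * y = c *s (y * z)" .
  then show ?thesis using c by (simp add: scalar_simps)
qed

text \<open>Stated with commutation instead of conjugation, so that \<open>x\<close> need not be invertible in the ring.\<close>

definition weight :: "'k \<Rightarrow> 'a \<Rightarrow> 'a \<Rightarrow> int \<Rightarrow> bool"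
  where "weight q x z k \<longleftrightarrow> x * z = (q powi k) *s (z * x)"

lemma weight_mult_right:
  "q \<noteq> 0 \<Longrightarrow> weight q x y k \<Longrightarrow> weight q x z l \<Longrightarrow> weight q x (y * z) (k + l)"
  by (simp add: weight_def mult.assoc[symmetric] scalar_simps)
     (simp add: mult.assoc scalar_simps power_int_add mult.commute)

lemma weight_mult_left:
  "q \<noteq> 0 \<Longrightarrow> weight q x z k \<Longrightarrow> weight q y z l \<Longrightarrow> weight q (x * y) z (k + l)"
  by (simp add: weight_def mult.assoc scalar_simps)
     (simp add: mult.assoc[symmetric] scalar_simps power_int_add mult.commute)

lemma weight_scale_left: "weight q x z k \<Longrightarrow> weight q (c *s x) z k"
  by (simp add: weight_def scalar_simps mult.commute)

lemma bracket_scale_right: "bracket c x (d *s y) = d *s bracket c x y"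
  by (simp add: bracket_def scalar_simps mult.commute)

end

section \<open>Deformed oscillators\<close>

text \<open>\<open>1\<close> for bosons, \<open>- 1\<close> for fermions, and \<open>0\<close> for the scalar letter of index \<open>N + 1\<close>.\<close>

definition osc_sign :: "nat \<Rightarrow> nat \<Rightarrow> nat \<Rightarrow> int"
  where "osc_sign m N i = (if i \<le> m then 1 else if i \<le> N then - 1 else 0)"

definition osc_parity :: "nat \<Rightarrow> nat \<Rightarrow> nat \<Rightarrow> bit"
  where "osc_parity m N i = (if m < i \<and> i \<le> N then 1 else 0)"

text \<open>The letters \<open>A i\<close> annihilate, \<open>D i\<close> create, and \<open>wi i\<close> is the inverse of \<open>w i\<close>. Index \<open>N + 1\<close> is a
  fictitious oscillator made of scalars; it gives the last generators \<open>E N = d A N\<close> and \<open>F N = D N\<close>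
  the same shape as the others. The unit of the algebra is an idempotent \<open>e\<close> instead of \<open>1\<close>,
  because the algebra may be a direct factor of the ring. The conditions on \<open>\<kappa>\<close> are those under
  which the commutator of \<open>E i\<close> and \<open>F i\<close> has the required value; \<open>\<kappa> N\<close> and its inverse come from
  separate coefficients, which explains the two conditions at \<open>N\<close>.\<close>

locale deformed_oscillators = associative_algebra scale
  for scale :: "'k::field \<Rightarrow> 'a::ring \<Rightarrow> 'a" (infixr \<open>*s\<close> 75) +
  fixes q d :: 'k and \<kappa> :: "nat \<Rightarrow> 'k" and m N :: nat and e :: 'a and A D w wi :: "nat \<Rightarrow> 'a"
  assumes mN: "1 \<le> m" "m < N" and q: "q \<noteq> 0" "q - inverse q \<noteq> 0" and two: "(2::'k) \<noteq> 0"
    and unit: "i \<in> {1..N+1} \<Longrightarrow> z \<in> {A i, D i, w i, wi i} \<Longrightarrow> e * z = z"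
      "i \<in> {1..N+1} \<Longrightarrow> z \<in> {A i, D i, w i, wi i} \<Longrightarrow> z * e = z"
    and last: "A (N+1) = e" "D (N+1) = d *s e" "w (N+1) = e" "wi (N+1) = e"
    and w_inverse: "i \<in> {1..N+1} \<Longrightarrow> w i * wi i = e" "i \<in> {1..N+1} \<Longrightarrow> wi i * w i = e"
    and w_commute: "i \<in> {1..N+1} \<Longrightarrow> j \<in> {1..N+1} \<Longrightarrow> w i * w j = w j * w i"
    and w_A: "i \<in> {1..N+1} \<Longrightarrow> j \<in> {1..N+1} \<Longrightarrow>
      weight q (w i) (A j) (- (if i = j then osc_sign m N i else 0))"
    and w_D: "i \<in> {1..N+1} \<Longrightarrow> j \<in> {1..N+1} \<Longrightarrow>
      weight q (w i) (D j) (if i = j then osc_sign m N i else 0)"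
    and A_A: "i \<in> {1..N+1} \<Longrightarrow> j \<in> {1..N+1} \<Longrightarrow>
      supercommute (osc_parity m N i) (osc_parity m N j) (A i) (A j)"
    and D_D: "i \<in> {1..N+1} \<Longrightarrow> j \<in> {1..N+1} \<Longrightarrow>
      supercommute (osc_parity m N i) (osc_parity m N j) (D i) (D j)"
    and A_D: "i \<in> {1..N+1} \<Longrightarrow> j \<in> {1..N+1} \<Longrightarrow> i \<noteq> j \<Longrightarrow>
      supercommute (osc_parity m N i) (osc_parity m N j) (A i) (D j)"
    and osc: "i \<in> {1..N} \<Longrightarrow> A i * D i - (of_int (osc_sign m N i) * q) *s (D i * A i) = wi i"
      "i \<in> {1..N} \<Longrightarrow> A i * D i - (of_int (osc_sign m N i) * inverse q) *s (D i * A i) = w i"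
    and \<kappa>: "i \<in> {1..N} \<Longrightarrow> \<kappa> i \<noteq> 0" "i \<in> {1..<N} \<Longrightarrow> \<kappa> i = - of_int (osc_sign m N (i+1))"
      "\<kappa> N = d * (q - 1)" "\<kappa> N * d * (1 - inverse q) = - 1"
begin

definition par :: "nat \<Rightarrow> bit"
  where "par i = osc_parity m N i + osc_parity m N (i+1)"

definition E :: "nat \<Rightarrow> 'a" where "E i = A i * D (i+1)"
definition F :: "nat \<Rightarrow> 'a" where "F i = A (i+1) * D i"
definition K :: "nat \<Rightarrow> 'a" where "K i = \<kappa> i *s (w i * wi (i+1))"
definition Ki :: "nat \<Rightarrow> 'a" where "Ki i = inverse (\<kappa> i) *s (wi i * w (i+1))"

lemma e_e: "e * e = e"
  using unit(1)[of "N+1" e] last by simp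

lemma D_A: "i \<in> {1..N+1} \<Longrightarrow> j \<in> {1..N+1} \<Longrightarrow> i \<noteq> j \<Longrightarrow>
    supercommute (osc_parity m N i) (osc_parity m N j) (D i) (A j)"
  using A_D[of j i] supercommute_sym by blast

lemma wi_w: "i \<in> {1..N+1} \<Longrightarrow> j \<in> {1..N+1} \<Longrightarrow> wi i * w j = w j * wi i"
  using inverse_commute[of "w i" "w j" 1 "wi i" e] w_commute[of i j] w_inverse[of i] unit[of i] unit[of j]
  by simp

lemma wi_wi: "i \<in> {1..N+1} \<Longrightarrow> j \<in> {1..N+1} \<Longrightarrow> wi i * wi j = wi j * wi i"
  using inverse_commute[of "w i" "wi j" 1 "wi i" e] wi_w[of j i] w_inverse[of i] unit[of i] unit[of j]
  by simp

lemma weight_inverse: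
  assumes "i \<in> {1..N+1}" and "weight q (w i) z k" and "e * z = z" "z * e = z"
  shows "weight q (wi i) z (- k)"
  using inverse_commute[of "w i" z "q powi k" "wi i" e] assms w_inverse[of i] unit[of i] q
  by (simp add: weight_def power_int_minus)

lemmas wi_A = weight_inverse[OF _ w_A]
lemmas wi_D = weight_inverse[OF _ w_D]

lemma K_Ki:
  assumes i: "i \<in> {1..N}"
  shows "K i * Ki i = e" "Ki i * K i = e"
proof -
  have j: "i \<in> {1..N+1}" "i + 1 \<in> {1..N+1}" using i by auto
  have "(w i * wi (i+1)) * (wi i * w (i+1)) = (w i * wi i) * (wi (i+1) * w (i+1))"
    "(wi i * w (i+1)) * (w i * wi (i+1)) = (wi i * w i) * (w (i+1) * wi (i+1))"
    using j by (auto intro: mult_interchange simp: wi_wi w_commute)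
  then show "K i * Ki i = e" "Ki i * K i = e"
    using j \<kappa>(1)[OF i] unfolding K_def Ki_def by (simp_all add: scalar_simps w_inverse e_e)
qed

lemma K_commute:
  assumes "i \<in> {1..N}" "j \<in> {1..N}"
  shows "K i * K j = K j * K i"
proof -
  have idx: "i \<in> {1..N+1}" "i + 1 \<in> {1..N+1}" "j \<in> {1..N+1}" "j + 1 \<in> {1..N+1}" using assms by auto
  have "(w i * wi (i+1)) * (w j * wi (j+1)) = (w i * w j) * (wi (i+1) * wi (j+1))"
    using idx by (intro mult_interchange wi_w)
  also have "\<dots> = (w j * w i) * (wi (j+1) * wi (i+1))"
    using idx by (metis w_commute wi_wi)
  also have "\<dots> = (w j * wi (j+1)) * (w i * wi (i+1))"
    using idx by (intro mult_interchange) (metis wi_w)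
  finally show ?thesis by (simp add: K_def scalar_simps mult.commute)
qed

lemma EF_unit:
  assumes "i \<in> {1..N}"
  shows "e * E i = E i" "E i * e = E i" "e * F i = F i" "F i * e = F i"
    "e * K i = K i" "K i * e = K i" "e * Ki i = Ki i" "Ki i * e = Ki i"
proof -
  have idx: "i \<in> {1..N+1}" "i + 1 \<in> {1..N+1}" using assms by auto
  note u = unit[OF idx(1)] unit[OF idx(2)]
  show "e * E i = E i" "E i * e = E i" "e * F i = F i" "F i * e = F i"
    "e * K i = K i" "K i * e = K i" "e * Ki i = Ki i" "Ki i * e = Ki i"
    unfolding E_def F_def K_def Ki_def
    by (simp_all add: scalar_simps u mult.assoc) (simp_all add: u mult.assoc[symmetric])
qed

text \<open>The four contributions of the letters of \<open>w i * wi (i+1)\<close> and \<open>E j\<close> to the weight.\<close>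

definition expo :: "nat \<Rightarrow> nat \<Rightarrow> int"
  where "expo i j = (let \<delta> = (\<lambda>a b. if a = b then osc_sign m N a else 0) in
    - \<delta> i j + \<delta> i (j+1) + \<delta> (i+1) j - \<delta> (i+1) (j+1))"

lemma K_weights:
  assumes "i \<in> {1..N}" "j \<in> {1..N}"
  shows "weight q (K i) (E j) (expo i j)" "weight q (K i) (F j) (- expo i j)"
proof -
  define \<delta> where "\<delta> = (\<lambda>a b. if a = b then osc_sign m N a else 0)"
  have idx: "i \<in> {1..N+1}" "i + 1 \<in> {1..N+1}" "j \<in> {1..N+1}" "j + 1 \<in> {1..N+1}"
    using assms by auto
  have w: "weight q (w a) (A b) (- \<delta> a b)" "weight q (w a) (D b) (\<delta> a b)"
    "weight q (wi a) (A b) (\<delta> a b)" "weight q (wi a) (D b) (- \<delta> a b)"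
    if "a \<in> {1..N+1}" "b \<in> {1..N+1}" for a b
    using w_A[OF that] w_D[OF that] wi_A[OF that(1) that] wi_D[OF that(1) that] unit[OF that(2)]
    by (simp_all add: \<delta>_def)
  have "weight q (K i) (E j) ((- \<delta> i j + \<delta> i (j+1)) + (\<delta> (i+1) j + - \<delta> (i+1) (j+1)))"
    "weight q (K i) (F j) ((- \<delta> i (j+1) + \<delta> i j) + (\<delta> (i+1) (j+1) + - \<delta> (i+1) j))"
    unfolding K_def E_def F_def
    by (intro weight_scale_left weight_mult_left weight_mult_right w idx q)+
  then show "weight q (K i) (E j) (expo i j)" "weight q (K i) (F j) (- expo i j)"
    by (simp_all add: expo_def \<delta>_def[symmetric] Let_def algebra_simps)
qed

text \<open>For \<open>i \<noteq> j\<close> no letter of \<open>E i\<close> meets its own partner in \<open>F j\<close>, so all four pairs supercommute,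
  and Koszul signs are multiplicative.\<close>

lemma E_F_supercommute:
  assumes "i \<in> {1..N}" "j \<in> {1..N}" "i \<noteq> j"
  shows "supercommute (par i) (par j) (E i) (F j)"
proof -
  have idx: "i \<in> {1..N+1}" "i + 1 \<in> {1..N+1}" "j \<in> {1..N+1}" "j + 1 \<in> {1..N+1}" "i + 1 \<noteq> j + 1"
    using assms by auto
  show ?thesis
    unfolding par_def E_def F_def add.commute[of "osc_parity m N j"]
    by (intro supercommute_mult_left supercommute_mult_right A_A D_D A_D D_A idx assms)
qed

lemma E_E_supercommute:
  assumes "i \<in> {1..N}" "j \<in> {1..N}" "i \<noteq> j" "i \<noteq> j + 1" "j \<noteq> i + 1"
  shows "supercommute (par i) (par j) (E i) (E j)" "supercommute (par i) (par j) (F i) (F j)"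
proof -
  have idx: "i \<in> {1..N+1}" "i + 1 \<in> {1..N+1}" "j \<in> {1..N+1}" "j + 1 \<in> {1..N+1}" "i + 1 \<noteq> j + 1"
    "i + 1 \<noteq> j"
    using assms by auto
  show "supercommute (par i) (par j) (E i) (E j)"
    unfolding par_def E_def
    by (intro supercommute_mult_left supercommute_mult_right A_A D_D A_D D_A idx assms)
  show "supercommute (par i) (par j) (F i) (F j)"
    unfolding par_def F_def add.commute[of "osc_parity m N i"] add.commute[of "osc_parity m N j"]
    by (intro supercommute_mult_left supercommute_mult_right A_A D_D A_D D_A idx assms)
qed

text \<open>Subtracting the two oscillator relations isolates \<open>D i * A i\<close>.\<close>

lemma number_operators:
  assumes i: "i \<in> {1..N}"
  shows "D i * A i = (of_int (osc_sign m N i) / (q - inverse q)) *s (w i - wi i)"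
    and "A i * D i = inverse (q - inverse q) *s (q *s w i - inverse q *s wi i)"
proof -
  define s t :: 'k where "s = of_int (osc_sign m N i)" and "t = q - inverse q"
  have s: "s * s = 1" and t: "t \<noteq> 0"
    using i q by (auto simp: s_def t_def osc_sign_def)
  note osc_i = osc[OF i, folded s_def]
  have "w i - wi i = (s * q) *s (D i * A i) - (s * inverse q) *s (D i * A i)"
    by (subst osc_i(1)[symmetric], subst osc_i(2)[symmetric]) simp
  also have "\<dots> = (s * t) *s (D i * A i)"
    by (simp add: t_def right_diff_distrib scale_left_diff_distrib)
  finally have "(s / t) *s (w i - wi i) = ((s * s) * (t / t)) *s (D i * A i)"
    by (simp add: scale_scale)
  then have DA: "D i * A i = (s / t) *s (w i - wi i)" using s t by simp
  then show "D i * A i = (of_int (osc_sign m N i) / (q - inverse q)) *s (w i - wi i)"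
    by (simp add: s_def t_def)
  have "A i * D i = wi i + (s * q) *s (D i * A i)" using osc_i(1) by (simp add: diff_eq_eq)
  also have "\<dots> = (t / t) *s wi i + ((s * s) * (q / t)) *s (w i - wi i)"
    using t by (simp add: DA scale_scale)
  also have "\<dots> = inverse t *s (t *s wi i + q *s (w i - wi i))"
    by (simp add: s scale_right_distrib scale_scale divide_inverse mult.commute)
  also have "t *s wi i + q *s (w i - wi i) = q *s w i - inverse q *s wi i"
    by (simp add: t_def scale_left_diff_distrib scale_right_diff_distrib)
  finally show "A i * D i = inverse (q - inverse q) *s (q *s w i - inverse q *s wi i)"
    by (simp add: t_def)
qed

text \<open>\<open>D j * A j\<close> is even whatever the parity of its letters.\<close>

lemma A_D_swap:
  assumes "i \<in> {1..N+1}" "j \<in> {1..N+1}" "i \<noteq> j"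
  shows "(D j * A j) * D i = D i * (D j * A j)"
proof -
  have "supercommute (osc_parity m N i) (osc_parity m N j + osc_parity m N j) (D i) (D j * A j)"
    by (intro supercommute_mult_right D_D D_A assms)
  moreover have "osc_parity m N j + osc_parity m N j = 0" by simp
  ultimately show ?thesis by (simp only: supercommute_even)
qed

text \<open>\<open>E i * F i\<close> and \<open>F i * E i\<close> regroup into \<open>A i * D i\<close> and \<open>D i * A i\<close> of the two indices involved,
  which are explicit in \<open>w\<close> and \<open>wi\<close>.\<close>

lemma E_F_diagonal:
  assumes i: "i \<in> {1..<N}"
  shows "E i * F i - koszul (par i) (par i) *s (F i * E i) = inverse (q - inverse q) *s (K i - Ki i)"
proof -
  define b where "b = i + 1"
  define s t :: 'k where "s = of_int (osc_sign m N b)" and "t = q - inverse q"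
  have iN: "i \<in> {1..N}" "b \<in> {1..N}" and idx: "i \<in> {1..N+1}" "b \<in> {1..N+1}" "i \<noteq> b"
    using i by (auto simp: b_def)
  have s: "s * s = 1" "inverse s = s" and t: "t \<noteq> 0"
    using iN q by (auto simp: s_def t_def osc_sign_def)
  have sign: "koszul (par i) (par i) = of_int (osc_sign m N i) * s"
    using i mN by (auto simp: s_def b_def par_def osc_parity_def osc_sign_def koszul_def)
  have "E i * F i = A i * ((D b * A b) * D i)" "F i * E i = A b * ((D i * A i) * D b)"
    by (simp_all add: E_def F_def b_def mult.assoc)
  then have EF: "E i * F i = (A i * D i) * (D b * A b)" "F i * E i = (A b * D b) * (D i * A i)"
    using A_D_swap[OF idx] A_D_swap[OF idx(2,1)] idx(3) by (simp_all add: mult.assoc)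
  note c = w_commute[OF idx(1,2)] wi_w[OF idx(1,2)] wi_w[OF idx(2,1)] wi_wi[OF idx(1,2)]
  let ?s = "of_int (osc_sign m N i) :: 'k"
  have ss: "?s * ?s = 1" using iN by (simp add: osc_sign_def)
  have "koszul (par i) (par i) *s (F i * E i)
      = ((?s * ?s) * s * inverse t * inverse t) *s ((q *s w b - inverse q *s wi b) * (w i - wi i))"
    unfolding EF sign number_operators[OF iN(1)] number_operators[OF iN(2)]
    unfolding s_def[symmetric] t_def[symmetric] divide_inverse mult_scale_left mult_scale_right
      scale_scale by (simp only: mult_ac)
  moreover have "E i * F i
      = (s * inverse t * inverse t) *s ((q *s w i - inverse q *s wi i) * (w b - wi b))"
    unfolding EF number_operators[OF iN(1)] number_operators[OF iN(2)]
    unfolding s_def[symmetric] t_def[symmetric] divide_inverse mult_scale_left mult_scale_right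
      scale_scale by (simp only: mult_ac)
  ultimately have "E i * F i - koszul (par i) (par i) *s (F i * E i)
      = (s * inverse t * inverse t) *s ((q *s w i - inverse q *s wi i) * (w b - wi b)
         - (q *s w b - inverse q *s wi b) * (w i - wi i))"
    by (simp add: ss scale_right_diff_distrib)
  also have "(q *s w i - inverse q *s wi i) * (w b - wi b) - (q *s w b - inverse q *s wi b) * (w i - wi i)
      = t *s (wi i * w b - w i * wi b)"
    unfolding t_def by (simp add: left_diff_distrib right_diff_distrib scalar_simps c[symmetric]
        scale_left_diff_distrib)
  also have "(s * inverse t * inverse t) *s t *s (wi i * w b - w i * wi b)
      = inverse t *s (s *s (wi i * w b - w i * wi b))"
    using t by (simp add: scale_scale mult_ac)
  also have "s *s (wi i * w b - w i * wi b) = K i - Ki i"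
    using s(2) unfolding K_def Ki_def \<kappa>(2)[OF i] b_def[symmetric] s_def[symmetric]
    by (simp add: scalar_simps)
  finally show ?thesis unfolding t_def .
qed

lemma E_F_last: "E N * F N + F N * E N = inverse (q - inverse q) *s (K N - Ki N)"
proof -
  have N: "N \<in> {1..N}" "N \<in> {1..N+1}" using mN by auto
  define t where "t = q - inverse q"
  have \<kappa>0: "\<kappa> N \<noteq> 0" using \<kappa>(1)[OF N(1)] .
  have inv: "inverse (\<kappa> N) = - (d * (1 - inverse q))"
    using \<kappa>(4) by (intro inverse_unique) (simp add: mult.assoc)
  have [simp]: "osc_sign m N N = - 1" using mN by (simp add: osc_sign_def)
  have K: "K N = (d * (q - 1)) *s w N" "Ki N = - (d * (1 - inverse q)) *s wi N"
    using unit(2)[OF N(2)] unfolding K_def Ki_def last inv by (simp_all add: \<kappa>(3))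
  have "E N * F N + F N * E N = d *s (A N * D N + D N * A N)"
    using unit[OF N(2)] unfolding E_def F_def last
    by (simp add: scalar_simps mult.assoc) 
  also have "\<dots> = (inverse t * d) *s ((q *s w N - inverse q *s wi N) - (w N - wi N))"
    unfolding number_operators[OF N(1)] t_def[symmetric]
    by (simp add: divide_inverse scalar_simps scale_left_diff_distrib mult_ac)
  also have "\<dots> = inverse t *s (K N - Ki N)"
    by (simp add: K scalar_simps right_diff_distrib scale_left_diff_distrib mult_ac)
  finally show ?thesis unfolding t_def .
qed

text \<open>A fermionic letter anticommutes with itself, and \<open>2\<close> is invertible.\<close>

lemma fermion_square: "i \<in> {m<..N} \<Longrightarrow> A i * A i = 0" "i \<in> {m<..N} \<Longrightarrow> D i * D i = 0"
proof -
  have *: "x = 0" if "x = - x" for x :: 'a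
  proof -
    have "2 *s x = x + x" using scale_left_distrib[of 1 1 x] by simp
    also have "\<dots> = 0" using that by (simp add: eq_neg_iff_add_eq_0)
    finally show ?thesis using two by simp
  qed
  show "A i * A i = 0" "D i * D i = 0" if i: "i \<in> {m<..N}"
    using A_A[of i i] D_D[of i i] i mN by (auto simp: supercommute_def osc_parity_def intro!: *)
qed

lemma boson_commute:
  assumes "i \<in> {1..m}" "j \<in> {1..N+1}"
  shows "A i * A j = A j * A i" "D i * D j = D j * D i" "i \<noteq> j \<Longrightarrow> A i * D j = D j * A i"
    "i \<noteq> j \<Longrightarrow> D i * A j = A j * D i"
  using assms mN A_A[of i j] D_D[of i j] A_D[of i j] D_A[of i j] by (auto simp: osc_parity_def)

text \<open>The one identity to which all Serre relations without a repeated fermion reduce. Both parts are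
  instances of \<open>serre_of_q_commutator\<close> with \<open>z\<close> a multiple of \<open>wi i\<close>; for the second, \<open>q\<close> and its inverse
  change roles.\<close>

lemma boson_serre:
  assumes i: "i \<in> {1..m}"
  shows "A i * A i * D i - (q + inverse q) *s (A i * D i * A i) + D i * A i * A i = 0"
    and "D i * D i * A i - (q + inverse q) *s (D i * A i * D i) + A i * D i * D i = 0"
proof -
  have idx: "i \<in> {1..N}" "i \<in> {1..N+1}" and [simp]: "osc_sign m N i = 1"
    using i mN by (auto simp: osc_sign_def)
  have wi: "wi i * A i = q *s (A i * wi i)" "wi i * D i = inverse q *s (D i * wi i)"
    using wi_A[of i i] wi_D[of i i] idx unit[of i]
    by (simp_all add: weight_def power_int_minus)
  show "A i * A i * D i - (q + inverse q) *s (A i * D i * A i) + D i * A i * A i = 0"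
    using serre_of_q_commutator[OF _ wi(1) q(1)] osc(1)[OF idx(1)] by simp
  have "D i * A i - inverse q *s (A i * D i) = (- inverse q) *s wi i"
    unfolding osc(1)[OF idx(1), symmetric] using q by (simp add: scalar_simps)
  from serre_of_q_commutator[OF this] wi(2) q(1)
  show "D i * D i * A i - (q + inverse q) *s (D i * A i * D i) + A i * D i * D i = 0"
    by (simp add: scalar_simps add.commute mult.commute)
qed

lemma boson_quantum_serre:
  assumes i: "i \<in> {1..<m}" and j: "j \<in> {1..N}" "j = i + 1 \<or> i = j + 1"
  shows "E i * E i * E j - (q + inverse q) *s (E i * E j * E i) + E j * E i * E i = 0"
    and "F i * F i * F j - (q + inverse q) *s (F i * F j * F i) + F j * F i * F i = 0"
proof -
  have b: "i \<in> {1..m}" "i + 1 \<in> {1..m}" and idx: "i \<in> {1..N+1}" "i + 1 \<in> {1..N+1}" "i \<noteq> i + 1"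
    using i mN by auto
  note b1 = boson_commute[OF b(1)] and b2 = boson_commute[OF b(2)]
  have E: "E i = A i * D (i+1)" "E i = D (i+1) * A i" and F: "F i = A (i+1) * D i" "F i = D i * A (i+1)"
    using b1(3,4)[OF idx(2,3)] by (simp_all add: E_def F_def)
  note S = boson_serre[OF b(1)] boson_serre[OF b(2)]
  have c: "A i * A (i+1) = A (i+1) * A i" "D i * D (i+1) = D (i+1) * D i"
    "A i * D (i+1) = D (i+1) * A i" "D i * A (i+1) = A (i+1) * D i"
    using b1(1,2)[OF idx(2)] b1(3,4)[OF idx(2,3)] .
  show "E i * E i * E j - (q + inverse q) *s (E i * E j * E i) + E j * E i * E i = 0"
  proof (cases "j = i + 1")
    case True
    have k: "i + 2 \<in> {1..N+1}" "i + 1 \<noteq> i + 2" "i \<noteq> i + 2" using True j by auto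
    have j: "E j = A (i+1) * D (i+2)" by (simp add: E_def True)
    note c = c b1(2)[OF k(1)] b1(3)[OF k(1,3)] b2(2)[OF k(1)] b2(3)[OF k(1,2)]
    show ?thesis unfolding E(1) j
      by (rule serre_product[OF S(4)]; (rule c | rule c[symmetric]))
  next
    case False
    then have j: "j \<in> {1..N+1}" "j + 1 = i" "i \<noteq> j" "i + 1 \<noteq> j" using j b mN by auto
    note c = c b1(1)[OF j(1)] b1(4)[OF j(1,3)] b2(1)[OF j(1)] b2(4)[OF j(1,4)]
    have j: "E j = D i * A j" unfolding E_def j(2) by (rule c(6)[symmetric])
    show ?thesis unfolding E(2) j
      by (rule serre_product[OF S(1)]; (rule c | rule c[symmetric]))
  qed
  show "F i * F i * F j - (q + inverse q) *s (F i * F j * F i) + F j * F i * F i = 0"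
  proof (cases "j = i + 1")
    case True
    have k: "i + 2 \<in> {1..N+1}" "i + 1 \<noteq> i + 2" "i \<noteq> i + 2" using True j by auto
    note c = c b1(1)[OF k(1)] b1(4)[OF k(1,3)] b2(1)[OF k(1)] b2(4)[OF k(1,2)]
    have j: "F j = D (i+1) * A (i+2)" using c(8) by (simp add: F_def True)
    show ?thesis unfolding F(2) j
      by (rule serre_product[OF S(3)]; (rule c | rule c[symmetric]))
  next
    case False
    then have j: "j \<in> {1..N+1}" "j + 1 = i" "i \<noteq> j" "i + 1 \<noteq> j" using j b mN by auto
    note c = c b1(2)[OF j(1)] b1(3)[OF j(1,3)] b2(2)[OF j(1)] b2(3)[OF j(1,4)]
    have j: "F j = A i * D j" unfolding F_def j(2) ..
    show ?thesis unfolding F(1) j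
      by (rule serre_product[OF S(2)]; (rule c | rule c[symmetric]))
  qed
qed

text \<open>One of the letters of \<open>E i\<close> and of \<open>F i\<close> is fermionic and has square zero.\<close>

lemma fermionic_node_square:
  assumes i: "i \<in> {m..N}"
  shows "E i * E i = 0" "F i * F i = 0"
proof -
  have idx: "i \<in> {1..N+1}" "i + 1 \<in> {1..N+1}" "i \<noteq> i + 1" "i + 1 \<noteq> i" using i mN by auto
  have AD: "A i * D (i+1) = koszul (osc_parity m N i) (osc_parity m N (i+1)) *s (D (i+1) * A i)"
    using A_D[OF idx(1-3)] by (simp only: supercommute_def)
  have DA: "D i * A (i+1) = koszul (osc_parity m N i) (osc_parity m N (i+1)) *s (A (i+1) * D i)"
    using D_A[OF idx(1-3)] by (simp only: supercommute_def)
  have "E i * E i = 0 \<and> F i * F i = 0"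
  proof (cases "i = m")
    case True
    then have i: "i + 1 \<in> {m<..N}" using mN by auto
    have "D (i+1) * A i = koszul (osc_parity m N (i+1)) (osc_parity m N i) *s (A i * D (i+1))"
      "A (i+1) * D i = koszul (osc_parity m N (i+1)) (osc_parity m N i) *s (D i * A (i+1))"
      using D_A[OF idx(2,1,4)] A_D[OF idx(2,1,4)] by (simp_all only: supercommute_def)
    from square_zero_products(1)[OF fermion_square(2)[OF i] this(1) this(1)]
      square_zero_products(1)[OF fermion_square(1)[OF i] this(2) this(2)]
    show ?thesis unfolding E_def F_def AD by (simp add: scalar_simps)
  next
    case False
    then have i: "i \<in> {m<..N}" using i by auto
    have FA: "F i = koszul (osc_parity m N (i+1)) (osc_parity m N i) *s (D i * A (i+1))"
      using A_D[OF idx(2,1,4)] by (simp only: supercommute_def F_def)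
    from square_zero_products(1)[OF fermion_square(1)[OF i] AD AD]
      square_zero_products(1)[OF fermion_square(2)[OF i] DA DA]
    show ?thesis unfolding FA E_def by (simp add: scalar_simps)
  qed
  then show "E i * E i = 0" "F i * F i = 0" by auto
qed

text \<open>A neighbouring node shares only one index with \<open>i\<close>, so one fermionic letter of \<open>E i\<close> supercommutes
  with all of \<open>E j\<close>, and its two occurrences cancel the product.\<close>

lemma fermion_sandwich:
  assumes i: "i \<in> {m<..<N}" and j: "j \<in> {1..N}" "j = i + 1 \<or> i = j + 1"
  shows "E i * E j * E i = 0" "F i * F j * F i = 0"
proof -
  have idx: "i \<in> {1..N+1}" "i + 1 \<in> {1..N+1}" "j \<in> {1..N+1}" "j + 1 \<in> {1..N+1}"
    "i \<noteq> i + 1" "i + 1 \<noteq> i" and f: "i \<in> {m<..N}" "i + 1 \<in> {m<..N}"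
    using i j mN by auto
  let ?p = "osc_parity m N"
  have AD: "A i * D (i+1) = koszul (?p i) (?p (i+1)) *s (D (i+1) * A i)"
    and DA: "D (i+1) * A i = koszul (?p (i+1)) (?p i) *s (A i * D (i+1))"
    and AD': "A (i+1) * D i = koszul (?p (i+1)) (?p i) *s (D i * A (i+1))"
    and DA': "D i * A (i+1) = koszul (?p i) (?p (i+1)) *s (A (i+1) * D i)"
    using A_D[OF idx(1,2,5)] D_A[OF idx(2,1,6)] A_D[OF idx(2,1,6)] D_A[OF idx(1,2,5)]
    by (simp_all only: supercommute_def)
  have "E i * E j * E i = 0 \<and> F i * F j * F i = 0"
  proof (cases "j = i + 1")
    case True
    have k: "i \<noteq> j" "i \<noteq> j + 1" using True by auto
    have "supercommute (?p i) (?p j + ?p (j+1)) (A i) (E j)"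
      unfolding E_def by (intro supercommute_mult_right A_A A_D idx k)
    then have x: "A i * E j = koszul (?p i) (?p j + ?p (j+1)) *s (E j * A i)"
      by (simp only: supercommute_def)
    have "supercommute (?p i) (?p (j+1) + ?p j) (D i) (F j)"
      unfolding F_def by (intro supercommute_mult_right D_D D_A idx k)
    then have y: "D i * F j = koszul (?p i) (?p (j+1) + ?p j) *s (F j * D i)"
      by (simp only: supercommute_def)
    have F: "F i = koszul (?p (i+1)) (?p i) *s (D i * A (i+1))"
      unfolding F_def by (rule AD')
    show ?thesis
      using square_zero_products(2)[OF fermion_square(1)[OF f(1)] AD x]
        square_zero_products(2)[OF fermion_square(2)[OF f(1)] DA' y]
      unfolding F by (simp add: E_def[of i] scalar_simps)
  next
    case False
    then have k: "i + 1 \<noteq> j" "i + 1 \<noteq> j + 1" using j by auto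
    have "supercommute (?p (i+1)) (?p j + ?p (j+1)) (D (i+1)) (E j)"
      unfolding E_def by (intro supercommute_mult_right D_D D_A idx k)
    then have x: "D (i+1) * E j = koszul (?p (i+1)) (?p j + ?p (j+1)) *s (E j * D (i+1))"
      by (simp only: supercommute_def)
    have "supercommute (?p (i+1)) (?p (j+1) + ?p j) (A (i+1)) (F j)"
      unfolding F_def by (intro supercommute_mult_right A_A A_D idx k)
    then have y: "A (i+1) * F j = koszul (?p (i+1)) (?p (j+1) + ?p j) *s (F j * A (i+1))"
      by (simp only: supercommute_def)
    have E: "E i = koszul (?p i) (?p (i+1)) *s (D (i+1) * A i)"
      unfolding E_def by (rule AD)
    show ?thesis
      using square_zero_products(2)[OF fermion_square(2)[OF f(2)] DA x]
        square_zero_products(2)[OF fermion_square(1)[OF f(2)] AD' y]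
      unfolding E by (simp add: F_def[of i] scalar_simps)
  qed
  then show "E i * E j * E i = 0" "F i * F j * F i = 0" by auto
qed

text \<open>The letters of index \<open>m\<close> form the boson of \<open>extra_serre\<close>, those of index \<open>m + 1\<close> are the fermions
  \<open>\<eta>\<close> and \<open>\<xi>\<close>. Going from \<open>E\<close> to \<open>F\<close> exchanges the roles of \<open>A\<close> and \<open>D\<close>.\<close>

lemma extra_relation:
  assumes m: "m \<ge> 2" and k: "k = koszul 1 (par (m+1))"
  shows "bracket (- k) (E m) (bracket q (E (m-1)) (bracket (k * inverse q) (E m) (E (m+1)))) = 0"
    and "bracket (- k) (F m) (bracket q (F (m-1)) (bracket (k * inverse q) (F m) (F (m+1)))) = 0"
proof -
  let ?p = "osc_parity m N"
  have idx: "m \<in> {1..m}" "m \<in> {1..N+1}" "m + 1 \<in> {1..N+1}" "m + 2 \<in> {1..N+1}" "m - 1 \<in> {1..m}"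
    "m - 1 \<in> {1..N+1}" "m + 1 \<in> {m<..N}" "m - 1 + 1 = m" "m + 1 \<noteq> m + 2"
    using m mN by auto
  have kk: "k * k = 1" and k': "koszul 1 (?p (m+2)) = - k"
    using mN by (auto simp: k par_def osc_parity_def koszul_def)
  have p1: "?p (m+1) = 1" using mN by (simp add: osc_parity_def)
  note S = boson_serre[OF idx(1)]
  have Z: "D (m+2) * D (m+1) = - (k *s (D (m+1) * D (m+2)))"
    "A (m+2) * A (m+1) = - (k *s (A (m+1) * A (m+2)))"
    using D_D[OF idx(4,3)] A_A[OF idx(4,3)]
    unfolding supercommute_def p1 koszul_commute[of _ 1] k' by simp_all
  have ne: "m \<noteq> m + 1" "m \<noteq> m + 2" "m - 1 \<noteq> m" "m - 1 \<noteq> m + 1" "m - 1 \<noteq> m + 2"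
    using m by auto
  note b = boson_commute[OF idx(1)] and b' = boson_commute[OF idx(5)]
  note c = b(1,2)[OF idx(3)] b(3,4)[OF idx(3) ne(1)] b(1,2)[OF idx(4)] b(3,4)[OF idx(4) ne(2)]
    b'(1,2)[OF idx(2)] b'(3,4)[OF idx(2) ne(3)] b'(1,2)[OF idx(3)] b'(3,4)[OF idx(3) ne(4)]
    b'(1,2)[OF idx(4)] b'(3,4)[OF idx(4) ne(5)]
  show "bracket (- k) (E m) (bracket q (E (m-1)) (bracket (k * inverse q) (E m) (E (m+1)))) = 0"
  proof -
    have E: "E m = A m * D (m+1)" "E (m-1) = A (m-1) * D m" "E (m+1) = A (m+1) * D (m+2)"
      using idx(8) by (simp_all add: E_def)
    show ?thesis
      unfolding E
      by (rule extra_serre[OF S(1) q(1) fermion_square(2)[OF idx(7)] Z(1) kk];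
          (rule c | rule c[symmetric]))
  qed
  show "bracket (- k) (F m) (bracket q (F (m-1)) (bracket (k * inverse q) (F m) (F (m+1)))) = 0"
  proof -
    have "A (m+2) * D (m+1) = (- k) *s (D (m+1) * A (m+2))"
      using A_D[OF idx(4,3)] unfolding supercommute_def p1 koszul_commute[of _ 1] k' by simp
    then have F: "F m = D m * A (m+1)" "F (m-1) = D (m-1) * A m" "F (m+1) = (- k) *s (D (m+1) * A (m+2))"
      using idx(8) c(4) c(12) by (simp_all add: F_def)
    have "bracket (- k) (D m * A (m+1)) (bracket q (D (m-1) * A m)
        (bracket (k * inverse q) (D m * A (m+1)) (D (m+1) * A (m+2)))) = 0"
      by (rule extra_serre[OF S(2) q(1) fermion_square(1)[OF idx(7)] Z(2) kk];
          (rule c | rule c[symmetric]))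
    then show ?thesis unfolding F bracket_scale_right by simp
  qed
qed

end

section \<open>Evaluating words in a quotient\<close>

definition scalar_mult :: "'k::field \<Rightarrow> ('g, 'k) free_alg all_quotients \<Rightarrow> ('g, 'k) free_alg all_quotients"
    (infixr \<open>*s\<close> 75)
  where "scalar_mult c = left_mult (Poly_Mapping.single 0 c)"

lemma mult_single_0_left:
  "x * (Poly_Mapping.single 0 c * y) = Poly_Mapping.single 0 c * (x * y)"
  for x y :: "'a::monoid_add \<Rightarrow>\<^sub>0 'b::comm_ring_1"
  by (simp only: mult.assoc[symmetric] single_0_central[of c x])

lemma left_mult_simps:
  "left_mult a (x + y) = left_mult a x + left_mult a y"
  "left_mult (a + b) x = left_mult a x + left_mult b x"
  "left_mult a (left_mult b x) = left_mult (a * b) x"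
  "left_mult 1 x = x"
  "left_mult a x * y = left_mult a (x * y)"
      apply (transfer, simp add: two_sided_idealD(1) distrib_left)
     apply (transfer, simp add: two_sided_idealD(1) distrib_right)
    apply (transfer, simp add: two_sided_idealD(1) mult.assoc)
   apply (transfer, simp add: two_sided_idealD(1))
  apply (transfer, simp add: two_sided_idealD(1) mult.assoc)
  done

lemma left_mult_central:
  assumes "\<And>x y. x * (a * y) = a * (x * y)"
  shows "x * left_mult a y = left_mult a (x * y)"
  by (transfer fixing: a) (simp add: assms two_sided_idealD(1))

lemma associative_algebra_all_quotients: "associative_algebra (scalar_mult :: 'k::field \<Rightarrow> _)"
  by unfold_locales (simp_all add: scalar_mult_def left_mult_simps
      left_mult_central[OF mult_single_0_left] single_add mult_single)

text \<open>The ideal generated by \<open>R\<close> is an ideal only of the subalgebra on the generators \<open>G\<close>. Pulling it back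
  along the projection that kills all other generators gives an ideal of the whole type.\<close>

definition relation_kernel ::
    "'g set \<Rightarrow> ('g \<Rightarrow> bit) \<Rightarrow> ('g, 'k::field) free_alg set \<Rightarrow> ('g, 'k) free_alg set"
  where "relation_kernel G p R =
    {x. subst (\<lambda>g. if g \<in> G then gen g else 0) x \<in> Idl\<^bsub>free_superalgebra G p\<^esub> R}"

text \<open>The class of \<open>x\<close> in the presented algebra, as an element of the ring type of all quotients.\<close>

definition evaluate :: "'g set \<Rightarrow> ('g \<Rightarrow> bit) \<Rightarrow> ('g, 'k::field) free_alg set \<Rightarrow>
    ('g, 'k) free_alg \<Rightarrow> ('g, 'k) free_alg all_quotients"
  where "evaluate G p R = factor (relation_kernel G p R)"

lemma evaluate_hom:
  "evaluate G p R (x + y) = evaluate G p R x + evaluate G p R y"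
  "evaluate G p R (x - y) = evaluate G p R x - evaluate G p R y"
  "evaluate G p R (- x) = - evaluate G p R x"
  "evaluate G p R (x * y) = evaluate G p R x * evaluate G p R y"
  "evaluate G p R (c *\<^sub>F x) = scalar_mult c (evaluate G p R x)"
  "evaluate G p R 0 = 0"
  unfolding evaluate_def scalar_mult_def scal_def by (rule factor_hom)+

lemma subst_restrict:
  assumes "x \<in> carrier (free_superalgebra G p)"
  shows "subst (\<lambda>g. if g \<in> G then gen g else 0) x = x"
  using assms by (induction x rule: free_induct) simp_all

lemma subst_restrict_closed:
  "subst (\<lambda>g. if g \<in> G then gen g else 0) x \<in> carrier (free_superalgebra G p)"
proof -
  have "superalgebra_hom (free_superalgebra UNIV p) (free_superalgebra G p)
      (subst (\<lambda>g. if g \<in> G then gen g else 0 :: ('a, 'b) free_alg))"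
    by (rule superalgebra_hom_subst) (simp add: free_graded)
  from superalgebra_hom.hom_closed[OF this, of x] show ?thesis by (simp add: free_simps)
qed

lemma evaluate_eq_0_iff:
  assumes R: "homogeneous_relations G p R" and x: "x \<in> carrier (free_superalgebra G p)"
  shows "evaluate G p R x = 0 \<longleftrightarrow> x \<in> Idl\<^bsub>free_superalgebra G p\<^esub> R"
proof -
  interpret A: superalgebra "free_superalgebra G p :: ('b, ('a, 'b) free_alg) superalg"
    by (rule superalgebra_free)
  interpret I: ideal "Idl\<^bsub>free_superalgebra G p\<^esub> R" "free_superalgebra G p"
    by (rule ideal_relations[OF R])
  have neg: "\<ominus>\<^bsub>free_superalgebra G p\<^esub> y = - y" if "y \<in> carrier (free_superalgebra G p)"
    for y :: "('a, 'b) free_alg"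
    using that free_closed(4)[OF that] by (intro A.minus_equality) (simp_all add: free_simps)
  have minus: "y - z \<in> Idl\<^bsub>free_superalgebra G p\<^esub> R"
    if "y \<in> Idl\<^bsub>free_superalgebra G p\<^esub> R" "z \<in> Idl\<^bsub>free_superalgebra G p\<^esub> R" for y z
    using I.a_closed[OF that(1) I.a_inv_closed[OF that(2)]] neg[OF I.a_Hcarr[OF that(2)]]
    by (simp add: free_simps(3))
  have "two_sided_ideal (relation_kernel G p R)"
    unfolding two_sided_ideal_def relation_kernel_def
    using I.zero_closed minus I.I_l_closed[OF _ subst_restrict_closed] I.I_r_closed[OF _ subst_restrict_closed]
    by (simp add: free_simps(2,5))
  then show ?thesis
    unfolding evaluate_def by (simp add: factor_eq_0_iff relation_kernel_def subst_restrict[OF x])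
qed

section \<open>The base field\<close>

lemma Fract_one_eq_iff: "Fract a 1 = Fract b 1 \<longleftrightarrow> a = b" for a b :: "'a::idom"
  by (simp add: eq_fract)

lemma Fract_power: "Fract a 1 ^ k = Fract (a ^ k) 1" for a :: "'a::idom"
  by (induction k) (simp_all add: One_fract_def)

lemma qh_power_neq_1:
  assumes "0 < k"
  shows "qh ^ k \<noteq> 1"
proof
  assume "qh ^ k = 1"
  then have "[:0, 1:] ^ k = (1 :: complex poly)"
    by (simp add: qh_def Fract_power One_fract_def Fract_one_eq_iff)
  then have "degree ([:0, 1:] ^ k :: complex poly) = 0" by simp
  then show False using assms by (simp add: degree_power_eq)
qed

lemma qh_nonzero: "qh \<noteq> 0"
  using Fract_one_eq_iff[of "[:0, 1:]" "0 :: complex poly"] by (simp add: qh_def Zero_fract_def)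

lemma qq_nonzero: "qq \<noteq> 0"
  by (simp add: qq_def qh_nonzero)

lemma minus_inverse_nonzero: "x \<noteq> 0 \<Longrightarrow> x * x \<noteq> 1 \<Longrightarrow> x - inverse x \<noteq> 0" for x :: "'a::field"
  by (metis eq_iff_diff_eq_0 right_inverse)

lemma qh_minus_inverse: "qh - inverse qh \<noteq> 0"
  using qh_power_neq_1[of 2] by (intro minus_inverse_nonzero qh_nonzero) (simp add: power2_eq_square)

lemma qq_minus_inverse: "qq - inverse qq \<noteq> 0"
  using qh_power_neq_1[of 4]
  by (intro minus_inverse_nonzero qq_nonzero) (simp add: qq_def power_add[symmetric])

lemma qI_square: "qI * qI = - 1"
  by (simp add: qI_def One_fract_def one_pCons)

lemma qfield_two: "(2 :: qfield) \<noteq> 0"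
proof -
  have "(2 :: qfield) = Fract (1 + 1) 1"
    by (simp only: one_add_one[symmetric] One_fract_def add_fract) simp
  then show ?thesis
    using Fract_one_eq_iff[of "1 + 1" "0 :: complex poly"] by (simp add: Zero_fract_def)
qed

section \<open>The deformed Clifford superalgebra as a system of deformed oscillators\<close>

text \<open>Indices up to \<open>m\<close> are bosons, the next \<open>n\<close> are fermions, and index \<open>m + n + 1\<close> is a scalar. The
  coefficient in the image of \<open>e\<^sub>m\<^sub>+\<^sub>n\<close> is carried by \<open>letter_D\<close> at this last index.\<close>

definition letter_A :: "nat \<Rightarrow> nat \<Rightarrow> nat \<Rightarrow> cl_free"
  where "letter_A m n i = (if i \<le> m then phi i else if i \<le> m + n then psi (i - m) else 1)"

definition spinor_coeff :: qfield
  where "spinor_coeff = qI * inverse (qh - inverse qh)"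

definition letter_D :: "nat \<Rightarrow> nat \<Rightarrow> nat \<Rightarrow> cl_free"
  where "letter_D m n i =
    (if i \<le> m then phiD i else if i \<le> m + n then psiD (i - m) else spinor_coeff *\<^sub>F 1)"

definition letter_w :: "nat \<Rightarrow> nat \<Rightarrow> nat \<Rightarrow> cl_free"
  where "letter_w m n i = (if i \<le> m then gu i else if i \<le> m + n then gv (i - m) else 1)"

definition letter_wi :: "nat \<Rightarrow> nat \<Rightarrow> nat \<Rightarrow> cl_free"
  where "letter_wi m n i = (if i \<le> m then guinv i else if i \<le> m + n then gvinv (i - m) else 1)"

definition cartan_coeff :: "nat \<Rightarrow> nat \<Rightarrow> nat \<Rightarrow> qfield"
  where "cartan_coeff m n i = (if i < m then - 1 else if i < m + n then 1 else qI * qh)"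

lemma homogeneous_relationsI:
  assumes "\<And>r. r \<in> R \<Longrightarrow> \<exists>s. r \<in> grade (free_superalgebra G p) s"
  shows "homogeneous_relations G p R"
  unfolding homogeneous_relations_def
proof
  fix r assume "r \<in> R"
  then obtain s where "r \<in> grade (free_superalgebra G p) s" using assms by blast
  then show "r \<in> grade (free_superalgebra G p) 0 \<union> grade (free_superalgebra G p) 1"
    by (cases s) simp_all
qed

lemma graded_mult:
  "x \<in> grade (free_superalgebra G p) s \<Longrightarrow> y \<in> grade (free_superalgebra G p) t \<Longrightarrow> s + t = u
    \<Longrightarrow> x * y \<in> grade (free_superalgebra G p) u"
  using free_graded_mult by blast

lemma graded_gen: "g \<in> G \<Longrightarrow> p g = s \<Longrightarrow> gen g \<in> grade (free_superalgebra G p) s"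
  and graded_one: "0 = s \<Longrightarrow> 1 \<in> grade (free_superalgebra G p) s"
  by (simp_all add: free_graded(3)) (simp add: free_graded(2) flip: bit_not_one_iff)

text \<open>The parity of a product may be left open while the parities of its factors are determined, and
  compared only at the end.\<close>

lemmas graded_intros = graded_gen graded_one graded_mult free_graded(1,4-7)

lemma homogeneous_cl_rels:
  "homogeneous_relations (bos_gens m \<union> ferm_gens n) cl_parity (cl_rels m n)"
proof (rule homogeneous_relationsI)
  let ?G = "bos_gens m \<union> ferm_gens n"
  let ?H = "{r. \<exists>s. r \<in> grade (free_superalgebra ?G cl_parity) s}"
  have gens: "Phi_gen i \<in> ?G" "PhiD_gen i \<in> ?G" "U_gen i \<in> ?G" "Uinv_gen i \<in> ?G" if "i \<in> {1..m}" for i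
    using that by (auto simp: bos_gens_def)
  have gens': "Psi_gen i \<in> ?G" "PsiD_gen i \<in> ?G" "V_gen i \<in> ?G" "Vinv_gen i \<in> ?G" if "i \<in> {1..n}" for i
    using that by (auto simp: ferm_gens_def)
  have "ferm_rels n \<subseteq> ?H"
    unfolding ferm_rels_def Let_def
    by (intro Un_least subsetI; elim CollectE exE conjE; hypsubst; rule CollectI; rule exI;
        intro graded_intros) (rule refl | rule gens', assumption | simp)+
  moreover have "bos_rels m \<subseteq> ?H"
    unfolding bos_rels_def Let_def
    by (intro Un_least subsetI; elim CollectE exE conjE; hypsubst; rule CollectI; rule exI;
        intro graded_intros) (rule refl | rule gens, assumption | simp)+
  moreover have "gen b * gen c - gen c * gen b \<in> ?H" if "b \<in> bos_gens m" "c \<in> ferm_gens n" for b c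
    apply (rule CollectI, rule exI, intro graded_intros)
    apply (rule refl | rule UnI1, rule that | rule UnI2, rule that | rule add.commute)+
    done
  ultimately show "\<exists>s. r \<in> grade (free_superalgebra ?G cl_parity) s" if "r \<in> cl_rels m n" for r
    using that unfolding cl_rels_def by blast
qed

context
  fixes m n :: nat
begin

abbreviation ev :: "cl_free \<Rightarrow> cl_free all_quotients"
  where "ev \<equiv> evaluate (bos_gens m \<union> ferm_gens n) cl_parity (cl_rels m n)"

interpretation associative_algebra scalar_mult
  by (rule associative_algebra_all_quotients)

lemma ev_relation:
  assumes "r \<in> cl_rels m n"
  shows "ev r = 0"
  using evaluate_eq_0_iff[OF homogeneous_cl_rels] relation_in_ideal[OF homogeneous_cl_rels assms]
    relations_subset[OF homogeneous_cl_rels] assms by blast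

lemmas ev_hom = evaluate_hom[of "bos_gens m \<union> ferm_gens n" cl_parity "cl_rels m n"]

lemma ev_unit: "ev 1 * ev x = ev x" "ev x * ev 1 = ev x"
  by (simp_all add: ev_hom(4)[symmetric])

lemma ev_bosonic:
  assumes "i \<in> {1..m}" "j \<in> {1..m}"
  shows "ev (gu i) * ev (gu j) = ev (gu j) * ev (gu i)"
    "ev (gu i) * ev (guinv i) = ev 1" "ev (guinv i) * ev (gu i) = ev 1"
    "ev (gu i) * ev (phi j) * ev (guinv i) = (qq powi (- (if i = j then 1 else 0))) *s ev (phi j)"
    "ev (gu i) * ev (phiD j) * ev (guinv i) = (qq powi (if i = j then 1 else 0)) *s ev (phiD j)"
    "ev (phi i) * ev (phi j) = ev (phi j) * ev (phi i)"
    "ev (phiD i) * ev (phiD j) = ev (phiD j) * ev (phiD i)"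
    "i \<noteq> j \<Longrightarrow> ev (phi i) * ev (phiD j) = ev (phiD j) * ev (phi i)"
    "ev (phi i) * ev (phiD i) - qq *s (ev (phiD i) * ev (phi i)) = ev (guinv i)"
    "ev (phi i) * ev (phiD i) - inverse qq *s (ev (phiD i) * ev (phi i)) = ev (gu i)"
proof -
  have rel: "ev r = 0" if "r \<in> bos_rels m" for r
    using that by (intro ev_relation) (simp add: cl_rels_def)
  have "ev (gu i * gu j - gu j * gu i) = 0" "ev (gu i * guinv i - 1) = 0" "ev (guinv i * gu i - 1) = 0"
    "ev (gu i * phi j * guinv i - (qq powi (- (if i = j then 1 else 0))) *\<^sub>F phi j) = 0"
    "ev (gu i * phiD j * guinv i - (qq powi (if i = j then 1 else 0)) *\<^sub>F phiD j) = 0"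
    "ev (phi i * phi j - phi j * phi i) = 0" "ev (phiD i * phiD j - phiD j * phiD i) = 0"
    "i \<noteq> j \<Longrightarrow> ev (phi i * phiD j - phiD j * phi i) = 0"
    "ev (phi i * phiD i - qq *\<^sub>F (phiD i * phi i) - guinv i) = 0"
    "ev (phi i * phiD i - inverse qq *\<^sub>F (phiD i * phi i) - gu i) = 0"
    using assms by (intro rel; unfold bos_rels_def Let_def; blast)+
  then show "ev (gu i) * ev (gu j) = ev (gu j) * ev (gu i)"
    "ev (gu i) * ev (guinv i) = ev 1" "ev (guinv i) * ev (gu i) = ev 1"
    "ev (gu i) * ev (phi j) * ev (guinv i) = (qq powi (- (if i = j then 1 else 0))) *s ev (phi j)"
    "ev (gu i) * ev (phiD j) * ev (guinv i) = (qq powi (if i = j then 1 else 0)) *s ev (phiD j)"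
    "ev (phi i) * ev (phi j) = ev (phi j) * ev (phi i)"
    "ev (phiD i) * ev (phiD j) = ev (phiD j) * ev (phiD i)"
    "i \<noteq> j \<Longrightarrow> ev (phi i) * ev (phiD j) = ev (phiD j) * ev (phi i)"
    "ev (phi i) * ev (phiD i) - qq *s (ev (phiD i) * ev (phi i)) = ev (guinv i)"
    "ev (phi i) * ev (phiD i) - inverse qq *s (ev (phiD i) * ev (phi i)) = ev (gu i)"
    by (simp_all only: ev_hom right_minus_eq simp_thms True_implies_equals)
qed

lemma ev_fermionic:
  assumes "i \<in> {1..n}" "j \<in> {1..n}"
  shows "ev (gv i) * ev (gv j) = ev (gv j) * ev (gv i)"
    "ev (gv i) * ev (gvinv i) = ev 1" "ev (gvinv i) * ev (gv i) = ev 1"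
    "ev (gv i) * ev (psi j) * ev (gvinv i) = (qq powi (if i = j then 1 else 0)) *s ev (psi j)"
    "ev (gv i) * ev (psiD j) * ev (gvinv i) = (qq powi (- (if i = j then 1 else 0))) *s ev (psiD j)"
    "ev (psi i) * ev (psi j) = - (ev (psi j) * ev (psi i))"
    "ev (psiD i) * ev (psiD j) = - (ev (psiD j) * ev (psiD i))"
    "i \<noteq> j \<Longrightarrow> ev (psi i) * ev (psiD j) = - (ev (psiD j) * ev (psi i))"
    "ev (psi i) * ev (psiD i) + qq *s (ev (psiD i) * ev (psi i)) = ev (gvinv i)"
    "ev (psi i) * ev (psiD i) + inverse qq *s (ev (psiD i) * ev (psi i)) = ev (gv i)"
proof -
  have rel: "ev r = 0" if "r \<in> ferm_rels n" for r
    using that by (intro ev_relation) (simp add: cl_rels_def)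
  have "ev (gv i * gv j - gv j * gv i) = 0" "ev (gv i * gvinv i - 1) = 0" "ev (gvinv i * gv i - 1) = 0"
    "ev (gv i * psi j * gvinv i - (qq powi (if i = j then 1 else 0)) *\<^sub>F psi j) = 0"
    "ev (gv i * psiD j * gvinv i - (qq powi (- (if i = j then 1 else 0))) *\<^sub>F psiD j) = 0"
    "ev (psi i * psi j + psi j * psi i) = 0" "ev (psiD i * psiD j + psiD j * psiD i) = 0"
    "i \<noteq> j \<Longrightarrow> ev (psi i * psiD j + psiD j * psi i) = 0"
    "ev (psi i * psiD i + qq *\<^sub>F (psiD i * psi i) - gvinv i) = 0"
    "ev (psi i * psiD i + inverse qq *\<^sub>F (psiD i * psi i) - gv i) = 0"
    using assms by (intro rel; unfold ferm_rels_def Let_def; blast)+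
  then show "ev (gv i) * ev (gv j) = ev (gv j) * ev (gv i)"
    "ev (gv i) * ev (gvinv i) = ev 1" "ev (gvinv i) * ev (gv i) = ev 1"
    "ev (gv i) * ev (psi j) * ev (gvinv i) = (qq powi (if i = j then 1 else 0)) *s ev (psi j)"
    "ev (gv i) * ev (psiD j) * ev (gvinv i) = (qq powi (- (if i = j then 1 else 0))) *s ev (psiD j)"
    "ev (psi i) * ev (psi j) = - (ev (psi j) * ev (psi i))"
    "ev (psiD i) * ev (psiD j) = - (ev (psiD j) * ev (psiD i))"
    "i \<noteq> j \<Longrightarrow> ev (psi i) * ev (psiD j) = - (ev (psiD j) * ev (psi i))"
    "ev (psi i) * ev (psiD i) + qq *s (ev (psiD i) * ev (psi i)) = ev (gvinv i)"
    "ev (psi i) * ev (psiD i) + inverse qq *s (ev (psiD i) * ev (psi i)) = ev (gv i)"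
    by (simp_all only: ev_hom right_minus_eq eq_neg_iff_add_eq_0 simp_thms True_implies_equals)
qed

lemma ev_mixed:
  assumes "b \<in> bos_gens m" "c \<in> ferm_gens n"
  shows "ev (gen b) * ev (gen c) = ev (gen c) * ev (gen b)"
proof -
  have "gen b * gen c - gen c * gen b \<in> cl_rels m n"
    unfolding cl_rels_def using assms by blast
  from ev_relation[OF this] show ?thesis by (simp add: ev_hom)
qed

end

context
  fixes m n :: nat
begin

interpretation associative_algebra scalar_mult
  by (rule associative_algebra_all_quotients)

lemma weight_of_conjugation:
  assumes "u * z * v = (q powi k) *s z" "v * u = e" "z * e = z"
  shows "weight q u z k"
proof -
  have "u * z = (u * z * v) * u" using assms(2,3) by (simp add: mult.assoc)
  then show ?thesis unfolding assms(1) weight_def by (simp add: scalar_simps)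
qed

lemma weight_0: "weight q u z 0 \<longleftrightarrow> u * z = z * u"
  by (simp add: weight_def)

lemma letter_simps:
  "i \<in> {1..m} \<Longrightarrow> letter_A m n i = phi i" "i \<in> {1..m} \<Longrightarrow> letter_D m n i = phiD i"
  "i \<in> {1..m} \<Longrightarrow> letter_w m n i = gu i" "i \<in> {1..m} \<Longrightarrow> letter_wi m n i = guinv i"
  "i \<in> {1..m} \<Longrightarrow> osc_parity m (m+n) i = 0" "i \<in> {1..m} \<Longrightarrow> osc_sign m (m+n) i = 1"
  "j \<in> {1..n} \<Longrightarrow> letter_A m n (m+j) = psi j" "j \<in> {1..n} \<Longrightarrow> letter_D m n (m+j) = psiD j"
  "j \<in> {1..n} \<Longrightarrow> letter_w m n (m+j) = gv j" "j \<in> {1..n} \<Longrightarrow> letter_wi m n (m+j) = gvinv j"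
  "j \<in> {1..n} \<Longrightarrow> osc_parity m (m+n) (m+j) = 1" "j \<in> {1..n} \<Longrightarrow> osc_sign m (m+n) (m+j) = - 1"
  "letter_A m n (m+n+1) = 1" "letter_D m n (m+n+1) = spinor_coeff *\<^sub>F 1"
  "letter_w m n (m+n+1) = 1" "letter_wi m n (m+n+1) = 1"
  "osc_parity m (m+n) (m+n+1) = 0" "osc_sign m (m+n) (m+n+1) = 0"
  by (auto simp: letter_A_def letter_D_def letter_w_def letter_wi_def osc_parity_def osc_sign_def)

lemma index_cases:
  assumes "i \<in> {1..m+n+1}"
  obtains (boson) "i \<in> {1..m}" | (fermion) j where "j \<in> {1..n}" "i = m + j" | (last) "i = m + n + 1"
proof -
  have "i \<in> {1..m} \<or> (i - m \<in> {1..n} \<and> i = m + (i - m)) \<or> i = m + n + 1" using assms by auto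
  then show thesis using that by blast
qed

lemma ev_commute:
  assumes "i \<in> {1..m}" "j \<in> {1..n}" "b \<in> {phi i, phiD i, gu i, guinv i}" "c \<in> {psi j, psiD j, gv j, gvinv j}"
  shows "ev m n b * ev m n c = ev m n c * ev m n b"
proof -
  have "b \<in> gen ` bos_gens m" using assms(1,3) by (auto simp: bos_gens_def)
  moreover have "c \<in> gen ` ferm_gens n" using assms(2,4) by (auto simp: ferm_gens_def)
  ultimately show ?thesis by (auto intro: ev_mixed)
qed

lemma ev_mixed_order:
  assumes "i \<in> {1..m}" "j \<in> {1..n}"
  shows "ev m n (psi j) * ev m n (phi i) = ev m n (phi i) * ev m n (psi j)"
    "ev m n (psiD j) * ev m n (phi i) = ev m n (phi i) * ev m n (psiD j)"
    "ev m n (psi j) * ev m n (phiD i) = ev m n (phiD i) * ev m n (psi j)"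
    "ev m n (psiD j) * ev m n (phiD i) = ev m n (phiD i) * ev m n (psiD j)"
    "ev m n (gv j) * ev m n (phi i) = ev m n (phi i) * ev m n (gv j)"
    "ev m n (gv j) * ev m n (phiD i) = ev m n (phiD i) * ev m n (gv j)"
    "ev m n (psi j) * ev m n (gu i) = ev m n (gu i) * ev m n (psi j)"
    "ev m n (psiD j) * ev m n (gu i) = ev m n (gu i) * ev m n (psiD j)"
    "ev m n (gv j) * ev m n (gu i) = ev m n (gu i) * ev m n (gv j)"
  by (rule ev_commute[OF assms, symmetric]; simp)+

lemma ev_weights:
  shows "i \<in> {1..m} \<Longrightarrow> j \<in> {1..m} \<Longrightarrow> weight qq (ev m n (gu i)) (ev m n (phi j)) (- (if i = j then 1 else 0))"
    "i \<in> {1..m} \<Longrightarrow> j \<in> {1..m} \<Longrightarrow> weight qq (ev m n (gu i)) (ev m n (phiD j)) (if i = j then 1 else 0)"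
    "i \<in> {1..n} \<Longrightarrow> j \<in> {1..n} \<Longrightarrow> weight qq (ev m n (gv i)) (ev m n (psi j)) (if i = j then 1 else 0)"
    "i \<in> {1..n} \<Longrightarrow> j \<in> {1..n} \<Longrightarrow> weight qq (ev m n (gv i)) (ev m n (psiD j)) (- (if i = j then 1 else 0))"
  by (rule weight_of_conjugation[OF ev_bosonic(4) ev_bosonic(3) ev_unit(2)]
      weight_of_conjugation[OF ev_bosonic(5) ev_bosonic(3) ev_unit(2)]
      weight_of_conjugation[OF ev_fermionic(4) ev_fermionic(3) ev_unit(2)]
      weight_of_conjugation[OF ev_fermionic(5) ev_fermionic(3) ev_unit(2)]; assumption)+

theorem deformed_oscillators_Cl_q:
  assumes m: "1 \<le> m" and n: "1 \<le> n"
  shows "deformed_oscillators scalar_mult qq spinor_coeff (cartan_coeff m n) m (m + n) (ev m n 1)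
    (\<lambda>i. ev m n (letter_A m n i)) (\<lambda>i. ev m n (letter_D m n i))
    (\<lambda>i. ev m n (letter_w m n i)) (\<lambda>i. ev m n (letter_wi m n i))"
proof
  show "1 \<le> m" "m < m + n" using m n by auto
  show "qq \<noteq> 0" "qq - inverse qq \<noteq> 0" "(2 :: qfield) \<noteq> 0"
    by (rule qq_nonzero qq_minus_inverse qfield_two)+
  show "ev m n (letter_A m n (m + n + 1)) = ev m n 1"
    "ev m n (letter_D m n (m + n + 1)) = spinor_coeff *s ev m n 1"
    "ev m n (letter_w m n (m + n + 1)) = ev m n 1" "ev m n (letter_wi m n (m + n + 1)) = ev m n 1"
    by (simp_all only: letter_simps ev_hom)
  show "cartan_coeff m n i \<noteq> 0" if "i \<in> {1..m + n}" for i
    using qI_square qh_nonzero by (auto simp: cartan_coeff_def)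
  show "cartan_coeff m n i = - of_int (osc_sign m (m + n) (i + 1))" if "i \<in> {1..<m + n}" for i
    using that by (auto simp: cartan_coeff_def osc_sign_def)
  have h: "qh * inverse qh = 1" using qh_nonzero by simp
  \<comment> \<open>Both conditions on the last Cartan coefficient come from \<open>q = qh\<^sup>2\<close>.\<close>
  have "qq - 1 = qh * (qh - inverse qh)" "(1 - inverse qq) * qh = qh - inverse qh"
    using qh_nonzero by (simp_all add: qq_def power2_eq_square field_simps)
  then have *: "spinor_coeff * (qq - 1) = qI * qh * (inverse (qh - inverse qh) * (qh - inverse qh))"
    "qI * qh * spinor_coeff * (1 - inverse qq) = qI * qI * (inverse (qh - inverse qh) * (qh - inverse qh))"
    by (simp_all add: spinor_coeff_def mult_ac)
  then show "cartan_coeff m n (m + n) = spinor_coeff * (qq - 1)"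
    "cartan_coeff m n (m + n) * spinor_coeff * (1 - inverse qq) = - 1"
    using qh_minus_inverse by (simp_all add: cartan_coeff_def qI_square)
  fix i assume i: "i \<in> {1..m + n + 1}"
  show "ev m n 1 * z = z" "z * ev m n 1 = z"
    if "z \<in> {ev m n (letter_A m n i), ev m n (letter_D m n i), ev m n (letter_w m n i), ev m n (letter_wi m n i)}"
    for z using that by (auto simp: ev_unit)
  show "ev m n (letter_w m n i) * ev m n (letter_wi m n i) = ev m n 1"
    "ev m n (letter_wi m n i) * ev m n (letter_w m n i) = ev m n 1"
    using i by (cases rule: index_cases; simp only: letter_simps ev_bosonic ev_fermionic ev_unit)+
  fix j assume j: "j \<in> {1..m + n + 1}"
  have weights: "k \<in> {1..m} \<Longrightarrow> weight qq (ev m n (gu k)) (ev m n (phi k)) (- 1)"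
    "k \<in> {1..m} \<Longrightarrow> weight qq (ev m n (gu k)) (ev m n (phiD k)) 1"
    "k \<in> {1..n} \<Longrightarrow> weight qq (ev m n (gv k)) (ev m n (psi k)) 1"
    "k \<in> {1..n} \<Longrightarrow> weight qq (ev m n (gv k)) (ev m n (psiD k)) (- 1)"
    "k \<in> {1..m} \<Longrightarrow> l \<in> {1..m} \<Longrightarrow> k \<noteq> l \<Longrightarrow> ev m n (gu k) * ev m n (phi l) = ev m n (phi l) * ev m n (gu k)"
    "k \<in> {1..m} \<Longrightarrow> l \<in> {1..m} \<Longrightarrow> k \<noteq> l \<Longrightarrow> ev m n (gu k) * ev m n (phiD l) = ev m n (phiD l) * ev m n (gu k)"
    "k \<in> {1..n} \<Longrightarrow> l \<in> {1..n} \<Longrightarrow> k \<noteq> l \<Longrightarrow> ev m n (gv k) * ev m n (psi l) = ev m n (psi l) * ev m n (gv k)"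
    "k \<in> {1..n} \<Longrightarrow> l \<in> {1..n} \<Longrightarrow> k \<noteq> l \<Longrightarrow> ev m n (gv k) * ev m n (psiD l) = ev m n (psiD l) * ev m n (gv k)"
    for k l
    using ev_weights(1,2)[of k k] ev_weights(3,4)[of k k] apply (simp, simp, simp, simp)
    using ev_weights(1,2)[of k l] ev_weights(3,4)[of k l] by (auto simp: weight_0 simp del: atLeastAtMost_iff)
  have odd: "k \<in> {1..n} \<Longrightarrow> l \<in> {1..n} \<Longrightarrow> supercommute 1 1 (ev m n (psi k)) (ev m n (psi l))"
    "k \<in> {1..n} \<Longrightarrow> l \<in> {1..n} \<Longrightarrow> supercommute 1 1 (ev m n (psiD k)) (ev m n (psiD l))"
    "k \<in> {1..n} \<Longrightarrow> l \<in> {1..n} \<Longrightarrow> k \<noteq> l \<Longrightarrow> supercommute 1 1 (ev m n (psi k)) (ev m n (psiD l))"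
    for k l
    unfolding supercommute_def koszul_simps scale_minus_left scale_one
    by (rule ev_fermionic(6-8); assumption)+
  note simps = letter_simps letter_simps(13-18)[simplified] ev_unit ev_hom(5) scalar_simps weight_0 supercommute_even
  show "ev m n (letter_w m n i) * ev m n (letter_w m n j) = ev m n (letter_w m n j) * ev m n (letter_w m n i)"
    using j by (cases rule: index_cases; cases rule: index_cases[OF i])
      (simp_all add: simps ev_bosonic(1) ev_fermionic(1) ev_mixed_order)
  show "weight qq (ev m n (letter_w m n i)) (ev m n (letter_A m n j)) (- (if i = j then osc_sign m (m + n) i else 0))"
    "weight qq (ev m n (letter_w m n i)) (ev m n (letter_D m n j)) (if i = j then osc_sign m (m + n) i else 0)"
    using j by (cases rule: index_cases; cases rule: index_cases[OF i];
        cases "i = j"; simp add: simps weights ev_mixed_order)+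
  show "supercommute (osc_parity m (m + n) i) (osc_parity m (m + n) j) (ev m n (letter_A m n i)) (ev m n (letter_A m n j))"
    using j by (cases rule: index_cases; cases rule: index_cases[OF i])
      (simp_all add: simps ev_bosonic(6) odd ev_mixed_order)
  show "supercommute (osc_parity m (m + n) i) (osc_parity m (m + n) j) (ev m n (letter_D m n i)) (ev m n (letter_D m n j))"
    using j by (cases rule: index_cases; cases rule: index_cases[OF i])
      (simp_all add: simps ev_bosonic(7) odd ev_mixed_order)
  show "supercommute (osc_parity m (m + n) i) (osc_parity m (m + n) j) (ev m n (letter_A m n i)) (ev m n (letter_D m n j))"
    if "i \<noteq> j"
    using j that by (cases rule: index_cases; cases rule: index_cases[OF i])
      (simp_all add: simps ev_bosonic(8) odd ev_mixed_order)
next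
  fix i assume "i \<in> {1..m + n}"
  then have "i \<in> {1..m + n + 1}" "i \<noteq> m + n + 1" by auto
  then consider "i \<in> {1..m}" | j where "j \<in> {1..n}" "i = m + j"
    by (blast elim: index_cases)
  then show "ev m n (letter_A m n i) * ev m n (letter_D m n i)
      - (of_int (osc_sign m (m + n) i) * qq) *s (ev m n (letter_D m n i) * ev m n (letter_A m n i))
      = ev m n (letter_wi m n i)"
    "ev m n (letter_A m n i) * ev m n (letter_D m n i)
      - (of_int (osc_sign m (m + n) i) * inverse qq) *s (ev m n (letter_D m n i) * ev m n (letter_A m n i))
      = ev m n (letter_w m n i)"
    by (cases; simp add: letter_simps ev_bosonic(9,10) ev_fermionic(9,10))+
qed

end

section \<open>The relations of the quantum supergroup\<close>

text \<open>For \<open>f\<^sub>m\<close> this gives \<open>\<psi>\<^sub>1 \<phi>\<^sub>m\<^sup>\<dagger>\<close>, which is \<open>\<phi>\<^sub>m\<^sup>\<dagger> \<psi>\<^sub>1\<close> up to a relation. The images of \<open>k\<^sub>i\<^sup>-\<^sup>1\<close> are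
  the inverses of those of \<open>k\<^sub>i\<close>.\<close>

fun spin_image :: "nat \<Rightarrow> nat \<Rightarrow> osp_gen \<Rightarrow> cl_free" where
  "spin_image m n (E_gen i) = letter_A m n i * letter_D m n (i + 1)"
| "spin_image m n (F_gen i) = letter_A m n (i + 1) * letter_D m n i"
| "spin_image m n (K_gen i) = cartan_coeff m n i *\<^sub>F (letter_w m n i * letter_wi m n (i + 1))"
| "spin_image m n (Kinv_gen i) =
    inverse (cartan_coeff m n i) *\<^sub>F (letter_wi m n i * letter_w m n (i + 1))"

definition spin_value :: "nat \<Rightarrow> nat \<Rightarrow> osp_free \<Rightarrow> cl_free all_quotients"
  where "spin_value m n x = ev m n (subst (spin_image m n) x)"

lemma parity_of_graded:
  assumes "x \<in> grade (free_superalgebra G p) s" "x \<noteq> 0"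
  shows "parity_of p x = s"
proof -
  obtain w where "w \<in> keys x" using assms(2) by fastforce
  then show ?thesis
    using assms(1) unfolding parity_of_def free_simps(7) by (cases s) auto
qed

lemma osp_gens_mem:
  "E_gen i \<in> osp_gens m n \<longleftrightarrow> i \<in> {1..m+n}" "F_gen i \<in> osp_gens m n \<longleftrightarrow> i \<in> {1..m+n}"
  "K_gen i \<in> osp_gens m n \<longleftrightarrow> i \<in> {1..m+n}" "Kinv_gen i \<in> osp_gens m n \<longleftrightarrow> i \<in> {1..m+n}"
  by (auto simp: osp_gens_def)

context
  fixes m n :: nat
  assumes m: "1 \<le> m" and n: "1 \<le> n"
begin

interpretation O: deformed_oscillators scalar_mult qq spinor_coeff "cartan_coeff m n" m "m + n"
    "ev m n 1" "\<lambda>i. ev m n (letter_A m n i)" "\<lambda>i. ev m n (letter_D m n i)"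
    "\<lambda>i. ev m n (letter_w m n i)" "\<lambda>i. ev m n (letter_wi m n i)"
  by (rule deformed_oscillators_Cl_q[OF m n])

abbreviation osp_grade :: "bit \<Rightarrow> osp_free set"
  where "osp_grade \<equiv> grade (free_superalgebra (osp_gens m n) (osp_parity m n))"

abbreviation cl_grade :: "bit \<Rightarrow> cl_free set"
  where "cl_grade \<equiv> grade (free_superalgebra (bos_gens m \<union> ferm_gens n) cl_parity)"

lemma par_eq: "i \<in> {1..m+n} \<Longrightarrow> osp_parity m n (E_gen i) = O.par i"
    "i \<in> {1..m+n} \<Longrightarrow> osp_parity m n (F_gen i) = O.par i"
  using m n by (auto simp: O.par_def osc_parity_def)

lemma letters_graded:
  assumes "i \<in> {1..m+n+1}"
  shows "letter_A m n i \<in> cl_grade (osc_parity m (m+n) i)" "letter_D m n i \<in> cl_grade (osc_parity m (m+n) i)"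
    "letter_w m n i \<in> cl_grade 0" "letter_wi m n i \<in> cl_grade 0"
  using assms unfolding letter_A_def letter_D_def letter_w_def letter_wi_def osc_parity_def
  by (auto intro!: graded_intros simp: bos_gens_def ferm_gens_def)

lemma spin_image_graded:
  assumes "g \<in> osp_gens m n"
  shows "spin_image m n g \<in> cl_grade (osp_parity m n g)"
proof -
  obtain i where i: "i \<in> {1..m+n}" "g = E_gen i \<or> g = F_gen i \<or> g = K_gen i \<or> g = Kinv_gen i"
    using assms unfolding osp_gens_def by blast
  then have idx: "i \<in> {1..m+n+1}" "i + 1 \<in> {1..m+n+1}" by auto
  note L = letters_graded[OF idx(1)] letters_graded[OF idx(2)]
  note I = free_graded_mult[OF L(1,6)] free_graded_mult[OF L(5,2)]
    free_graded_mult[OF L(3,8)] free_graded_mult[OF L(4,7)]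
  from i(2) show ?thesis
    using I par_eq[OF i(1)]
    by (elim disjE) (simp_all only: spin_image.simps osp_parity.simps O.par_def add.commute add_0
        free_graded(5) simp_thms)
qed

abbreviation H :: "osp_free \<Rightarrow> cl_free all_quotients"
  where "H \<equiv> spin_value m n"

lemma H_hom:
  "H (x + y) = H x + H y" "H (x - y) = H x - H y" "H (x * y) = H x * H y"
  "H (c *\<^sub>F x) = c *s H x" "H 0 = 0" "H 1 = ev m n 1"
  by (simp_all only: spin_value_def subst_add subst_diff subst_mult subst_scal subst_zero subst_one ev_hom)

lemma H_gen: "H (gE i) = O.E i" "H (gF i) = O.F i" "H (gK i) = O.K i" "H (gKinv i) = O.Ki i"
  by (simp_all only: spin_value_def subst_gen spin_image.simps ev_hom O.E_def O.F_def O.K_def O.Ki_def)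

lemma H_unit: "ev m n 1 * H x = H x" "H x * ev m n 1 = H x"
  unfolding spin_value_def by (rule ev_unit)+

lemma K_conjugate:
  assumes i: "i \<in> {1..m+n}" and k: "O.weight qq (O.K i) (H x) k"
  shows "O.K i * H x * O.Ki i = (qq powi k) *s H x" "O.Ki i * H x * O.K i = (qq powi (- k)) *s H x"
proof -
  note K = O.K_Ki[OF i] O.EF_unit(5-8)[OF i] H_unit
  show "O.K i * H x * O.Ki i = (qq powi k) *s H x"
    using k K unfolding O.weight_def by (simp add: O.scalar_simps mult.assoc)
  have "O.Ki i * H x = inverse (qq powi k) *s (H x * O.Ki i)"
    by (rule O.inverse_commute[OF k[unfolded O.weight_def]]; (rule K)?) (simp add: qq_nonzero)
  then show "O.Ki i * H x * O.K i = (qq powi (- k)) *s H x"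
    using K by (simp add: O.scalar_simps mult.assoc power_int_minus)
qed

text \<open>The adjoint action turns into a twisted commutator, because \<open>k\<^sub>i\<close> acts by a scalar.\<close>

lemma H_AdE:
  assumes "i \<in> {1..m+n}" and "O.weight qq (O.K i) (H x) k"
  shows "H (AdE m n i x) = O.bracket (koszul (O.par i) (parity_of (osp_parity m n) x) * qq powi k) (O.E i) (H x)"
  unfolding AdE_def H_hom H_gen O.bracket_def par_eq[OF assms(1)]
  by (simp add: K_conjugate[OF assms] O.scalar_simps)

lemma H_AdF:
  assumes "i \<in> {1..m+n}" and "O.weight qq (O.K i) (H x) (- k)"
  shows "H (AdF m n i x) = O.bracket (koszul (O.par i) (parity_of (osp_parity m n) x) * qq powi k) (O.F i) (H x)"
  unfolding AdF_def H_hom H_gen O.bracket_def par_eq[OF assms(1)]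
  using K_conjugate(2)[OF assms] by (simp add: O.scalar_simps)

lemma weight_bracket:
  assumes "O.weight qq z x k" "O.weight qq z y l"
  shows "O.weight qq z (O.bracket c x y) (k + l)"
proof -
  have "O.weight qq z (x * y) (k + l)" "O.weight qq z (y * x) (k + l)"
    using O.weight_mult_right[OF qq_nonzero assms] O.weight_mult_right[OF qq_nonzero assms(2,1)]
    by (simp_all add: add.commute)
  then show ?thesis
    unfolding O.bracket_def O.weight_def
    by (simp add: left_diff_distrib right_diff_distrib O.scalar_simps mult.commute)
qed

lemma weights: 
  assumes "i \<in> {1..m+n}" "j \<in> {1..m+n}"
  shows "O.weight qq (O.K i) (H (gE j)) (O.expo i j)" "O.weight qq (O.K i) (H (gF j)) (- O.expo i j)"
  unfolding H_gen by (rule O.K_weights[OF assms])+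

lemma weight_AdE:
  assumes "i \<in> {1..m+n}" "k \<in> {1..m+n}" "O.weight qq (O.K i) (H x) a" "O.weight qq (O.K k) (H x) b"
  shows "O.weight qq (O.K k) (H (AdE m n i x)) (O.expo k i + b)"
  unfolding H_AdE[OF assms(1,3)]
  by (rule weight_bracket[OF weights(1)[unfolded H_gen, OF assms(2,1)] assms(4)])

lemma weight_AdF:
  assumes "i \<in> {1..m+n}" "k \<in> {1..m+n}" "O.weight qq (O.K i) (H x) (- a)" "O.weight qq (O.K k) (H x) (- b)"
  shows "O.weight qq (O.K k) (H (AdF m n i x)) (- (O.expo k i + b))"
  unfolding H_AdF[OF assms(1,3)]
  using weight_bracket[OF weights(2)[unfolded H_gen, OF assms(2,1)] assms(4)] by simp

text \<open>The exponent of the oscillator weights is the entry \<open>d\<^sub>i a\<^sub>i\<^sub>j\<close> of the symmetrised Cartan matrix.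
  Since both sides are powers of \<open>qh\<close>, twice these numbers are compared.\<close>

lemma osp_weight: 
  assumes "i \<in> {1..m+n}" "j \<in> {1..m+n}"
  shows "osp_q m n i powi osp_a m n i j = qq powi O.expo i j"
    "osp_q m n i powi (- osp_a m n i j) = qq powi (- O.expo i j)"
proof -
  have "osp_dd m n i * osp_a m n i j = 2 * O.expo i j"
    using assms m n unfolding osp_dd_def osp_a_def O.expo_def osc_sign_def Let_def by auto
  moreover have qq: "qq = qh powi 2" by (simp add: qq_def)
  ultimately show "osp_q m n i powi osp_a m n i j = qq powi O.expo i j"
    by (simp only: osp_q_def qq power_int_mult[symmetric])
  then show "osp_q m n i powi (- osp_a m n i j) = qq powi (- O.expo i j)"
    by (simp add: power_int_minus)
qed

lemma osp_gens_graded: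
  assumes "i \<in> {1..m+n}"
  shows "gE i \<in> osp_grade (O.par i)" "gF i \<in> osp_grade (O.par i)" "gK i \<in> osp_grade 0" "gKinv i \<in> osp_grade 0"
  unfolding free_graded(3) osp_gens_mem par_eq[OF assms] using assms by auto

lemma Ad_graded:
  assumes i: "i \<in> {1..m+n}" and x: "x \<in> osp_grade s"
  shows "AdE m n i x \<in> osp_grade (O.par i + s)" "AdF m n i x \<in> osp_grade (O.par i + s)"
proof -
  note g = osp_gens_graded[OF i]
  have "0 + s + 0 + O.par i = O.par i + s" by (simp only: add_0_left add_0_right add.commute)
  then have "gK i * x * gKinv i * gE i \<in> osp_grade (O.par i + s)" "gKinv i * x * gK i * gF i \<in> osp_grade (O.par i + s)"
    using free_graded_mult[OF free_graded_mult[OF free_graded_mult[OF g(3) x] g(4)] g(1)]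
      free_graded_mult[OF free_graded_mult[OF free_graded_mult[OF g(4) x] g(3)] g(2)] by simp_all
  then show "AdE m n i x \<in> osp_grade (O.par i + s)" "AdF m n i x \<in> osp_grade (O.par i + s)"
    unfolding AdE_def AdF_def using free_graded_mult[OF g(1) x] free_graded_mult[OF g(2) x]
    by (blast intro: free_graded(5,7))+
qed

text \<open>The parity of an element can be read off only if the element is nonzero. This character detects that
  iterated adjoint actions on a generator are nonzero in the free algebra: it sends the Cartan
  generators to \<open>0\<close> and thereby removes the second term of each adjoint action.\<close>

definition character :: "osp_free \<Rightarrow> osp_free"
  where "character = subst (\<lambda>g. case g of E_gen i \<Rightarrow> 1 | F_gen i \<Rightarrow> 1 | K_gen i \<Rightarrow> 0 | Kinv_gen i \<Rightarrow> 0)"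

lemma character_simps:
  "character (gE i) = 1" "character (gF i) = 1"
  "character (AdE m n i x) = character x" "character (AdF m n i x) = character x"
  by (simp_all add: character_def AdE_def AdF_def)

lemma character_nonzero: "character x = 1 \<Longrightarrow> x \<noteq> 0"
  by (auto simp: character_def)

lemma parity_of_gen:
  assumes "j \<in> {1..m+n}"
  shows "parity_of (osp_parity m n) (gE j) = O.par j" "parity_of (osp_parity m n) (gF j) = O.par j"
  using osp_gens_graded[OF assms] character_nonzero character_simps(1,2)
  by (auto intro!: parity_of_graded)

lemma par_values: "i \<in> {1..<m} \<Longrightarrow> O.par i = 0" "O.par m = 1"
  using m n by (auto simp: O.par_def osc_parity_def)

lemma expo_values:
  "i \<in> {1..<m} \<Longrightarrow> O.expo i i = - 2" "i \<in> {1..<m} \<Longrightarrow> O.expo i (i+1) = 1"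
  "i \<in> {1..m} \<Longrightarrow> i = j + 1 \<Longrightarrow> O.expo i j = 1"
  "i \<in> {1..m+n} \<Longrightarrow> j \<in> {1..m+n} \<Longrightarrow> i \<noteq> j \<Longrightarrow> j \<noteq> i + 1 \<Longrightarrow> i \<noteq> j + 1 \<Longrightarrow> O.expo i j = 0"
  "O.expo m (m+1) = - 1" "O.expo m m = 0"
  using m n by (auto simp: O.expo_def osc_sign_def Let_def)

text \<open>For nodes that are not neighbours a single bracket vanishes by supercommutation. On the fermionic
  nodes and on the last node squares vanish. On the bosonic nodes the weights \<open>q\<close> and \<open>q\<^sup>-\<^sup>1\<close> of the two
  brackets give the coefficient \<open>q + q\<^sup>-\<^sup>1\<close> of the quantum Serre relation.\<close>

lemma serre_relations:
  assumes i: "i \<in> {1..m+n}" and j: "j \<in> {1..m+n}" and a: "osp_a m n i i \<noteq> 0" "i \<noteq> j"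
  shows "H ((AdE m n i ^^ nat (1 - osp_a m n i j)) (gE j)) = 0"
    "H ((AdF m n i ^^ nat (1 - osp_a m n i j)) (gF j)) = 0"
proof -
  have im: "i \<noteq> m" using a by (auto simp: osp_a_def)
  note w = weights[OF i j]
  note one = H_AdE[OF i w(1)] H_AdF[OF i w(2)]
  note w2 = weight_AdE[OF i i w(1) w(1)] weight_AdF[OF i i w(2) w(2)]
  note two = H_AdE[OF i w2(1)] H_AdF[OF i w2(2)]
  note three = H_AdE[OF i weight_AdE[OF i i w2(1) w2(1)]] H_AdF[OF i weight_AdF[OF i i w2(2) w2(2)]]
  consider (far) "j \<noteq> i + 1" "i \<noteq> j + 1" | (last) "i = m + n" "i = j + 1"
    | (boson) "i \<in> {1..<m}" "j = i + 1 \<or> i = j + 1" | (fermion) "i \<in> {m<..<m+n}" "j = i + 1 \<or> i = j + 1"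
    using i j im by fastforce
  then have "H ((AdE m n i ^^ nat (1 - osp_a m n i j)) (gE j)) = 0
      \<and> H ((AdF m n i ^^ nat (1 - osp_a m n i j)) (gF j)) = 0"
  proof cases
    case far
    then have "nat (1 - osp_a m n i j) = Suc 0" using a by (simp add: osp_a_def)
    moreover have "O.expo i j = 0" using expo_values(4)[OF i j a(2) far] .
    ultimately show ?thesis
      using O.E_E_supercommute[OF i j a(2) far(2,1)]
      by (simp add: one H_gen parity_of_gen[OF j] O.bracket_def O.supercommute_def)
  next
    case last
    then have "nat (1 - osp_a m n i j) = Suc (Suc (Suc 0))" by (simp add: osp_a_def)
    moreover have "O.E i * O.E i = 0" "O.F i * O.F i = 0"
      using O.fermionic_node_square[of i] last by auto
    ultimately show ?thesis
      by (simp add: three two one H_gen O.bracket_thrice_square_zero)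
  next
    case boson
    then have "nat (1 - osp_a m n i j) = Suc (Suc 0)" using im by (auto simp: osp_a_def)
    moreover have "O.expo i j = 1" "O.expo i i = - 2" using boson expo_values(1-3) by auto
    ultimately show ?thesis
      using O.boson_quantum_serre[OF boson(1) j boson(2)]
      by (simp add: two one H_gen par_values(1)[OF boson(1)] koszul_simps O.bracket_twice
          power_int_minus qq_nonzero)
  next
    case fermion
    then have "nat (1 - osp_a m n i j) = Suc (Suc 0)" using im by (auto simp: osp_a_def)
    moreover have "O.E i * O.E i = 0" "O.F i * O.F i = 0"
      using O.fermionic_node_square[of i] fermion by auto
    ultimately show ?thesis
      using O.fermion_sandwich[OF fermion(1) j fermion(2)]
      by (simp add: two one H_gen O.bracket_twice mult.assoc)
  qed
  then show "H ((AdE m n i ^^ nat (1 - osp_a m n i j)) (gE j)) = 0"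
    "H ((AdF m n i ^^ nat (1 - osp_a m n i j)) (gF j)) = 0" by auto
qed

lemma extra_relations:
  assumes m2: "m \<ge> 2"
  shows "H (AdE m n m (AdE m n (m - 1) (AdE m n m (gE (m + 1))))) = 0"
    "H (AdF m n m (AdF m n (m - 1) (AdF m n m (gF (m + 1))))) = 0"
proof -
  have idx: "m \<in> {1..m+n}" "m - 1 \<in> {1..m+n}" "m + 1 \<in> {1..m+n}" "m - 1 \<in> {1..<m}"
    using m2 n by auto
  define k :: qfield where "k = koszul 1 (O.par (m+1))"
  have ex: "O.expo m (m+1) = - 1" "O.expo (m-1) m = 1" "O.expo (m-1) (m+1) = 0"
    "O.expo m (m-1) = 1" "O.expo m m = 0"
    using expo_values(2)[OF idx(4)] expo_values(3)[of m "m-1"] expo_values(4)[OF idx(2,3)]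
      expo_values(5,6) m2 by auto
  note w1 = weights[OF idx(1,3)] and w1' = weights[OF idx(2,3)]
  note w2 = weight_AdE[OF idx(1,2) w1(1) w1'(1)] weight_AdF[OF idx(1,2) w1(2) w1'(2)]
    and w2' = weight_AdE[OF idx(1,1) w1(1) w1(1)] weight_AdF[OF idx(1,1) w1(2) w1(2)]
  note w3 = weight_AdE[OF idx(2,1) w2(1) w2'(1)] weight_AdF[OF idx(2,1) w2(2) w2'(2)]
  note steps = H_AdE[OF idx(1) w3(1)] H_AdE[OF idx(2) w2(1)] H_AdE[OF idx(1) w1(1)]
    H_AdF[OF idx(1) w3(2)] H_AdF[OF idx(2) w2(2)] H_AdF[OF idx(1) w1(2)]
  \<comment> \<open>The parity of the inner double bracket is \<open>1 + [e\<^sub>m\<^sub>+\<^sub>1]\<close>.\<close>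
  have p: "O.par (m-1) + (O.par m + O.par (m+1)) = 1 + O.par (m+1)"
    by (simp only: par_values(1)[OF idx(4)] par_values(2) add_0)
  have "parity_of (osp_parity m n) (AdE m n (m - 1) (AdE m n m (gE (m + 1)))) = 1 + O.par (m+1)"
    unfolding p[symmetric]
    by (intro parity_of_graded[OF Ad_graded(1)[OF idx(2) Ad_graded(1)[OF idx(1) osp_gens_graded(1)[OF idx(3)]]]]
        character_nonzero) (simp add: character_simps)
  moreover have "parity_of (osp_parity m n) (AdF m n (m - 1) (AdF m n m (gF (m + 1)))) = 1 + O.par (m+1)"
    unfolding p[symmetric]
    by (intro parity_of_graded[OF Ad_graded(2)[OF idx(2) Ad_graded(2)[OF idx(1) osp_gens_graded(2)[OF idx(3)]]]]
        character_nonzero) (simp add: character_simps)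
  moreover have "koszul 1 (1 + O.par (m+1)) = - k"
    unfolding k_def koszul_add_right by simp
  ultimately show "H (AdE m n m (AdE m n (m - 1) (AdE m n m (gE (m + 1))))) = 0"
    "H (AdF m n m (AdF m n (m - 1) (AdF m n m (gF (m + 1))))) = 0"
    using O.extra_relation[OF m2 k_def]
    unfolding steps ex H_gen parity_of_gen[OF idx(3)] par_values(1)[OF idx(4)] par_values(2) koszul_simps k_def[symmetric]
    by (simp_all add: power_int_minus)
qed

lemma osp_rels_cases:
  assumes "r \<in> osp_rels m n"
  obtains (K_inverse) i where "i \<in> {1..m+n}" "r = gK i * gKinv i - 1 \<or> r = gKinv i * gK i - 1"
    | (K_commute) i j where "i \<in> {1..m+n}" "j \<in> {1..m+n}" "r = gK i * gK j - gK j * gK i"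
    | (K_E) i j where "i \<in> {1..m+n}" "j \<in> {1..m+n}"
        "r = gK i * gE j * gKinv i - (osp_q m n i powi osp_a m n i j) *\<^sub>F gE j"
    | (K_F) i j where "i \<in> {1..m+n}" "j \<in> {1..m+n}"
        "r = gK i * gF j * gKinv i - (osp_q m n i powi (- osp_a m n i j)) *\<^sub>F gF j"
    | (E_F) i j where "i \<in> {1..m+n}" "j \<in> {1..m+n}"
        "r = gE i * gF j - koszul (osp_parity m n (E_gen i)) (osp_parity m n (F_gen j)) *\<^sub>F (gF j * gE i)
          - (if i = j then inverse (qq - inverse qq) *\<^sub>F (gK i - gKinv i) else 0)"
    | (square) "r = gE m * gE m \<or> r = gF m * gF m"
    | (serre) i j where "i \<in> {1..m+n}" "j \<in> {1..m+n}" "osp_a m n i i \<noteq> 0" "i \<noteq> j"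
        "r = (AdE m n i ^^ nat (1 - osp_a m n i j)) (gE j) \<or> r = (AdF m n i ^^ nat (1 - osp_a m n i j)) (gF j)"
    | (extra) "m \<ge> 2" "r = AdE m n m (AdE m n (m - 1) (AdE m n m (gE (m + 1))))
        \<or> r = AdF m n m (AdF m n (m - 1) (AdF m n m (gF (m + 1))))"
  using assms unfolding osp_rels_def Let_def
  apply (elim UnE)
            apply blast
           apply blast
          apply blast
         apply blast
        apply blast
       apply blast
      apply blast
     apply blast
    apply blast
  apply (simp only: insert_iff empty_iff split: if_split_asm; blast)
  done

lemma funpow_Ad_graded:
  assumes "i \<in> {1..m+n}" "j \<in> {1..m+n}"
  shows "\<exists>s. (AdE m n i ^^ k) (gE j) \<in> osp_grade s" "\<exists>s. (AdF m n i ^^ k) (gF j) \<in> osp_grade s"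
proof -
  show "\<exists>s. (AdE m n i ^^ k) (gE j) \<in> osp_grade s"
    by (induction k) (auto intro: osp_gens_graded[OF assms(2)] Ad_graded[OF assms(1)])
  show "\<exists>s. (AdF m n i ^^ k) (gF j) \<in> osp_grade s"
    by (induction k) (auto intro: osp_gens_graded[OF assms(2)] Ad_graded[OF assms(1)])
qed

lemma homogeneous_osp_rels: "homogeneous_relations (osp_gens m n) (osp_parity m n) (osp_rels m n)"
proof (rule homogeneous_relationsI)
  fix r assume "r \<in> osp_rels m n"
  then show "\<exists>s. r \<in> osp_grade s"
  proof (cases rule: osp_rels_cases)
    case (K_inverse i)
    note g = osp_gens_graded(3,4)[OF K_inverse(1)]
    show ?thesis
      using K_inverse(2) free_graded_mult[OF g(1) g(2)] free_graded_mult[OF g(2) g(1)]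
      by (auto intro!: exI[of _ 0] free_graded)
  next
    case (K_commute i j)
    note g = osp_gens_graded(3)[OF K_commute(1)] osp_gens_graded(3)[OF K_commute(2)]
    show ?thesis
      using K_commute(3) free_graded_mult[OF g(1) g(2)] free_graded_mult[OF g(2) g(1)]
      by (auto intro!: exI[of _ 0] free_graded)
  next
    case (K_E i j)
    note g = osp_gens_graded(3,4)[OF K_E(1)] osp_gens_graded(1)[OF K_E(2)]
    have "gK i * gE j * gKinv i \<in> osp_grade (O.par j)"
      using free_graded_mult[OF free_graded_mult[OF g(1,3)] g(2)] by (simp only: add_0_left add_0_right)
    then show ?thesis unfolding K_E(3) using g(3) by (blast intro: free_graded(5,7))
  next
    case (K_F i j)
    note g = osp_gens_graded(3,4)[OF K_F(1)] osp_gens_graded(2)[OF K_F(2)]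
    have "gK i * gF j * gKinv i \<in> osp_grade (O.par j)"
      using free_graded_mult[OF free_graded_mult[OF g(1,3)] g(2)] by (simp only: add_0_left add_0_right)
    then show ?thesis unfolding K_F(3) using g(3) by (blast intro: free_graded(5,7))
  next
    case (E_F i j)
    note g = osp_gens_graded[OF E_F(1)] osp_gens_graded[OF E_F(2)]
    have "gE i * gF j \<in> osp_grade (O.par i + O.par j)" "gF j * gE i \<in> osp_grade (O.par i + O.par j)"
      using free_graded_mult[OF g(1,6)] free_graded_mult[OF g(6,1)] by (simp_all only: add.commute)
    moreover have "(if i = j then inverse (qq - inverse qq) *\<^sub>F (gK i - gKinv i) else 0) \<in> osp_grade (O.par i + O.par j)"
    proof (cases "i = j")
      case True
      have "O.par j + O.par j = 0" by simp
      then show ?thesis using True g(3,4) by (simp only: if_True free_graded(5,7) refl)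
    qed (simp add: free_graded(1))
    ultimately show ?thesis unfolding E_F(3) by (blast intro: free_graded(5,7))
  next
    case square
    have "m \<in> {1..m+n}" using m by simp
    note g = osp_gens_graded(1,2)[OF this]
    show ?thesis using square free_graded_mult[OF g(1,1)] free_graded_mult[OF g(2,2)] by blast
  next
    case (serre i j)
    then show ?thesis using funpow_Ad_graded[OF serre(1,2)] by blast
  next
    case extra
    have idx: "m \<in> {1..m+n}" "m - 1 \<in> {1..m+n}" "m + 1 \<in> {1..m+n}" using extra(1) n by auto
    show ?thesis
      using extra(2) Ad_graded[OF idx(1) Ad_graded(1)[OF idx(2) Ad_graded(1)[OF idx(1) osp_gens_graded(1)[OF idx(3)]]]]
        Ad_graded[OF idx(1) Ad_graded(2)[OF idx(2) Ad_graded(2)[OF idx(1) osp_gens_graded(2)[OF idx(3)]]]]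
      by blast
  qed
qed

lemma spin_image_relations:
  assumes "r \<in> osp_rels m n"
  shows "H r = 0"
  using assms
proof (cases rule: osp_rels_cases)
  case (K_inverse i)
  then show ?thesis using O.K_Ki[OF K_inverse(1)] by (auto simp only: H_hom H_gen right_minus_eq)
next
  case (K_commute i j)
  then show ?thesis using O.K_commute[OF K_commute(1,2)] by (simp only: H_hom H_gen right_minus_eq)
next
  case (K_E i j)
  then show ?thesis
    using K_conjugate(1)[OF K_E(1) weights(1)[OF K_E(1,2)]]
    by (simp only: H_hom H_gen right_minus_eq osp_weight)
next
  case (K_F i j)
  then show ?thesis
    using K_conjugate(1)[OF K_F(1) weights(2)[OF K_F(1,2)]]
    by (simp only: H_hom H_gen right_minus_eq osp_weight)
next
  case (E_F i j)
  have "O.E i * O.F j - koszul (O.par i) (O.par j) *s (O.F j * O.E i)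
    = (if i = j then inverse (qq - inverse qq) *s (O.K i - O.Ki i) else 0)"
  proof (cases "i = j")
    case False
    then show ?thesis using O.E_F_supercommute[OF E_F(1,2)] by (simp add: O.supercommute_def)
  next
    case True
    show ?thesis
    proof (cases "i = m + n")
      case True
      moreover have "O.par (m + n) = 1" using m n by (simp add: O.par_def osc_parity_def)
      ultimately show ?thesis using O.E_F_last \<open>i = j\<close> by (simp add: koszul_simps)
    next
      case False
      then show ?thesis using O.E_F_diagonal[of i] E_F(1) \<open>i = j\<close> by simp
    qed
  qed
  then show ?thesis
    unfolding E_F(3) par_eq[OF E_F(1)] par_eq[OF E_F(2)] by (simp add: H_hom H_gen split: if_splits)
next
  case square
  have "m \<in> {m..m+n}" by simp
  then show ?thesis using square O.fermionic_node_square[of m] by (auto simp: H_hom H_gen)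
next
  case (serre i j)
  then show ?thesis using serre_relations[OF serre(1-4)] by auto
next
  case extra
  then show ?thesis using extra_relations[OF extra(1)] by auto
qed

lemma spin_relations_in_ideal:
  assumes "r \<in> osp_rels m n"
  shows "subst (spin_image m n) r \<in>
    Idl\<^bsub>free_superalgebra (bos_gens m \<union> ferm_gens n) cl_parity\<^esub> cl_rels m n"
proof -
  have "superalgebra_hom (free_superalgebra (osp_gens m n) (osp_parity m n))
      (free_superalgebra (bos_gens m \<union> ferm_gens n) cl_parity) (subst (spin_image m n))"
    by (rule superalgebra_hom_subst[OF spin_image_graded])
  from superalgebra_hom.hom_closed[OF this] relations_subset[OF homogeneous_osp_rels] assms
  have "subst (spin_image m n) r \<in> carrier (free_superalgebra (bos_gens m \<union> ferm_gens n) cl_parity)"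
    by blast
  then show ?thesis
    using spin_image_relations[OF assms] evaluate_eq_0_iff[OF homogeneous_cl_rels]
    unfolding spin_value_def by blast
qed

section \<open>The homomorphism to the deformed Clifford superalgebra\<close>

text \<open>The prescribed values, in the uniform notation.\<close>

definition spinorial :: "(osp_free set \<Rightarrow> cl_free set) \<Rightarrow> bool"
  where "spinorial \<pi> \<longleftrightarrow> (\<forall>i\<in>{1..m+n}.
      \<pi> (Uq_class m n (gE i)) = Cl_class m n (spin_image m n (E_gen i))
    \<and> \<pi> (Uq_class m n (gF i)) = Cl_class m n (spin_image m n (F_gen i))
    \<and> \<pi> (Uq_class m n (gK i)) = Cl_class m n (spin_image m n (K_gen i)))"

lemma spinorial_exists:
  "\<exists>\<pi>. \<pi> \<in> extensional (carrier (Uq_osp m n)) \<and> superalgebra_hom (Uq_osp m n) (Cl_q m n) \<pi> \<and> spinorial \<pi>"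
proof -
  obtain \<pi> where "\<pi> \<in> extensional (carrier (Uq_osp m n))" "superalgebra_hom (Uq_osp m n) (Cl_q m n) \<pi>"
    and \<pi>: "\<forall>x\<in>carrier (free_superalgebra (osp_gens m n) (osp_parity m n)).
        \<pi> (Uq_class m n x) = Cl_class m n (subst (spin_image m n) x)"
    using presented_hom_exists[OF homogeneous_osp_rels homogeneous_cl_rels spin_image_graded
        spin_relations_in_ideal]
    unfolding Uq_osp_def Cl_q_def Uq_class_def Cl_class_def by blast
  moreover have "spinorial \<pi>"
    unfolding spinorial_def using \<pi> by (simp add: free_closed osp_gens_mem del: spin_image.simps)
  ultimately show ?thesis by blast
qed

lemma spinorial_unique:
  assumes \<pi>: "superalgebra_hom (Uq_osp m n) (Cl_q m n) \<pi>" "spinorial \<pi>"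
    and \<pi>': "superalgebra_hom (Uq_osp m n) (Cl_q m n) \<pi>'" "spinorial \<pi>'"
    and a: "a \<in> carrier (Uq_osp m n)"
  shows "\<pi> a = \<pi>' a"
proof -
  note R = homogeneous_osp_rels
  have gens: "\<pi> (Uq_class m n (gen g)) = \<pi>' (Uq_class m n (gen g))" if g: "g \<in> osp_gens m n" for g
  proof -
    obtain i where i: "i \<in> {1..m+n}" "g = E_gen i \<or> g = F_gen i \<or> g = K_gen i \<or> g = Kinv_gen i"
      using g unfolding osp_gens_def by blast
    have K: "gK i \<in> carrier (free_superalgebra (osp_gens m n) (osp_parity m n))"
      "gKinv i \<in> carrier (free_superalgebra (osp_gens m n) (osp_parity m n))"
      using i(1) by (simp_all add: free_closed osp_gens_mem)
    have rels: "gK i * gKinv i - 1 \<in> osp_rels m n" "gKinv i * gK i - 1 \<in> osp_rels m n"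
      using i(1) unfolding osp_rels_def Let_def by blast+
    have "\<pi> (Uq_class m n (gK i)) = \<pi>' (Uq_class m n (gK i))"
      using \<pi>(2) \<pi>'(2) i(1) by (simp add: spinorial_def)
    then have "\<pi> (Uq_class m n (gKinv i)) = \<pi>' (Uq_class m n (gKinv i))"
    proof (rule ring_hom_inverse_unique[OF \<pi>(1) \<pi>'(1), rotated 4])
      show "Uq_class m n (gK i) \<in> carrier (Uq_osp m n)" "Uq_class m n (gKinv i) \<in> carrier (Uq_osp m n)"
        using K unfolding Uq_class_def Uq_osp_def presented_carrier[OF R] by blast+
      show "Uq_class m n (gK i) \<otimes>\<^bsub>Uq_osp m n\<^esub> Uq_class m n (gKinv i) = \<one>\<^bsub>Uq_osp m n\<^esub>"
        "Uq_class m n (gKinv i) \<otimes>\<^bsub>Uq_osp m n\<^esub> Uq_class m n (gK i) = \<one>\<^bsub>Uq_osp m n\<^esub>"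
        using relation_in_ideal[OF R rels(1)] relation_in_ideal[OF R rels(2)] K
        unfolding Uq_class_def Uq_osp_def presented_one[OF R]
        by (simp_all add: presented_ops(1)[OF R] presented_class_eq_iff[OF R] free_closed free_closed_mult)
    qed
    then show ?thesis using i \<pi>(2) \<pi>'(2) by (auto simp: spinorial_def)
  qed
  show ?thesis
    using presented_hom_unique[OF R, of "Cl_q m n" \<pi> \<pi>' a] \<pi>(1) \<pi>'(1) gens a
    unfolding Uq_osp_def Uq_class_def by blast
qed

lemma spinorial_iff:
  "spinorial \<pi> \<longleftrightarrow> (\<forall>i\<in>{1..<m}.
          \<pi> (Uq_class m n (gE i)) = Cl_class m n (phi i * phiD (i + 1))
        \<and> \<pi> (Uq_class m n (gF i)) = Cl_class m n (phi (i + 1) * phiD i)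
        \<and> \<pi> (Uq_class m n (gK i)) = Cl_class m n (- (gu i * guinv (i + 1))))
    \<and> \<pi> (Uq_class m n (gE m)) = Cl_class m n (phi m * psiD 1)
    \<and> \<pi> (Uq_class m n (gF m)) = Cl_class m n (phiD m * psi 1)
    \<and> \<pi> (Uq_class m n (gK m)) = Cl_class m n (gu m * gvinv 1)
    \<and> (\<forall>j\<in>{1..<n}.
          \<pi> (Uq_class m n (gE (m + j))) = Cl_class m n (psi j * psiD (j + 1))
        \<and> \<pi> (Uq_class m n (gF (m + j))) = Cl_class m n (psi (j + 1) * psiD j)
        \<and> \<pi> (Uq_class m n (gK (m + j))) = Cl_class m n (gv j * gvinv (j + 1)))
    \<and> \<pi> (Uq_class m n (gE (m + n))) = Cl_class m n ((qI * inverse (qh - inverse qh)) *\<^sub>F psi n)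
    \<and> \<pi> (Uq_class m n (gF (m + n))) = Cl_class m n (psiD n)
    \<and> \<pi> (Uq_class m n (gK (m + n))) = Cl_class m n ((qI * qh) *\<^sub>F gv n)"
  (is "_ \<longleftrightarrow> ?rhs")
proof -
  let ?P = "\<lambda>i. \<pi> (Uq_class m n (gE i)) = Cl_class m n (spin_image m n (E_gen i))
    \<and> \<pi> (Uq_class m n (gF i)) = Cl_class m n (spin_image m n (F_gen i))
    \<and> \<pi> (Uq_class m n (gK i)) = Cl_class m n (spin_image m n (K_gen i))"
  have neg: "(- 1) *\<^sub>F x = - x" for x :: cl_free
    by (metis add.right_inverse neg_eq_iff_add_eq_0 scal_add_left scal_one scal_zero(1))
  have images:
    "i \<in> {1..<m} \<Longrightarrow> spin_image m n (E_gen i) = phi i * phiD (i + 1)"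
    "i \<in> {1..<m} \<Longrightarrow> spin_image m n (F_gen i) = phi (i + 1) * phiD i"
    "i \<in> {1..<m} \<Longrightarrow> spin_image m n (K_gen i) = - (gu i * guinv (i + 1))"
    "spin_image m n (E_gen m) = phi m * psiD 1"
    "spin_image m n (F_gen m) = psi 1 * phiD m"
    "spin_image m n (K_gen m) = gu m * gvinv 1"
    "j \<in> {1..<n} \<Longrightarrow> spin_image m n (E_gen (m + j)) = psi j * psiD (j + 1)"
    "j \<in> {1..<n} \<Longrightarrow> spin_image m n (F_gen (m + j)) = psi (j + 1) * psiD j"
    "j \<in> {1..<n} \<Longrightarrow> spin_image m n (K_gen (m + j)) = gv j * gvinv (j + 1)"
    "spin_image m n (E_gen (m + n)) = (qI * inverse (qh - inverse qh)) *\<^sub>F psi n"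
    "spin_image m n (F_gen (m + n)) = psiD n"
    "spin_image m n (K_gen (m + n)) = (qI * qh) *\<^sub>F gv n" for i j
    using m n by (auto simp: letter_A_def letter_D_def letter_w_def letter_wi_def cartan_coeff_def
        spinor_coeff_def scal_mult_right neg)
  have "phiD m * psi 1 - psi 1 * phiD m \<in> cl_rels m n"
  proof -
    have "PhiD_gen m \<in> bos_gens m" "Psi_gen 1 \<in> ferm_gens n"
      using m n by (auto simp: bos_gens_def ferm_gens_def)
    then show ?thesis unfolding cl_rels_def by blast
  qed
  then have "phiD m * psi 1 - psi 1 * phiD m \<in>
      Idl\<^bsub>free_superalgebra (bos_gens m \<union> ferm_gens n) cl_parity\<^esub> cl_rels m n"
    by (rule relation_in_ideal[OF homogeneous_cl_rels])
  moreover have "phiD m \<in> carrier (free_superalgebra (bos_gens m \<union> ferm_gens n) cl_parity)"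
    "psi 1 \<in> carrier (free_superalgebra (bos_gens m \<union> ferm_gens n) cl_parity)"
    using m n by (auto simp: free_closed bos_gens_def ferm_gens_def)
  ultimately have F: "Cl_class m n (phiD m * psi 1) = Cl_class m n (psi 1 * phiD m)"
    unfolding Cl_class_def by (simp add: presented_class_eq_iff[OF homogeneous_cl_rels] free_closed_mult)
  have "{1..m+n} = {1..<m} \<union> {m} \<union> (\<lambda>j. m + j) ` {1..<n} \<union> {m + n}"
  proof (intro equalityI subsetI)
    fix i assume "i \<in> {1..m+n}"
    then have "i \<in> {1..<m} \<or> i = m \<or> (i = m + (i - m) \<and> i - m \<in> {1..<n}) \<or> i = m + n" by auto
    then show "i \<in> {1..<m} \<union> {m} \<union> (\<lambda>j. m + j) ` {1..<n} \<union> {m + n}" by blast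
  qed (use m n in auto)
  then have "spinorial \<pi> \<longleftrightarrow> (\<forall>i\<in>{1..<m}. ?P i) \<and> ?P m \<and> (\<forall>j\<in>{1..<n}. ?P (m + j)) \<and> ?P (m + n)"
    unfolding spinorial_def by (simp only: ball_Un ball_simps conj_assoc simp_thms)
  also have "\<dots> \<longleftrightarrow> ?rhs"
    unfolding F by (simp only: images conj_assoc cong: ball_cong)
  finally show ?thesis .
qed

end

theorem theorem3p2:
  fixes m n :: nat
  assumes "m \<ge> 1" and "n \<ge> 1"
  shows "\<exists>!\<pi>. \<pi> \<in> extensional (carrier (Uq_osp m n))
    \<and> superalgebra_hom (Uq_osp m n) (Cl_q m n) \<pi>
    \<and> (\<forall>i\<in>{1..<m}.
          \<pi> (Uq_class m n (gE i)) = Cl_class m n (phi i * phiD (i + 1))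
        \<and> \<pi> (Uq_class m n (gF i)) = Cl_class m n (phi (i + 1) * phiD i)
        \<and> \<pi> (Uq_class m n (gK i)) = Cl_class m n (- (gu i * guinv (i + 1))))
    \<and> \<pi> (Uq_class m n (gE m)) = Cl_class m n (phi m * psiD 1)
    \<and> \<pi> (Uq_class m n (gF m)) = Cl_class m n (phiD m * psi 1)
    \<and> \<pi> (Uq_class m n (gK m)) = Cl_class m n (gu m * gvinv 1)
    \<and> (\<forall>j\<in>{1..<n}.
          \<pi> (Uq_class m n (gE (m + j))) = Cl_class m n (psi j * psiD (j + 1))
        \<and> \<pi> (Uq_class m n (gF (m + j))) = Cl_class m n (psi (j + 1) * psiD j)
        \<and> \<pi> (Uq_class m n (gK (m + j))) = Cl_class m n (gv j * gvinv (j + 1)))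
    \<and> \<pi> (Uq_class m n (gE (m + n))) = Cl_class m n ((qI * inverse (qh - inverse qh)) *\<^sub>F psi n)
    \<and> \<pi> (Uq_class m n (gF (m + n))) = Cl_class m n (psiD n)
    \<and> \<pi> (Uq_class m n (gK (m + n))) = Cl_class m n ((qI * qh) *\<^sub>F gv n)"
proof -
  let ?S = "\<lambda>\<pi>. \<pi> \<in> extensional (carrier (Uq_osp m n))
    \<and> superalgebra_hom (Uq_osp m n) (Cl_q m n) \<pi> \<and> spinorial m n \<pi>"
  have "\<exists>!\<pi>. ?S \<pi>"
  proof (rule ex_ex1I)
    show "\<exists>\<pi>. ?S \<pi>" by (rule spinorial_exists[OF assms])
    fix \<pi> \<pi>' assume h: "?S \<pi>" "?S \<pi>'"
    then have "\<pi> a = \<pi>' a" if "a \<in> carrier (Uq_osp m n)" for a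
      using spinorial_unique[OF assms, of \<pi> \<pi>' a] that by simp
    then show "\<pi> = \<pi>'"
      using h extensionalityI[of \<pi> "carrier (Uq_osp m n)" \<pi>'] by blast
  qed
  then show ?thesis unfolding spinorial_iff[OF assms] .
qed

end
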